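(* Let $\eta\in\mathbb{R}$ and $q=m-\frac32$ with $m\in\{2,3,4,\ldots\}$ be fixed, and let $0<c<1$. Write $$F_q(\eta,\beta)=\Gamma\left(m-\tfrac12\right)\left(\frac2\beta\right)^{m-\frac12}\left(F_q^{(P)}(\eta,\beta)+F_q^{(Q)}(\eta,\beta)\right)+F_q^{(R)}(\eta,\beta),$$ with $F_q^{(P)},F_q^{(Q)}$ as defined in the context and $$F_q^{(R)}(\eta,\beta)=\sum_{j=0}^{m-1}(-1)^j\frac{\left(-\frac12\right)_j}{j!}\left(\frac2\beta\right)^{j-\frac12}F_{m-j-1}(\eta).$$ Then, as $\beta\to\infty$, $$F_q^{(P)}(\eta,\beta)\sim A_m\sum_{k=0}^\infty\frac{\widetilde P_{m,k}}{\beta^k}\Psi_k(\eta),\qquad F_q^{(Q)}(\eta,\beta)\sim A_m\sum_{k=0}^\infty\frac{\widetilde Q_{m,k}}{\beta^k}\Phi_k^{(1)}(\eta),$$ where $$\Psi_k(\eta)=\frac{1}{2i}\int_{c-i\infty}^{c+i\infty}\ln s\;e^{\eta s}s^k\frac{ds}{\sin(\pi s)},\qquad \Phi_k^{(1)}(\eta)=\frac{1}{2i}\int_{c-i\infty}^{c+i\infty}e^{\eta s}s^k\frac{ds}{\sin(\pi s)},$$ $$\widetilde P_{m,k}=\frac{2^k\left(m-\frac12\right)_k}{k!\,(m+1)_k},\qquad A_m=\frac{(-1)^{m+1}}{m!\,\Gamma(-\frac12)},$$ $$\widetilde Q_{m,k}=\widetilde P_{m,k}\left(\ln\left(\tfrac2\beta\right)+\psi\left(m-\tfrac12+k\right)-\psi(1+k)-\psi(m+k+1)\right).$$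 (Here $\sim$ means that for every integer $N\ge0$ the remainder after the terms $k=0,\ldots,N-1$ is $\mathcal{O}(\beta^{-N})$ for $F_q^{(P)}$, and $\mathcal{O}(\beta^{-N}\ln\beta)$ for $F_q^{(Q)}$, whose coefficients $\widetilde Q_{m,k}$ depend on $\ln\beta$.)
   Context: The standard and relativistic Fermi-Dirac integrals are $$F_q(\eta)=\int_0^\infty\frac{x^q}{e^{x-\eta}+1}\,dx,\qquad F_q(\eta,\beta)=\int_0^\infty \frac{x^q\sqrt{1+\beta x/2}}{e^{x-\eta}+1}\,dx .$$ $(a)_k$ is the Pochhammer symbol and $\psi=\Gamma'/\Gamma$. With $A_m=\frac{(-1)^{m+1}}{m!\,\Gamma(-\frac12)}$, set $$P_{m,k}=\left(\frac2\beta\right)^k\frac{(m-\frac12)_k}{k!\,(m+1)_k},\qquad Q_{m,k}=P_{m,k}\left(\ln\left(\tfrac2\beta\right)+\psi\left(m-\tfrac12+k\right)-\psi(1+k)-\psi(m+k+1)\right).$$ For $\beta>0$, $0<c<1$ and the principal branch of $\ln s$, define $$F_q^{(P)}(\eta,\beta)=\frac{A_m}{2\pi i}\int_{c-i\infty}^{c+i\infty}e^{\eta s}\frac{\pi}{\sin(\pi s)}\ln s\sum_{k=0}^\infty P_{m,k}s^k\,ds,\qquad F_q^{(Q)}(\eta,\beta)=\frac{A_m}{2\pi i}\int_{c-i\infty}^{c+i\infty}e^{\eta s}\frac{\pi}{\sin(\pi s)}\sum_{k=0}^\infty Q_{m,k}s^k\,ds;$$ the two infinite series converge for all finite complex $s$.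 *)

theory Defs
  imports "HOL-Analysis.Analysis" "HOL-Library.Landau_Symbols"
begin

(* The open half-line makes x powr 0 = 1 throughout; in Isabelle, 0 powr 0 = 0. *)
definition fermi_dirac :: "real \<Rightarrow> real \<Rightarrow> real" where
  "fermi_dirac q \<eta> = (LINT x:{0<..}|lborel. x powr q / (exp (x - \<eta>) + 1))"

definition rel_fermi_dirac :: "real \<Rightarrow> real \<Rightarrow> real \<Rightarrow> real" where
  "rel_fermi_dirac q \<eta> \<beta> =
     (LINT x:{0<..}|lborel. x powr q * sqrt (1 + \<beta> * x / 2) / (exp (x - \<eta>) + 1))"

(* Integral of f from c - i * infinity to c + i * infinity: ds = i dt along s = c + i t.
   All integrands below decay exponentially along the line, so the Lebesgue integral over t
   agrees with the improper one. *)
definition vline_integral :: "real \<Rightarrow> (complex \<Rightarrow> complex) \<Rightarrow> complex" where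
  "vline_integral c f = \<i> * (LINT t|lborel. f (Complex c t))"

definition FD_A :: "nat \<Rightarrow> real" where
  "FD_A m = (-1) ^ (m + 1) / (fact m * Gamma (-1/2))"

definition FD_P :: "nat \<Rightarrow> real \<Rightarrow> nat \<Rightarrow> real" where
  "FD_P m \<beta> k = (2 / \<beta>) ^ k * pochhammer (real m - 1/2) k / (fact k * pochhammer (real m + 1) k)"

definition FD_Q :: "nat \<Rightarrow> real \<Rightarrow> nat \<Rightarrow> real" where
  "FD_Q m \<beta> k = FD_P m \<beta> k *
     (ln (2 / \<beta>) + Digamma (real m - 1/2 + real k) - Digamma (1 + real k)
       - Digamma (real m + real k + 1))"

definition FD_Pt :: "nat \<Rightarrow> nat \<Rightarrow> real" where
  "FD_Pt m k = 2 ^ k * pochhammer (real m - 1/2) k / (fact k * pochhammer (real m + 1) k)"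

definition FD_Qt :: "nat \<Rightarrow> real \<Rightarrow> nat \<Rightarrow> real" where
  "FD_Qt m \<beta> k = FD_Pt m k *
     (ln (2 / \<beta>) + Digamma (real m - 1/2 + real k) - Digamma (1 + real k)
       - Digamma (real m + real k + 1))"

(* The subscript q = m - 3/2 of the three parts below is encoded by m. On complex arguments
   ln is the principal branch. *)
definition F_P :: "nat \<Rightarrow> real \<Rightarrow> real \<Rightarrow> real \<Rightarrow> complex" where
  "F_P m c \<eta> \<beta> = of_real (FD_A m) / (2 * of_real pi * \<i>) *
     vline_integral c (\<lambda>s. exp (of_real \<eta> * s) * (of_real pi / sin (of_real pi * s)) * ln s *
       (\<Sum>k. of_real (FD_P m \<beta> k) * s ^ k))"

definition F_Q :: "nat \<Rightarrow> real \<Rightarrow> real \<Rightarrow> real \<Rightarrow> complex" where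
  "F_Q m c \<eta> \<beta> = of_real (FD_A m) / (2 * of_real pi * \<i>) *
     vline_integral c (\<lambda>s. exp (of_real \<eta> * s) * (of_real pi / sin (of_real pi * s)) *
       (\<Sum>k. of_real (FD_Q m \<beta> k) * s ^ k))"

definition F_R :: "nat \<Rightarrow> real \<Rightarrow> real \<Rightarrow> real" where
  "F_R m \<eta> \<beta> = (\<Sum>j<m. (-1) ^ j * (pochhammer (-1/2) j / fact j) *
     (2 / \<beta>) powr (real j - 1/2) * fermi_dirac (real m - real j - 1) \<eta>)"

definition FD_Psi :: "real \<Rightarrow> real \<Rightarrow> nat \<Rightarrow> complex" where
  "FD_Psi c \<eta> k = 1 / (2 * \<i>) *
     vline_integral c (\<lambda>s. ln s * exp (of_real \<eta> * s) * s ^ k / sin (of_real pi * s))"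

definition FD_Phi1 :: "real \<Rightarrow> real \<Rightarrow> nat \<Rightarrow> complex" where
  "FD_Phi1 c \<eta> k = 1 / (2 * \<i>) *
     vline_integral c (\<lambda>s. exp (of_real \<eta> * s) * s ^ k / sin (of_real pi * s))"

end

theory Submission
  imports Defs "HOL-Complex_Analysis.Complex_Analysis"
begin

text \<open>
  The Fermi function is an inverse Laplace integral of \<open>\<pi> / sin (\<pi> s)\<close>, so by Fubini the relativistic
  integral becomes a line integral against the Laplace transform of \<open>x powr q * sqrt (1 + \<beta> * x / 2)\<close>,
  that is, of \<open>u powr (m - 3/2) * sqrt (1 + u)\<close> at \<open>2 * s / \<beta>\<close>. The connection formula of this transform
  (Kummer's \<open>U\<close> in the logarithmic case) splits off the three parts. For \<open>m = 1\<close> both of its sides solve the same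
  Kummer equation; their Wronskian with the entire solution vanishes by the behaviour at the origin, where the
  constant comes from an elementary antiderivative and \<open>\<Gamma>'(1) = - \<gamma>\<close>. Differentiating in \<open>s\<close> raises \<open>m\<close> by one.
  The two expansions result from integrating the exponential series term by term, since \<open>1 / sin (\<pi> s)\<close> decays
  faster along the line than the tails of the series grow once \<open>\<beta>\<close> is large.
\<close>

section \<open>Laplace transforms on the right half plane\<close>

text \<open>The representation is claimed for every \<beta> > 0, whereas termwise bounds on the two
  series only give exponential growth along the line at a rate proportional to 1 / \<beta>, which 1
  / sin (pi s) outweighs for large \<beta> alone. Integrability is therefore obtained differently:
  Euler's integral bounds the Kummer function in the P part, the integrands of P and Q add up to a
  multiple of a Laplace transform, which is bounded on the line, and the Q part is integrable as a
  difference. Termwise bounds return only in the limit of large \<beta>.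

  The constants have one origin. The transform of u^(m - 3/2) sqrt (1 + u) is Gamma (m - 1/2) U(m -
  1/2, m + 1, z), and A_m is the coefficient of the logarithmic series of this U. Up to sign, Gamma
  (m - 1/2) A_m is the binomial coefficient of 1/2 over m. The terms of F_R stem from the binomial
  expansion of u^(m - 1) sqrt (1 + 1/u) at large u, cut off where the powers of u would become
  negative.\<close>

definition laplace :: "(real \<Rightarrow> real) \<Rightarrow> complex \<Rightarrow> complex" where
  "laplace f z = (LINT u:{0<..}|lborel. of_real (f u) * exp (- (z * of_real u)))"

text \<open>Integrability is required at every positive abscissa, not at a single one; this makes
  the class closed under multiplication by \<open>u\<close>, hence under differentiation of the
  transform, and under scaling of the argument.\<close>

definition laplaceable :: "(real \<Rightarrow> real) \<Rightarrow> bool" where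
  "laplaceable f \<longleftrightarrow> f \<in> borel_measurable borel \<and>
     (\<forall>x>0. set_integrable lborel {0<..} (\<lambda>u. f u * exp (- (x * u))))"

lemma laplaceableD:
  assumes "laplaceable f" "x > 0"
  shows "set_integrable lborel {0<..} (\<lambda>u. f u * exp (- (x * u)))"
  using assms by (auto simp: laplaceable_def)

lemma laplaceable_measurable [measurable_dest]: "laplaceable f \<Longrightarrow> f \<in> borel_measurable borel"
  by (simp add: laplaceable_def)

lemma laplaceable_bound:
  assumes f: "laplaceable f" and g: "g \<in> borel_measurable borel"
    and le: "\<And>u. u > 0 \<Longrightarrow> \<bar>g u\<bar> \<le> C * \<bar>f u\<bar>"
  shows "laplaceable g"
  unfolding laplaceable_def
proof (intro conjI allI impI)
  fix x :: real assume "x > 0"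
  from laplaceableD[OF f this]
  have "set_integrable lborel {0<..} (\<lambda>u. C * (f u * exp (- (x * u))))" by simp
  then show "set_integrable lborel {0<..} (\<lambda>u. g u * exp (- (x * u)))"
  proof (rule set_integrable_bound)
    show "set_borel_measurable lborel {0<..} (\<lambda>u. g u * exp (- (x * u)))"
      using g unfolding set_borel_measurable_def by measurable
    show "AE u in lborel. u \<in> {0<..} \<longrightarrow>
        norm (g u * exp (- (x * u))) \<le> norm (C * (f u * exp (- (x * u))))"
    proof (intro AE_I2 impI)
      fix u :: real assume "u \<in> {0<..}"
      then have "\<bar>g u\<bar> \<le> C * \<bar>f u\<bar>" using le by auto
      also have "\<dots> \<le> \<bar>C\<bar> * \<bar>f u\<bar>" by (intro mult_right_mono) auto
      finally show "norm (g u * exp (- (x * u))) \<le> norm (C * (f u * exp (- (x * u))))"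
        by (simp add: abs_mult mult.assoc[symmetric] mult_right_mono)
    qed
  qed
qed fact

lemma laplaceable_add:
  assumes "laplaceable f" "laplaceable g"
  shows "laplaceable (\<lambda>u. f u + g u)"
  using assms unfolding laplaceable_def by (auto simp: distrib_right intro!: set_integral_add)

lemma laplaceable_cmult:
  assumes "laplaceable f"
  shows "laplaceable (\<lambda>u. C * f u)"
  using assms unfolding laplaceable_def by (auto simp: mult.assoc)

text \<open>Half of the decay pays for the factor \<open>u\<close>; the other half is still an
  admissible Laplace kernel.\<close>

lemma le_exp_half:
  fixes u x :: real
  assumes "x > 0" "u > 0"
  shows "u * exp (- (x * u)) \<le> 2 / x * exp (- (x / 2 * u))"
proof -
  have "x / 2 * u \<le> exp (x / 2 * u)" using exp_ge_add_one_self[of "x / 2 * u"] by linarith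
  then have "u \<le> 2 / x * exp (x / 2 * u)" using assms by (simp add: field_simps)
  then have "u * exp (- (x * u)) \<le> 2 / x * exp (x / 2 * u) * exp (- (x * u))"
    by (intro mult_right_mono) auto
  also have "\<dots> = 2 / x * exp (- (x / 2 * u))" by (simp add: exp_add[symmetric] field_simps)
  finally show ?thesis .
qed

lemma laplaceable_mult_id:
  assumes f: "laplaceable f"
  shows "laplaceable (\<lambda>u. u * f u)"
  unfolding laplaceable_def
proof (intro conjI allI impI)
  have [measurable]: "f \<in> borel_measurable borel" using f by (rule laplaceable_measurable)
  show "(\<lambda>u. u * f u) \<in> borel_measurable borel" by measurable
  fix x :: real assume x: "x > 0"
  then have "x / 2 > 0" by simp
  from laplaceableD[OF f this]
  have "set_integrable lborel {0<..} (\<lambda>u. 2 / x * (f u * exp (- (x / 2 * u))))"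
    by (rule set_integrable_mult_right)
  then show "set_integrable lborel {0<..} (\<lambda>u. u * f u * exp (- (x * u)))"
  proof (rule set_integrable_bound)
    show "set_borel_measurable lborel {0<..} (\<lambda>u. u * f u * exp (- (x * u)))"
      unfolding set_borel_measurable_def by measurable
    show "AE u in lborel. u \<in> {0<..} \<longrightarrow>
        norm (u * f u * exp (- (x * u))) \<le> norm (2 / x * (f u * exp (- (x / 2 * u))))"
    proof (intro AE_I2 impI)
      fix u :: real assume u: "u \<in> {0<..}"
      have "\<bar>f u\<bar> * (u * exp (- (x * u))) \<le> \<bar>f u\<bar> * (2 / x * exp (- (x / 2 * u)))"
        using le_exp_half[OF x, of u] u by (intro mult_left_mono) auto
      then show "norm (u * f u * exp (- (x * u))) \<le> norm (2 / x * (f u * exp (- (x / 2 * u))))"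
        using u x by (simp add: abs_mult mult_ac)
    qed
  qed
qed

lemma norm_exp_laplace: "norm (exp (- (z * complex_of_real u))) = exp (- (Re z * u))"
  by simp

lemma laplace_integrable:
  assumes f: "laplaceable f" and z: "Re z > 0"
  shows "set_integrable lborel {0<..} (\<lambda>u. complex_of_real (f u) * exp (- (z * of_real u)))"
proof (rule set_integrable_bound[OF laplaceableD[OF f z]])
  have [measurable]: "f \<in> borel_measurable borel" using f by (rule laplaceable_measurable)
  show "set_borel_measurable lborel {0<..} (\<lambda>u. complex_of_real (f u) * exp (- (z * of_real u)))"
    unfolding set_borel_measurable_def by measurable
qed (auto simp: norm_mult)

lemma norm_laplace_le:
  assumes f: "laplaceable f" and z: "Re z > 0"
  shows "norm (laplace f z) \<le> (LINT u:{0<..}|lborel. \<bar>f u\<bar> * exp (- (Re z * u)))"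
proof -
  have "norm (laplace f z) \<le>
      (LINT u:{0<..}|lborel. norm (complex_of_real (f u) * exp (- (z * of_real u))))"
    unfolding laplace_def
    by (rule set_integral_norm_bound[OF laplace_integrable[OF f z]])
  then show ?thesis by (simp add: norm_mult)
qed

lemma norm_exp_minus_linear_le:
  fixes a :: complex
  shows "norm (exp a - 1 - a) \<le> norm a ^ 2 * exp (norm a)"
proof -
  have "norm (exp a - (\<Sum>i\<le>1. a ^ i / fact i)) \<le> exp \<bar>Re a\<bar> * (norm a ^ Suc 1) / fact 1"
    by (rule Taylor_exp)
  also have "\<dots> \<le> exp (norm a) * (norm a ^ Suc 1)"
    by (simp, intro mult_right_mono) (auto simp: abs_Re_le_cmod)
  finally show ?thesis by (simp add: power2_eq_square algebra_simps)
qed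

text \<open>Differentiation under the integral by a quantitative estimate: the remainder of the
  linearisation in \<open>h\<close> is at most |h|^2 \<open>K\<close> with \<open>K\<close>
  independent of \<open>h\<close>, so the difference quotient has error O(|h|).\<close>

lemma laplace_has_field_derivative:
  assumes f: "laplaceable f" and z: "Re z > 0"
  shows "(laplace f has_field_derivative - laplace (\<lambda>u. u * f u) z) (at z)"
proof -
  \<comment> \<open>For |h| < Re z / 2 the factor exp (|h| u) of the Taylor remainder uses up at
    most half of the decay; the other half keeps \<open>K\<close> finite.\<close>
  define x where "x = Re z / 2"
  have x: "x > 0" using z by (simp add: x_def)
  let ?g = "\<lambda>u. u * (u * f u)"
  have g1: "laplaceable (\<lambda>u. u * f u)" by (rule laplaceable_mult_id[OF f])
  have g2: "laplaceable ?g" by (rule laplaceable_mult_id[OF g1])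
  define K where "K = (LINT u:{0<..}|lborel. \<bar>?g u\<bar> * exp (- (x * u)))"
  have Ki: "set_integrable lborel {0<..} (\<lambda>u. \<bar>?g u\<bar> * exp (- (x * u)))"
    using set_integrable_abs[OF laplaceableD[OF g2 x]] by (simp add: abs_mult)
  have bound: "norm (laplace f (z + h) - laplace f z + laplace (\<lambda>u. u * f u) z * h) \<le> norm h ^ 2 * K"
    if h: "norm h < x" for h
  proof -
    have zh: "Re (z + h) > 0" using abs_Re_le_cmod[of h] h z by (simp add: x_def)
    let ?r = "\<lambda>u. complex_of_real (f u) * (exp (- (z * of_real u)) * (exp (- (h * of_real u)) - 1 - - (h * of_real u)))"
    have i: "set_integrable lborel {0<..} (\<lambda>u. complex_of_real (f u) * exp (- ((z + h) * of_real u)))"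
      "set_integrable lborel {0<..} (\<lambda>u. complex_of_real (f u) * exp (- (z * of_real u)))"
      "set_integrable lborel {0<..} (\<lambda>u. complex_of_real (u * f u) * exp (- (z * of_real u)) * h)"
      using laplace_integrable[OF f zh] laplace_integrable[OF f z] laplace_integrable[OF g1 z] by auto
    have req: "?r = (\<lambda>u. complex_of_real (f u) * exp (- ((z + h) * of_real u)) -
       complex_of_real (f u) * exp (- (z * of_real u)) + complex_of_real (u * f u) * exp (- (z * of_real u)) * h)"
      by (rule ext) (simp add: algebra_simps exp_add[symmetric] exp_diff exp_minus field_simps)
    have ri: "set_integrable lborel {0<..} ?r"
      unfolding req using i by (intro set_integral_add set_integral_diff)
    have eq: "laplace f (z + h) - laplace f z + laplace (\<lambda>u. u * f u) z * h = (LINT u:{0<..}|lborel. ?r u)"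
      unfolding req laplace_def using i
      by (subst set_integral_add, auto)
    have "norm (LINT u:{0<..}|lborel. ?r u) \<le> (LINT u:{0<..}|lborel. norm (?r u))"
      by (rule set_integral_norm_bound[OF ri])
    also have "\<dots> \<le> (LINT u:{0<..}|lborel. norm h ^ 2 * (\<bar>?g u\<bar> * exp (- (x * u))))"
    proof (rule set_integral_mono)
      show "set_integrable lborel {0<..} (\<lambda>u. norm (?r u))"
using integrable_norm[OF ri[unfolded set_integrable_def]]
        by (simp add: set_integrable_def)
      show "set_integrable lborel {0<..} (\<lambda>u. norm h ^ 2 * (\<bar>?g u\<bar> * exp (- (x * u))))"
        using Ki by simp
      fix u :: real assume u: "u \<in> {0<..}"
      have "norm (exp (- (h * of_real u)) - 1 - - (h * complex_of_real u)) \<le> (norm h * u) ^ 2 * exp (norm h * u)"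
        using norm_exp_minus_linear_le[of "- (h * of_real u)"] u by (simp add: norm_mult)
      also have "\<dots> \<le> (norm h * u) ^ 2 * exp (x * u)"
        using h u by (intro mult_left_mono) auto
      finally have "norm (?r u) \<le> \<bar>f u\<bar> * (exp (- (Re z * u)) * ((norm h * u) ^ 2 * exp (x * u)))"
        unfolding norm_mult norm_exp_laplace by (intro mult_mono) auto
      also have "\<dots> = norm h ^ 2 * (\<bar>?g u\<bar> * (exp (- (Re z * u)) * exp (x * u)))"
        using u by (simp add: abs_mult power2_eq_square mult_ac)
      also have "exp (- (Re z * u)) * exp (x * u) = exp (- (x * u))"
        by (simp add: exp_add[symmetric] x_def field_simps)
      finally show "norm (?r u) \<le> norm h ^ 2 * (\<bar>?g u\<bar> * exp (- (x * u)))" .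
    qed
    also have "\<dots> = norm h ^ 2 * K" unfolding K_def by simp
    finally show ?thesis by (simp only: eq)
  qed
  have K0: "K \<ge> 0" unfolding K_def set_lebesgue_integral_def by (rule integral_nonneg_AE) auto
  have "((\<lambda>h. (laplace f (z + h) - laplace f z) / h - - laplace (\<lambda>u. u * f u) z) \<longlongrightarrow> 0) (at 0)"
  proof (rule Lim_null_comparison)
    show "((\<lambda>h. norm h * K) \<longlongrightarrow> 0) (at (0::complex))" by (auto intro!: tendsto_eq_intros)
    have "eventually (\<lambda>h. norm h < x \<and> h \<noteq> 0) (at (0::complex))"
      using x by (auto simp: eventually_at intro!: exI[of _ x])
    then show "eventually (\<lambda>h. norm ((laplace f (z + h) - laplace f z) / h - - laplace (\<lambda>u. u * f u) z) \<le> norm h * K) (at 0)"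
    proof eventually_elim
      case (elim h)
      then have h: "h \<noteq> 0" by simp
      have "(laplace f (z + h) - laplace f z) / h - - laplace (\<lambda>u. u * f u) z =
        (laplace f (z + h) - laplace f z + laplace (\<lambda>u. u * f u) z * h) / h" using h by (simp add: field_simps)
      also have "norm \<dots> \<le> norm h ^ 2 * K / norm h"
        unfolding norm_divide using bound[of h] elim by (intro divide_right_mono) auto
      also have "\<dots> = norm h * K" using h by (simp add: power2_eq_square)
      finally show ?case .
    qed
  qed
  then show ?thesis unfolding DERIV_def by (simp only: LIM_zero_iff)
qed

lemma laplace_scale:
  assumes a: "a > 0"
  shows "laplace (\<lambda>u. f (a * u)) z = laplace f (z / of_real a) / of_real a"
proof -
  have pos: "0 < a * x \<longleftrightarrow> 0 < x" for x :: real
    using a by (simp add: zero_less_mult_iff)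
  have "laplace f (z / of_real a) =
    \<bar>a\<bar> *\<^sub>R (LINT u|lborel. indicator {0<..} (0 + a * u) *\<^sub>R (of_real (f (0 + a * u)) * exp (- (z / of_real a * of_real (0 + a * u)))))"
    unfolding laplace_def set_lebesgue_integral_def using a
    by (intro lborel_integral_real_affine) auto
  also have "\<dots> = of_real a * laplace (\<lambda>u. f (a * u)) z"
    unfolding laplace_def set_lebesgue_integral_def using a
    by (simp add: scaleR_conv_of_real indicator_def pos)
  finally show ?thesis using a by (simp add: field_simps)
qed

section \<open>Transforms of powers and of derivatives\<close>

lemma laplaceable_powr:
  assumes p: "p > -1"
  shows "laplaceable (\<lambda>u. u powr p)"
  unfolding laplaceable_def
proof (intro conjI allI impI)
  show "(\<lambda>u::real. u powr p) \<in> borel_measurable borel" by measurable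
  fix x :: real assume x: "x > 0"
  have "(\<lambda>t. complex_of_real t powr (of_real (p+1) - 1) / of_real (exp (x * t))) absolutely_integrable_on {0<..}"
    using absolutely_integrable_Gamma_integral[of "of_real (p+1)" x] p x by simp
  then have "(\<lambda>t. norm (complex_of_real t powr (of_real (p+1) - 1) / of_real (exp (x * t)))) absolutely_integrable_on {0<..}"
    by (rule absolutely_integrable_norm[unfolded o_def])
  moreover have "norm (complex_of_real t powr (of_real (p+1) - 1) / of_real (exp (x * t))) = t powr p * exp (- (x * t))"
    if "t \<in> {0<..}" for t
    using that by (simp add: norm_divide exp_minus norm_powr_real_powr divide_inverse norm_mult norm_inverse)
  ultimately have "set_integrable lebesgue {0<..} (\<lambda>t. t powr p * exp (- (x * t)))"
    by (subst (asm) set_integrable_cong[OF refl]) auto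
  then show "set_integrable lborel {0<..} (\<lambda>u. u powr p * exp (- (x * u)))"
    unfolding set_integrable_def by (subst (asm) integrable_completion) auto
qed

lemma laplaceable_power: "laplaceable (\<lambda>u. u ^ n)"
proof (rule laplaceable_bound)
  show "laplaceable (\<lambda>u. u powr real n)" by (rule laplaceable_powr) simp
  show "\<bar>u ^ n\<bar> \<le> 1 * \<bar>u powr real n\<bar>" if "u > 0" for u using that by (simp add: powr_realpow)
qed measurable

lemma tendsto_exp_neg:
  assumes "(x::real) > 0"
  shows "((\<lambda>u. exp (- (x * u))) \<longlongrightarrow> 0) at_top"
proof -
  have "filterlim (\<lambda>u. x * u) at_top at_top"
    by (rule filterlim_tendsto_pos_mult_at_top[OF tendsto_const assms filterlim_ident])
  then have "filterlim (\<lambda>u. - (x * u)) at_bot at_top"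
    by (simp add: filterlim_uminus_at_bot)
  then show ?thesis by (rule filterlim_compose[OF exp_at_bot])
qed

lemma laplace_1:
  assumes z: "Re z > 0"
  shows "laplace (\<lambda>u. 1) z = 1 / z"
proof -
  have z0: "z \<noteq> 0" using z by auto
  have i: "set_integrable lborel {0<..} (\<lambda>u. exp (- (z * complex_of_real u)))"
    using laplace_integrable[OF laplaceable_power[of 0] z] by simp
  let ?F = "\<lambda>u. - exp (- (z * complex_of_real u)) / z"
  have "(LBINT u=0..\<infinity>. exp (- (z * complex_of_real u))) = 0 - (- 1 / z)"
  proof (rule interval_integral_FTC_integrable[where F="?F"])
    show "(?F has_vector_derivative exp (- (z * complex_of_real x))) (at x)" for x
    proof (rule has_vector_derivative_real_field)
      show "((\<lambda>w. - exp (- (z * w)) / z) has_field_derivative exp (- (z * complex_of_real x))) (at (of_real x))"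
        using z0 by (auto intro!: derivative_eq_intros)
    qed
    show "set_integrable lborel (einterval 0 \<infinity>) (\<lambda>u. exp (- (z * complex_of_real u)))"
      using i by (simp add: einterval_eq_Ici zero_ereal_def)
    have "(?F \<longlongrightarrow> - exp (- (z * complex_of_real 0)) / z) (at_right 0)"
      using z0 by (intro tendsto_intros)
    then have "((?F \<circ> real_of_ereal) \<longlongrightarrow> - exp (- (z * complex_of_real 0)) / z) (at_right (ereal 0))"
      by (subst ereal_tendsto_simps1(2))
    then show "((?F \<circ> real_of_ereal) \<longlongrightarrow> - 1 / z) (at_right 0)"
      by (simp add: zero_ereal_def[symmetric])
    have "((\<lambda>u. exp (- (Re z * u)) / norm z) \<longlongrightarrow> 0 / norm z) at_top"
      using z z0 by (intro tendsto_intros tendsto_exp_neg) auto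
    then have "(?F \<longlongrightarrow> 0) at_top"
      by (rule_tac tendsto_norm_zero_cancel) (simp add: norm_divide)
    then show "((?F \<circ> real_of_ereal) \<longlongrightarrow> 0) (at_left \<infinity>)"
      by (subst ereal_tendsto_simps1(3))
  qed (auto intro!: continuous_intros)
  then show ?thesis
    unfolding laplace_def by (simp add: interval_lebesgue_integral_0_infty)
qed

text \<open>Differentiation of the transform multiplies the function by \<open>- u\<close>, so the
  induction step is the derivative of the induction hypothesis.\<close>

lemma laplace_power:
  assumes z: "Re z > 0"
  shows "laplace (\<lambda>u. u ^ n) z = fact n / z ^ Suc n"
  using z
proof (induction n arbitrary: z)
  case 0
  then show ?case by (simp add: laplace_1)
next
  case (Suc n)
  have nz: "z \<noteq> 0" using Suc.prems by auto
  have "(laplace (\<lambda>u. u ^ n) has_field_derivative - laplace (\<lambda>u. u * u ^ n) z) (at z)"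
    by (rule laplace_has_field_derivative[OF laplaceable_power Suc.prems])
  moreover have "(laplace (\<lambda>u. u ^ n) has_field_derivative - (fact (Suc n) / z ^ Suc (Suc n))) (at z)"
  proof (rule has_field_derivative_transform_within_open[where S="{z. Re z > 0}"])
    have "((\<lambda>z. fact n / z ^ Suc n) has_field_derivative
        - (fact n * (of_nat (Suc n) * z ^ n)) / (z ^ Suc n * z ^ Suc n)) (at z)"
      using nz by (auto intro!: derivative_eq_intros simp del: power_Suc)
    also have "- (fact n * (of_nat (Suc n) * z ^ n)) / (z ^ Suc n * z ^ Suc n)
        = - (fact (Suc n) / z ^ Suc (Suc n))"
      using nz by (simp add: divide_simps)
    finally show "((\<lambda>z. fact n / z ^ Suc n) has_field_derivative - (fact (Suc n) / z ^ Suc (Suc n))) (at z)" .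
  qed (use Suc in \<open>auto simp: open_halfspace_Re_gt\<close>)
  ultimately have "- laplace (\<lambda>u. u * u ^ n) z = - (fact (Suc n) / z ^ Suc (Suc n))"
    by (rule DERIV_unique)
  then show ?case by simp
qed

lemma laplace_cong: "(\<And>u. u > 0 \<Longrightarrow> f u = g u) \<Longrightarrow> laplace f z = laplace g z"
  unfolding laplace_def by (intro set_lebesgue_integral_cong) auto

lemma laplace_add:
  assumes "laplaceable f" "laplaceable g" "Re z > 0"
  shows "laplace (\<lambda>u. f u + g u) z = laplace f z + laplace g z"
  unfolding laplace_def
  using set_integral_add(2)[OF laplace_integrable[OF assms(1,3)] laplace_integrable[OF assms(2,3)]]
  by (simp add: distrib_right)

lemma laplace_cmult: "laplace (\<lambda>u. C * f u) z = of_real C * laplace f z"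
  unfolding laplace_def by (simp add: mult.assoc)

lemma laplaceable_diff:
  assumes "laplaceable f" "laplaceable g"
  shows "laplaceable (\<lambda>u. f u - g u)"
  using laplaceable_add[OF assms(1) laplaceable_cmult[OF assms(2), of "-1"]] by simp

lemma laplace_diff:
  assumes "laplaceable f" "laplaceable g" "Re z > 0"
  shows "laplace (\<lambda>u. f u - g u) z = laplace f z - laplace g z"
  using laplace_add[OF assms(1) laplaceable_cmult[OF assms(2), of "-1"] assms(3)] laplace_cmult[of "-1" g z] by simp

lemma laplace_of_real: "laplace f (of_real t) = of_real (LINT u:{0<..}|lborel. f u * exp (- (t * u)))"
  unfolding laplace_def set_integral_complex_of_real[symmetric] by (simp add: exp_of_real[symmetric])

text \<open>Integration by parts on the half-line: the boundary term at 0 vanishes by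
  \<open>lim\<close>, the one at infinity by the quadratic growth bound. It serves twice, to obtain
  Kummer's equation from a total derivative of weights and to replace a weight by its
  antiderivative.\<close>

lemma laplace_deriv:
  assumes F: "laplaceable F" and f: "laplaceable f" and z: "Re z > 0"
    and D: "\<And>u. u > 0 \<Longrightarrow> (F has_real_derivative f u) (at u)"
    and c: "continuous_on {0<..} f"
    and lim: "(F \<longlongrightarrow> 0) (at_right 0)"
    and b: "\<And>u. u > 0 \<Longrightarrow> \<bar>F u\<bar> \<le> C * (1 + u) ^ 2"
  shows "laplace f z = z * laplace F z"
proof -
  let ?G = "\<lambda>u. of_real (F u) * exp (- (z * complex_of_real u))"
  let ?g = "\<lambda>u. of_real (f u) * exp (- (z * complex_of_real u)) - z * ?G u"
  have i: "set_integrable lborel {0<..} ?g"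
    by (intro set_integral_diff set_integrable_mult_right laplace_integrable F f z)
  have cF: "continuous_on {0<..} F"
    by (intro continuous_at_imp_continuous_on ballI DERIV_isCont[OF D]) auto
  have "(LBINT u=0..\<infinity>. ?g u) = 0 - 0"
  proof (rule interval_integral_FTC_integrable[where F="?G"])
    show "(?G has_vector_derivative ?g x) (at x)" if "0 < ereal x" for x
    proof -
      have x: "x > 0" using that by simp
      have 1: "((\<lambda>u. complex_of_real (F u)) has_vector_derivative of_real (f x)) (at x)"
        using D[OF x] by (intro has_vector_derivative_of_real) (simp add: has_real_derivative_iff_has_vector_derivative)
      have 2: "((\<lambda>u. exp (- (z * complex_of_real u))) has_vector_derivative - z * exp (- (z * of_real x))) (at x)"
        by (rule has_vector_derivative_real_field) (auto intro!: derivative_eq_intros)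
      from has_vector_derivative_mult[OF 1 2] show ?thesis by (simp add: algebra_simps)
    qed
    show "isCont ?g x" if "0 < ereal x" for x
    proof -
      have "continuous_on {0<..} ?g" by (intro continuous_intros cF c)
      then show ?thesis using that by (subst (asm) continuous_on_eq_continuous_at) auto
    qed
    show "set_integrable lborel (einterval 0 \<infinity>) ?g"
      using i by (simp add: einterval_eq_Ici zero_ereal_def)
    have "(?G \<longlongrightarrow> of_real 0 * exp (- (z * complex_of_real 0))) (at_right 0)"
      by (intro tendsto_intros lim)
    then have "((?G \<circ> real_of_ereal) \<longlongrightarrow> of_real 0 * exp (- (z * complex_of_real 0))) (at_right (ereal 0))"
      by (subst ereal_tendsto_simps1(2))
    then show "((?G \<circ> real_of_ereal) \<longlongrightarrow> 0) (at_right 0)"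
      by (simp add: zero_ereal_def[symmetric])
    let ?x = "Re z"
    have xu: "filterlim (\<lambda>u. ?x * u) at_top at_top"
      by (rule filterlim_tendsto_pos_mult_at_top[OF tendsto_const z filterlim_ident])
    \<comment> \<open>The quadratic bound is expanded in powers of \<open>?x * u\<close>, each of
      which loses against the exponential.\<close>
    have pw: "((\<lambda>u. (?x * u) ^ k / exp (?x * u)) \<longlongrightarrow> 0) at_top" for k
      by (rule filterlim_compose[OF tendsto_power_div_exp_0 xu])
    have "((\<lambda>u. C * ((?x * u) ^ 0 / exp (?x * u)) + (2 * C / ?x) * ((?x * u) ^ 1 / exp (?x * u)) +
       (C / ?x ^ 2) * ((?x * u) ^ 2 / exp (?x * u))) \<longlongrightarrow> C * 0 + (2 * C / ?x) * 0 + (C / ?x ^ 2) * 0) at_top"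
      by (intro tendsto_intros pw)
    moreover have "(\<lambda>u. C * ((?x * u) ^ 0 / exp (?x * u)) + (2 * C / ?x) * ((?x * u) ^ 1 / exp (?x * u)) +
       (C / ?x ^ 2) * ((?x * u) ^ 2 / exp (?x * u))) = (\<lambda>u. C * (1 + u) ^ 2 * exp (- (?x * u)))"
      using z by (intro ext) (simp add: exp_minus divide_simps power2_eq_square, simp add: algebra_simps)
    ultimately have l: "((\<lambda>u. C * (1 + u) ^ 2 * exp (- (?x * u))) \<longlongrightarrow> 0) at_top" by simp
    have "(?G \<longlongrightarrow> 0) at_top"
    proof (rule Lim_null_comparison[OF _ l])
      show "eventually (\<lambda>u. norm (?G u) \<le> C * (1 + u) ^ 2 * exp (- (?x * u))) at_top"
        using eventually_gt_at_top[of 0]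
        by eventually_elim (use b in \<open>auto simp: norm_mult intro!: mult_right_mono\<close>)
    qed
    then show "((?G \<circ> real_of_ereal) \<longlongrightarrow> 0) (at_left \<infinity>)"
      by (subst ereal_tendsto_simps1(3))
  qed auto
  then have "(LINT u:{0<..}|lborel. ?g u) = 0" by (simp add: interval_lebesgue_integral_0_infty)
  then show ?thesis
    unfolding laplace_def
    by (subst (asm) set_integral_diff) (auto intro!: set_integrable_mult_right laplace_integrable F f z)
qed

section \<open>Inversion of the Fermi function\<close>

text \<open>On the line the real part of sin (pi s) is sin (pi c) cosh (pi t), which already shows
  the full growth.\<close>

lemma norm_sin_pi_ge:
  assumes c: "0 < c" "c < 1"
  shows "sin (pi * c) * exp (pi * \<bar>t\<bar>) / 2 \<le> norm (sin (of_real pi * Complex c t))"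
proof -
  have "sin (pi * c) > 0" using c by (intro sin_gt_zero) auto
  have "exp (pi * \<bar>t\<bar>) \<le> exp (pi * t) + exp (- (pi * t))" by (cases "t \<ge> 0") auto
  then have "sin (pi * c) * exp (pi * \<bar>t\<bar>) / 2 \<le> sin (pi * c) * (exp (pi * t) + exp (- (pi * t))) / 2"
    using \<open>sin (pi * c) > 0\<close> by auto
  also have "\<dots> = Re (sin (of_real pi * Complex c t))" by (simp add: Re_sin)
  also have "\<dots> \<le> norm (sin (of_real pi * Complex c t))" by (rule complex_Re_le_cmod)
  finally show ?thesis .
qed

lemma sin_pi_neq_0:
  assumes "0 < Re s" "Re s < 2" "s \<noteq> 1"
  shows "sin (of_real pi * s) \<noteq> 0"
proof
  assume "sin (of_real pi * s) = 0"
  then obtain n :: int where "of_real pi * s = of_real (n * pi)" by (auto simp: sin_eq_0)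
  then have s: "s = of_int n" by simp
  with assms have "n = 1" by simp
  with s assms show False by simp
qed

lemma continuous_on_Complex [continuous_intros]:
  assumes "continuous_on A f" "continuous_on A g"
  shows "continuous_on A (\<lambda>t. Complex (f t) (g t))"
  unfolding Complex_eq using assms by (intro continuous_intros)

lemma borel_measurable_Complex [measurable (raw)]:
  assumes "f \<in> borel_measurable M" "g \<in> borel_measurable M"
  shows "(\<lambda>t. Complex (f t) (g t)) \<in> borel_measurable M"
  unfolding Complex_eq using assms by measurable

lemma integrable_exp_neg_abs:
  assumes a: "(a::real) > 0"
  shows "integrable lborel (\<lambda>t. exp (- (a * \<bar>t\<bar>)))"
proof -
  have 1: "set_integrable lborel {0..} (\<lambda>t. exp (- (a * t)))"
  proof -
    have "(\<lambda>t. exp (- a * t)) integrable_on {0..}"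
      using integrable_on_exp_minus_to_infinity[OF a] by simp
    then have "(\<lambda>t. exp (- a * t)) absolutely_integrable_on {0..}"
      by (subst absolutely_integrable_on_iff_nonneg) auto
    then show ?thesis
      unfolding set_integrable_def by (subst (asm) integrable_completion) auto
  qed
  have 2: "integrable lborel (\<lambda>t. indicator {0..} t *\<^sub>R exp (- (a * t)))"
    using 1 by (simp add: set_integrable_def)
  have "integrable lborel (\<lambda>t. indicator {0..} (0 + (-1) * t) *\<^sub>R exp (- (a * (0 + (-1) * t))))"
    by (rule lborel_integrable_real_affine[OF 2]) auto
  then have "integrable lborel (\<lambda>t. indicator {0..} t *\<^sub>R exp (- (a * t)) + indicator {0..} (-t) *\<^sub>R exp (- (a * (- t))))"
    using 2 by auto
  then show ?thesis
    by (rule Bochner_Integration.integrable_bound) (auto split: split_indicator)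
qed

text \<open>The estimate is linear in \<open>C\<close>, with a factor depending on \<open>c\<close>
  and \<open>d\<close> only. This uniformity later turns a bound on the tail of a series into an
  O-bound in \<beta>.\<close>

lemma integrable_over_sin:
  assumes c: "0 < c" "c < 1" and d: "d < pi"
    and m: "f \<in> borel_measurable borel"
    and bound: "\<And>t. norm (f t) \<le> C * exp (d * \<bar>t\<bar>)"
  shows "integrable lborel (\<lambda>t. f t / sin (of_real pi * Complex c t))"
    and "norm (LINT t|lborel. f t / sin (of_real pi * Complex c t)) \<le>
           C * (2 / sin (pi * c) * (LINT t|lborel. exp (- ((pi - d) * \<bar>t\<bar>))))"
proof -
  have [measurable]: "f \<in> borel_measurable borel" by fact
  have s0: "sin (pi * c) > 0" using c by (intro sin_gt_zero) auto
  have ie: "integrable lborel (\<lambda>t. C * (2 / sin (pi * c) * exp (- ((pi - d) * \<bar>t\<bar>))))"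
    using integrable_exp_neg_abs[of "pi - d"] d by simp
  have b: "norm (f t / sin (of_real pi * Complex c t)) \<le> C * (2 / sin (pi * c) * exp (- ((pi - d) * \<bar>t\<bar>)))" for t
  proof -
    have "norm (f t / sin (of_real pi * Complex c t)) \<le> (C * exp (d * \<bar>t\<bar>)) / (sin (pi * c) * exp (pi * \<bar>t\<bar>) / 2)"
      unfolding norm_divide using bound[of t] norm_sin_pi_ge[OF c, of t] s0
      by (intro frac_le) (auto intro: order_trans[OF norm_ge_zero bound])
    also have "\<dots> = C * (2 / sin (pi * c) * exp (- ((pi - d) * \<bar>t\<bar>)))"
      using s0 by (simp add: field_simps exp_add[symmetric] exp_diff exp_minus)
    finally show ?thesis .
  qed
  show i: "integrable lborel (\<lambda>t. f t / sin (of_real pi * Complex c t))"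
  proof (rule Bochner_Integration.integrable_bound[OF ie])
    show "AE t in lborel. norm (f t / sin (of_real pi * Complex c t)) \<le>
        norm (C * (2 / sin (pi * c) * exp (- ((pi - d) * \<bar>t\<bar>))))"
      unfolding real_norm_def by (intro AE_I2 order_trans[OF b abs_ge_self])
  qed measurable
  have "norm (LINT t|lborel. f t / sin (of_real pi * Complex c t)) \<le>
    (LINT t|lborel. C * (2 / sin (pi * c) * exp (- ((pi - d) * \<bar>t\<bar>))))"
    using b by (intro Bochner_Integration.integral_norm_bound_integral[OF i ie])
  then show "norm (LINT t|lborel. f t / sin (of_real pi * Complex c t)) \<le>
           C * (2 / sin (pi * c) * (LINT t|lborel. exp (- ((pi - d) * \<bar>t\<bar>))))" by simp
qed

text \<open>On the horizontal sides of the rectangle below the bound has to be uniform in the real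
  part. The estimate of \<open>norm_sin_pi_ge\<close> would degenerate at Re s = 1, where sin (pi Re
  s) vanishes.\<close>

lemma norm_sin_ge_sinh: "(exp \<bar>Im z\<bar> - 1) / 2 \<le> norm (sin z)"
proof -
  have "norm (sin z) = norm (exp (\<i> * z) - exp (- (\<i> * z))) / 2"
    by (simp add: sin_exp_eq norm_divide norm_mult)
  moreover have "exp \<bar>Im z\<bar> - 1 \<le> norm (exp (\<i> * z) - exp (- (\<i> * z)))"
  proof (cases "Im z \<ge> 0")
    case True
    then have "exp \<bar>Im z\<bar> - 1 \<le> norm (exp (- (\<i> * z))) - norm (exp (\<i> * z))" by simp
    also have "\<dots> \<le> norm (exp (\<i> * z) - exp (- (\<i> * z)))"
      by (metis norm_minus_commute norm_triangle_ineq2)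
    finally show ?thesis .
  next
    case False
    then have "exp \<bar>Im z\<bar> - 1 \<le> norm (exp (\<i> * z)) - norm (exp (- (\<i> * z)))" by simp
    also have "\<dots> \<le> norm (exp (\<i> * z) - exp (- (\<i> * z)))" by (rule norm_triangle_ineq2)
    finally show ?thesis .
  qed
  ultimately show ?thesis by simp
qed

lemma lim_symmetric_integral:
  fixes f :: "real \<Rightarrow> complex"
  assumes f: "integrable lborel f"
  shows "(\<lambda>n. integral {- real n..real n} f) \<longlonglongrightarrow> (LINT t|lborel. f t)"
proof -
  have "(\<lambda>n. LINT t|lborel. indicator {- real n..real n} t *\<^sub>R f t) \<longlonglongrightarrow> (LINT t|lborel. f t)"
  proof (rule integral_dominated_convergence[where w="\<lambda>t. norm (f t)"])
    show "AE t in lborel. (\<lambda>n. indicator {- real n..real n} t *\<^sub>R f t) \<longlonglongrightarrow> f t"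
    proof (rule AE_I2)
      fix t :: real
      have "eventually (\<lambda>n. \<bar>t\<bar> \<le> real n) sequentially"
        using filterlim_real_sequentially eventually_ge_at_top filterlim_iff by metis
      then have "eventually (\<lambda>n. indicator {- real n..real n} t *\<^sub>R f t = f t) sequentially"
        by eventually_elim (auto simp: indicator_def)
      then show "(\<lambda>n. indicator {- real n..real n} t *\<^sub>R f t) \<longlonglongrightarrow> f t"
        by (rule tendsto_eventually)
    qed
    have fm: "f \<in> borel_measurable lborel" using f by auto
    show "(\<lambda>t. indicator {- real n..real n} t *\<^sub>R f t) \<in> borel_measurable lborel" for n
      using fm by measurable
    show "f \<in> borel_measurable lborel" by (rule fm)
  qed (use f in \<open>auto split: split_indicator\<close>)
  moreover have "(LINT t|lborel. indicator {- real n..real n} t *\<^sub>R f t) = integral {- real n..real n} f" for n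
  proof -
    have "set_integrable lborel {- real n..real n} f"
      unfolding set_integrable_def using integrable_mult_indicator[OF _ f] by auto
    from set_borel_integral_eq_integral(2)[OF this] show ?thesis by (simp add: set_lebesgue_integral_def)
  qed
  ultimately show ?thesis by simp
qed

lemma residue_pi_over_sin:
  "residue (\<lambda>s. exp (- (s * of_real y)) * of_real pi / sin (of_real pi * s)) 1 = - exp (- of_real y)"
proof -
  have "residue (\<lambda>s. (exp (- (s * of_real y)) * of_real pi) / sin (of_real pi * s)) 1 =
     exp (- (1 * of_real y)) * of_real pi / (of_real pi * cos (of_real pi * 1) :: complex)"
    by (rule residue_simple_pole_deriv[where s=UNIV])
       (auto intro!: holomorphic_intros derivative_eq_intros simp: sin_of_real cos_of_real)
  then show ?thesis by (simp add: cos_of_real)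
qed

text \<open>The sides Re s = c and Re s = c + 1 enclose the single pole 1. Since sin (pi (s + 1)) =
  - sin (pi s), the integrand on the right side is - exp (- y) times the one on the left, so the
  residue theorem becomes a linear equation for one line integral, with an error from the horizontal
  sides. All real \<open>y\<close> are treated alike, without shifting the contour to infinity and
  summing residues.\<close>

lemma rectangle_pi_over_sin:
  fixes y T c :: real
  assumes c: "0 < c" "c < 1" and T: "T > 0"
  defines "f \<equiv> \<lambda>s. exp (- (s * of_real y)) * of_real pi / sin (of_real pi * s)"
  shows "norm (integral {-T..T} (\<lambda>t. f (Complex c t)) * of_real (1 + exp (- y)) - of_real (2 * pi * exp (- y)))
           \<le> 2 * (exp (2 * \<bar>y\<bar>) * pi / ((exp (pi * T) - 1) / 2))"
proof -
  define S where "S = {s. 0 < Re s \<and> Re s < 2}"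
  define a where "a = Complex c (-T)"
  define b where "b = Complex (c + 1) T"
  define a' where "a' = Complex (c + 1) (-T)"
  define b' where "b' = Complex c T"
  have S: "open S" "convex S"
  proof -
    have "S = {s. 0 < Re s} \<inter> {s. Re s < 2}" by (auto simp: S_def)
    then show "open S" "convex S"
      by (auto intro!: open_Int convex_Int simp: open_halfspace_Re_gt open_halfspace_Re_lt
            convex_halfspace_Re_gt convex_halfspace_Re_lt)
  qed
  have holo: "f holomorphic_on S - {1}"
    unfolding f_def by (intro holomorphic_intros) (auto simp: S_def sin_pi_neq_0)
  have one: "1 \<in> box a b" using c T by (simp add: in_box_complex_iff a_def b_def)
  have cb: "cbox a b \<subseteq> S" using c by (auto simp: in_cbox_complex_iff a_def b_def S_def)
  have le: "Re a \<le> Re b" "Im a \<le> Im b" using T by (auto simp: a_def b_def)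
  have pi_img: "path_image (rectpath a b) \<subseteq> S - {1}"
    using cb one path_image_rectpath_cbox_minus_box[OF le] by auto
  have "contour_integral (rectpath a b) f = 2 * pi * \<i> * (\<Sum>p\<in>{1}. winding_number (rectpath a b) p * residue f p)"
  proof (rule Residue_theorem[where S=S])
    show "\<forall>z. z \<notin> S \<longrightarrow> winding_number (rectpath a b) z = 0"
      using cb le by (auto intro!: winding_number_rectpath_outside)
  qed (use S holo pi_img convex_connected in auto)
  also have "\<dots> = - (2 * pi * \<i> * exp (- of_real y))"
    using winding_number_rectpath[OF one] residue_pi_over_sin[of y] by (simp add: f_def)
  finally have R: "contour_integral (rectpath a b) f = - (2 * pi * \<i> * exp (- of_real y))" .
  have seg: "closed_segment a a' \<subseteq> S - {1}" "closed_segment a' b \<subseteq> S - {1}"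
      "closed_segment b b' \<subseteq> S - {1}" "closed_segment b' a \<subseteq> S - {1}"
    using pi_img by (auto simp: rectpath_def Let_def path_image_join a_def b_def a'_def b'_def)
  have int: "f contour_integrable_on linepath a a'" "f contour_integrable_on linepath a' b"
      "f contour_integrable_on linepath b b'" "f contour_integrable_on linepath b' a"
    using seg holomorphic_on_imp_continuous_on[OF holo]
    by (auto intro!: contour_integrable_continuous_linepath elim: continuous_on_subset)
  have "rectpath a b = linepath a a' +++ linepath a' b +++ linepath b b' +++ linepath b' a"
    by (simp add: rectpath_def Let_def a_def b_def a'_def b'_def)
  then have dec: "contour_integral (rectpath a b) f = contour_integral (linepath a a') f +
      (contour_integral (linepath a' b) f + (contour_integral (linepath b b') f + contour_integral (linepath b' a) f))"
    using int by simp
  let ?I = "integral {-T..T} (\<lambda>t. f (Complex c t))"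
  have v1: "contour_integral (linepath a' b) f = \<i> * integral {-T..T} (\<lambda>t. f (Complex (c+1) t))"
    using T by (intro contour_integral_linepath_same_Re) (auto simp: a'_def b_def)
  have shift: "f (Complex (c+1) t) = - of_real (exp (- y)) * f (Complex c t)" for t
  proof -
    have e: "Complex (c+1) t = Complex c t + 1" by (simp add: complex_eq_iff)
    have "of_real pi * (Complex c t + 1) = of_real pi * Complex c t + of_real pi" by (simp add: algebra_simps)
    then have "sin (of_real pi * (Complex c t + 1)) = - sin (of_real pi * Complex c t)"
      by (simp add: sin_add cos_of_real sin_of_real)
    then show ?thesis unfolding f_def e
      by (simp add: distrib_right exp_diff exp_add exp_minus exp_of_real field_simps)
  qed
  have v1': "contour_integral (linepath a' b) f = - (\<i> * of_real (exp (- y)) * ?I)"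
    unfolding v1 shift by simp
  have "contour_integral (linepath a b') f = \<i> * ?I"
    using T by (intro contour_integral_linepath_same_Re) (auto simp: a_def b'_def)
  then have v2: "contour_integral (linepath b' a) f = - (\<i> * ?I)"
    using contour_integral_reverse_linepath[of a b' f] seg(4) holomorphic_on_imp_continuous_on[OF holo]
    by (metis (no_types, lifting) closed_segment_commute continuous_on_subset minus_minus)
  define B where "B = exp (2 * \<bar>y\<bar>) * pi / ((exp (pi * T) - 1) / 2)"
  have ex: "exp (pi * T) > 1" using T by simp
  have fb: "norm (f s) \<le> B" if "s \<in> S" "\<bar>Im s\<bar> = T" for s
  proof -
    have "\<bar>Re s * y\<bar> \<le> 2 * \<bar>y\<bar>" using that by (simp add: abs_mult S_def mult_right_mono)
    then have e: "exp (- (Re s * y)) \<le> exp (2 * \<bar>y\<bar>)" by simp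
    have "(exp (pi * T) - 1) / 2 \<le> norm (sin (of_real pi * s))"
      using norm_sin_ge_sinh[of "of_real pi * s"] that by (simp add: abs_mult)
    then show ?thesis unfolding f_def B_def norm_divide norm_mult using e ex
      by (intro frac_le mult_mono) auto
  qed
  have B0: "B \<ge> 0" unfolding B_def using ex by simp
  have h1: "norm (contour_integral (linepath a a') f) \<le> B * norm (a' - a)"
  proof (rule contour_integral_bound_linepath[OF int(1) B0])
    fix x assume x: "x \<in> closed_segment a a'"
    then obtain u where "x = (1 - u) *\<^sub>R a + u *\<^sub>R a'" by (auto simp: closed_segment_def)
    then have "Im x = -T" by (simp add: a_def a'_def left_diff_distrib)
    then show "norm (f x) \<le> B" using x seg T by (intro fb) auto
  qed
  have h2: "norm (contour_integral (linepath b b') f) \<le> B * norm (b' - b)"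
  proof (rule contour_integral_bound_linepath[OF int(3) B0])
    fix x assume x: "x \<in> closed_segment b b'"
    then obtain u where "x = (1 - u) *\<^sub>R b + u *\<^sub>R b'" by (auto simp: closed_segment_def)
    then have "Im x = T" by (simp add: b_def b'_def left_diff_distrib)
    then show "norm (f x) \<le> B" using x seg T by (intro fb) auto
  qed
  have n: "norm (a' - a) = 1" "norm (b' - b) = 1"
    by (auto simp: a_def a'_def b_def b'_def norm_complex_def)
  have "\<i> * (?I * of_real (1 + exp (- y)) - of_real (2 * pi * exp (- y))) =
      contour_integral (linepath a a') f + contour_integral (linepath b b') f"
    using R unfolding dec v1' v2 by (simp add: algebra_simps exp_of_real[symmetric])
  then have "norm (\<i> * (?I * of_real (1 + exp (- y)) - of_real (2 * pi * exp (- y)))) \<le>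
      norm (contour_integral (linepath a a') f) + norm (contour_integral (linepath b b') f)"
    by (simp only: norm_triangle_ineq)
  then have "norm (?I * of_real (1 + exp (- y)) - of_real (2 * pi * exp (- y))) \<le>
      norm (contour_integral (linepath a a') f) + norm (contour_integral (linepath b b') f)"
    by (simp only: norm_mult norm_ii mult_1_left)
  also have "\<dots> \<le> 2 * B" using h1 h2 n by simp
  finally show ?thesis unfolding B_def .
qed

text \<open>Growing height removes the error in \<open>rectangle_pi_over_sin\<close>; division by
  \<open>1 + exp (- y)\<close>, which is positive, leaves the Fermi function.\<close>

lemma fermi_inversion:
  assumes c: "0 < c" "c < 1"
  shows "(LINT t|lborel. exp (- (Complex c t * of_real y)) * of_real pi / sin (of_real pi * Complex c t))
      = of_real (2 * pi / (exp y + 1))"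
proof -
  let ?f = "\<lambda>s. exp (- (s * of_real y)) * of_real pi / sin (of_real pi * s)"
  let ?L = "LINT t|lborel. ?f (Complex c t)"
  have "integrable lborel (\<lambda>t. exp (- (Complex c t * of_real y)) * of_real pi / sin (of_real pi * Complex c t))"
    by (rule integrable_over_sin(1)[OF c, where d=0 and C="exp (- (c * y)) * pi"]) (auto simp: norm_mult)
  from lim_symmetric_integral[OF this]
  have l: "(\<lambda>n. integral {- real n..real n} (\<lambda>t. ?f (Complex c t)) * of_real (1 + exp (- y)) - of_real (2 * pi * exp (- y)))
     \<longlonglongrightarrow> ?L * of_real (1 + exp (- y)) - of_real (2 * pi * exp (- y))"
    by (intro tendsto_intros)
  have "(\<lambda>n. integral {- real n..real n} (\<lambda>t. ?f (Complex c t)) * of_real (1 + exp (- y)) - of_real (2 * pi * exp (- y)))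
     \<longlonglongrightarrow> 0"
  proof (rule Lim_null_comparison)
    show "eventually (\<lambda>n. norm (integral {- real n..real n} (\<lambda>t. ?f (Complex c t)) * of_real (1 + exp (- y)) - of_real (2 * pi * exp (- y)))
         \<le> 2 * (exp (2 * \<bar>y\<bar>) * pi / ((exp (pi * real n) - 1) / 2))) sequentially"
      using eventually_gt_at_top[of "0::nat"]
      by eventually_elim (rule rectangle_pi_over_sin[OF c], simp)
    have "filterlim (\<lambda>n. pi * real n) at_top sequentially"
      by (rule filterlim_tendsto_pos_mult_at_top[OF tendsto_const pi_gt_zero filterlim_real_sequentially])
    then have "filterlim (\<lambda>n. exp (pi * real n)) at_top sequentially"
      by (rule filterlim_compose[OF exp_at_top])
    then have "filterlim (\<lambda>n. (- 1 + exp (pi * real n)) * (1/2)) at_top sequentially"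
      by (intro filterlim_at_top_mult_tendsto_pos[OF tendsto_const] filterlim_tendsto_add_at_top[OF tendsto_const]) auto
    then have "filterlim (\<lambda>n. (exp (pi * real n) - 1) / 2) at_top sequentially" by simp
    then have "(\<lambda>n. exp (2 * \<bar>y\<bar>) * pi / ((exp (pi * real n) - 1) / 2)) \<longlonglongrightarrow> 0"
      by (intro real_tendsto_divide_at_top[OF tendsto_const])
    then show "(\<lambda>n. 2 * (exp (2 * \<bar>y\<bar>) * pi / ((exp (pi * real n) - 1) / 2))) \<longlonglongrightarrow> 0"
      by (intro tendsto_mult_right_zero)
  qed
  with l have "?L * of_real (1 + exp (- y)) - of_real (2 * pi * exp (- y)) = 0"
    by (rule LIMSEQ_unique)
  moreover have "1 + exp (- y) \<noteq> 0" using exp_gt_zero[of "-y"] by linarith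
  ultimately have "?L = of_real (2 * pi * exp (- y)) / of_real (1 + exp (- y))"
    by (simp only: eq_divide_eq of_real_eq_0_iff) simp
  also have "\<dots> = of_real (2 * pi * exp (- y) / (1 + exp (- y)))" by simp
  also have "2 * pi * exp (- y) / (1 + exp (- y)) = 2 * pi / (exp y + 1)"
    using \<open>1 + exp (- y) \<noteq> 0\<close> exp_gt_zero[of y] by (simp add: exp_minus field_simps)
  finally show ?thesis .
qed

text \<open>Fubini after inserting \<open>fermi_inversion\<close> at y = x - \<eta>. On the line the
  modulus of the Laplace kernel depends on \<open>x\<close> only, so the absolute double integral
  splits into the integral \<open>K\<close> over \<open>x\<close> and an integral of 1 / |sin| over
  \<open>t\<close>.\<close>

lemma laplace_fermi:
  assumes f: "laplaceable f" and c: "0 < c" "c < 1"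
  shows "(LINT t|lborel. exp (of_real \<eta> * Complex c t) * of_real pi * laplace f (Complex c t) /
            sin (of_real pi * Complex c t)) =
         of_real (2 * pi * (LINT x:{0<..}|lborel. f x / (exp (x - \<eta>) + 1)))"
proof -
  have [measurable]: "f \<in> borel_measurable borel" using f by (rule laplaceable_measurable)
  define F where "F = (\<lambda>t x. exp (of_real \<eta> * Complex c t) * of_real pi / sin (of_real pi * Complex c t) *
     (indicator {0<..} x *\<^sub>R (of_real (f x) * exp (- (Complex c t * of_real x)))))"
  have i0: "set_integrable lborel {0<..} (\<lambda>x. complex_of_real (f x) * exp (- (Complex c t * of_real x)))" for t
    using laplace_integrable[OF f, of "Complex c t"] c by simp
  have "integrable (lborel \<Otimes>\<^sub>M lborel) (case_prod F)"
  proof (rule lborel_pair.Fubini_integrable)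
    show "case_prod F \<in> borel_measurable (lborel \<Otimes>\<^sub>M lborel)"
      unfolding F_def by measurable
    show "AE t in lborel. integrable lborel (\<lambda>x. case (t, x) of (t, x) \<Rightarrow> F t x)"
      unfolding F_def prod.case by (intro AE_I2 integrable_mult_right i0[unfolded set_integrable_def])
    define K where "K = (LINT x:{0<..}|lborel. \<bar>f x\<bar> * exp (- (c * x)))"
    have n: "(\<lambda>t. LINT x|lborel. norm (case (t, x) of (t, x) \<Rightarrow> F t x)) =
      (\<lambda>t. norm (of_real (exp (\<eta> * c) * pi * K) / sin (complex_of_real pi * Complex c t)))"
    proof
      fix t
      have "(\<lambda>x. norm (F t x)) = (\<lambda>x. exp (\<eta> * c) * pi / norm (sin (of_real pi * Complex c t)) *
          (indicator {0<..} x *\<^sub>R (\<bar>f x\<bar> * exp (- (c * x)))))"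
        by (rule ext) (simp add: F_def norm_mult norm_divide)
      moreover have "K \<ge> 0" unfolding K_def set_lebesgue_integral_def by (intro integral_nonneg_AE) auto
      ultimately show "(LINT x|lborel. norm (case (t, x) of (t, x) \<Rightarrow> F t x)) =
         norm (of_real (exp (\<eta> * c) * pi * K) / sin (complex_of_real pi * Complex c t))"
        by (simp add: K_def set_lebesgue_integral_def norm_divide norm_mult abs_mult)
    qed
    show "integrable lborel (\<lambda>t. LINT x|lborel. norm (case (t, x) of (t, x) \<Rightarrow> F t x))"
      unfolding n
      by (intro integrable_norm integrable_over_sin(1)[OF c, where d=0 and C="norm (exp (\<eta> * c) * pi * K)"])
         (auto simp: norm_mult simp del: of_real_mult)
  qed
  from lborel_pair.Fubini_integral[OF this]
  have "(LINT x|lborel. LINT t|lborel. F t x) = (LINT t|lborel. LINT x|lborel. F t x)" .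
  moreover have "(LINT x|lborel. F t x) = exp (of_real \<eta> * Complex c t) * of_real pi * laplace f (Complex c t) /
            sin (of_real pi * Complex c t)" for t
    unfolding F_def laplace_def set_lebesgue_integral_def by (subst integral_mult_right_zero) simp
  moreover have "(LINT t|lborel. F t x) = of_real (2 * pi * (indicator {0<..} x *\<^sub>R (f x / (exp (x - \<eta>) + 1))))" for x
  proof -
    have "(\<lambda>t. F t x) = (\<lambda>t. indicator {0<..} x *\<^sub>R of_real (f x) *
       (exp (- (Complex c t * of_real (x - \<eta>))) * of_real pi / sin (of_real pi * Complex c t)))"
    proof
      fix t
      have "exp (- (Complex c t * of_real (x - \<eta>))) = exp (of_real \<eta> * Complex c t) * exp (- (Complex c t * of_real x))"
        by (simp add: exp_add[symmetric] algebra_simps)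
      then show "F t x = indicator {0<..} x *\<^sub>R of_real (f x) *
       (exp (- (Complex c t * of_real (x - \<eta>))) * of_real pi / sin (of_real pi * Complex c t))"
        by (simp add: F_def indicator_def mult_ac)
    qed
    then have "(LINT t|lborel. F t x) = indicator {0<..} x *\<^sub>R of_real (f x) * of_real (2 * pi / (exp (x - \<eta>) + 1))"
      by (simp only: integral_mult_right_zero fermi_inversion[OF c])
    then show ?thesis by (simp add: indicator_def)
  qed
  ultimately show ?thesis
    unfolding set_lebesgue_integral_def integral_mult_right_zero[symmetric] integral_complex_of_real[symmetric]
    by simp
qed

section \<open>Entire power series\<close>

definition pser :: "(nat \<Rightarrow> real) \<Rightarrow> complex \<Rightarrow> complex" where
  "pser a z = (\<Sum>k. of_real (a k) * z ^ k)"

text \<open>Coefficients of an entire function of exponential type. Both Kummer series belong here,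
  the operations in Kummer's equation preserve the class, and it comes with an explicit tail
  bound.\<close>

definition exp_bounded :: "(nat \<Rightarrow> real) \<Rightarrow> bool" where
  "exp_bounded a \<longleftrightarrow> (\<exists>C r. \<forall>k. \<bar>a k\<bar> \<le> C * r ^ k / fact k)"

lemma exp_boundedI: "(\<And>k. \<bar>a k\<bar> \<le> C * r ^ k / fact k) \<Longrightarrow> exp_bounded a"
  unfolding exp_bounded_def by blast

lemma summable_norm_pser:
  assumes "exp_bounded a"
  shows "summable (\<lambda>k. norm (of_real (a k) * (z::complex) ^ k))"
proof -
  obtain C r where b: "\<And>k. \<bar>a k\<bar> \<le> C * r ^ k / fact k" using assms by (auto simp: exp_bounded_def)
  have "summable (\<lambda>k. C * (inverse (fact k) * (r * norm z) ^ k))"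
    by (intro summable_mult summable_exp)
  then show ?thesis
  proof (rule summable_comparison_test'[where N=0])
    fix k :: nat
    have "\<bar>a k\<bar> * norm z ^ k \<le> (C * r ^ k / fact k) * norm z ^ k"
      by (intro mult_right_mono b) auto
    then show "norm (norm (of_real (a k) * z ^ k)) \<le> C * (inverse (fact k) * (r * norm z) ^ k)"
      by (simp add: norm_mult norm_power power_mult_distrib divide_inverse mult_ac)
  qed
qed

lemma pser_sums: "exp_bounded a \<Longrightarrow> (\<lambda>k. of_real (a k) * z ^ k) sums pser a z"
  unfolding pser_def by (intro summable_sums summable_norm_cancel[OF summable_norm_pser])

lemma exp_bounded_Suc:
  assumes "exp_bounded a"
  shows "exp_bounded (\<lambda>k. a (Suc k))"
proof -
  obtain C r where b: "\<And>k. \<bar>a k\<bar> \<le> C * r ^ k / fact k" using assms by (auto simp: exp_bounded_def)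
  show ?thesis
  proof (rule exp_boundedI)
    fix k
    have "\<bar>a (Suc k)\<bar> \<le> C * r ^ Suc k / fact (Suc k)" by (rule b)
    also have "\<dots> \<le> \<bar>C * r ^ Suc k\<bar> / fact (Suc k)" by (intro divide_right_mono) auto
    also have "\<dots> \<le> \<bar>C * r ^ Suc k\<bar> / fact k" by (intro divide_left_mono fact_mono) auto
    finally show "\<bar>a (Suc k)\<bar> \<le> \<bar>C * r\<bar> * \<bar>r\<bar> ^ k / fact k" by (simp add: abs_mult power_abs mult_ac)
  qed
qed

lemma Suc_le_two_power: "real (Suc k) \<le> 2 ^ k"
proof (induction k)
  case (Suc k)
  have "real (Suc (Suc k)) \<le> 2 * real (Suc k)" by simp
  also have "\<dots> \<le> 2 * 2 ^ k" using Suc by (intro mult_left_mono) auto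
  finally show ?case by simp
qed simp

text \<open>A factor of linear growth only doubles the rate \<open>r\<close>, because k + 1 \<le>
  2^k. Differentiation of a series and the digamma factors both go through this.\<close>

lemma exp_bounded_mult_linear:
  assumes "exp_bounded a" and "\<And>k. \<bar>b k\<bar> \<le> K * real (Suc k)"
  shows "exp_bounded (\<lambda>k. b k * a k)"
proof -
  obtain C r where b: "\<And>k. \<bar>a k\<bar> \<le> C * r ^ k / fact k" using assms by (auto simp: exp_bounded_def)
  show ?thesis
  proof (rule exp_boundedI)
    fix k
    have K: "K \<ge> 0" using order_trans[OF abs_ge_zero assms(2)[of 0]] by simp
    have "\<bar>b k * a k\<bar> \<le> (K * real (Suc k)) * (C * r ^ k / fact k)"
      unfolding abs_mult using b assms(2) K by (intro mult_mono) auto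
    also have "\<dots> \<le> (K * 2 ^ k) * (C * r ^ k / fact k)"
      using K order_trans[OF abs_ge_zero b[of k]] Suc_le_two_power[of k] by (intro mult_right_mono mult_left_mono) auto
    finally show "\<bar>b k * a k\<bar> \<le> (K * C) * (2 * r) ^ k / fact k" by (simp add: power_mult_distrib mult_ac)
  qed
qed

lemma exp_bounded_diff:
  assumes "exp_bounded a" "exp_bounded b"
  shows "exp_bounded (\<lambda>k. a k - b k)"
proof -
  obtain C r where a: "\<And>k. \<bar>a k\<bar> \<le> C * r ^ k / fact k" using assms by (auto simp: exp_bounded_def)
  obtain D s where b: "\<And>k. \<bar>b k\<bar> \<le> D * s ^ k / fact k" using assms by (auto simp: exp_bounded_def)
  have up: "C * r ^ k \<le> \<bar>C\<bar> * (\<bar>r\<bar> + \<bar>s\<bar>) ^ k" for C r s :: real and k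
  proof -
    have "C * r ^ k \<le> \<bar>C\<bar> * \<bar>r\<bar> ^ k" by (metis abs_ge_self abs_mult power_abs)
    also have "\<dots> \<le> \<bar>C\<bar> * (\<bar>r\<bar> + \<bar>s\<bar>) ^ k" by (intro mult_left_mono power_mono) auto
    finally show ?thesis .
  qed
  show ?thesis
  proof (rule exp_boundedI)
    fix k
    have "\<bar>a k - b k\<bar> \<le> C * r ^ k / fact k + D * s ^ k / fact k" using a[of k] b[of k] by linarith
    also have "\<dots> \<le> \<bar>C\<bar> * (\<bar>r\<bar> + \<bar>s\<bar>) ^ k / fact k + \<bar>D\<bar> * (\<bar>s\<bar> + \<bar>r\<bar>) ^ k / fact k"
      by (intro add_mono divide_right_mono up) auto
    finally show "\<bar>a k - b k\<bar> \<le> (\<bar>C\<bar> + \<bar>D\<bar>) * (\<bar>r\<bar> + \<bar>s\<bar>) ^ k / fact k"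
      by (simp add: distrib_right add_divide_distrib add.commute)
  qed
qed

lemma exp_bounded_diffs:
  assumes "exp_bounded a"
  shows "exp_bounded (\<lambda>k. real (Suc k) * a (Suc k))"
  by (rule exp_bounded_mult_linear[OF exp_bounded_Suc[OF assms], where K=1]) auto

lemma pser_has_field_derivative:
  assumes "exp_bounded a"
  shows "(pser a has_field_derivative pser (\<lambda>k. real (Suc k) * a (Suc k)) z) (at z)"
proof -
  have "((\<lambda>z. \<Sum>k. complex_of_real (a k) * z ^ k) has_field_derivative
       (\<Sum>k. diffs (\<lambda>k. complex_of_real (a k)) k * z ^ k)) (at z)"
    by (rule termdiffs_strong_converges_everywhere) (rule sums_summable[OF pser_sums[OF assms]])
  then show ?thesis unfolding pser_def[abs_def] by (simp add: diffs_def)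
qed

lemma continuous_on_pser [continuous_intros]:
  assumes "exp_bounded a" "continuous_on A f"
  shows "continuous_on A (\<lambda>x. pser a (f x))"
proof -
  have "continuous_on UNIV (pser a)"
    using pser_has_field_derivative[OF assms(1)] by (intro DERIV_continuous_on) (auto intro: has_field_derivative_at_within)
  then show ?thesis by (rule continuous_on_compose2[OF _ assms(2)]) auto
qed

lemma pser_0: "pser a 0 = of_real (a 0)"
  using powser_sums_zero[of "\<lambda>k. of_real (a k)"] unfolding pser_def by (simp add: sums_iff)

lemma pser_shift:
  assumes "exp_bounded a"
  shows "pser a z = of_real (a 0) + z * pser (\<lambda>k. a (Suc k)) z"
proof -
  have "(\<lambda>k. of_real (a (Suc k)) * z ^ Suc k) sums (z * pser (\<lambda>k. a (Suc k)) z)"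
    using sums_mult[OF pser_sums[OF exp_bounded_Suc[OF assms], of z], of z] by (simp add: mult_ac)
  then have "(\<lambda>k. of_real (a k) * z ^ k) sums (z * pser (\<lambda>k. a (Suc k)) z + of_real (a 0) * z ^ 0)"
    by (rule sums_Suc)
  from sums_unique2[OF this pser_sums[OF assms]] show ?thesis by (simp add: add.commute)
qed

lemma pser_diff:
  assumes "exp_bounded a" "exp_bounded b"
  shows "pser (\<lambda>k. a k - b k) z = pser a z - pser b z"
  using sums_diff[OF pser_sums[OF assms(1), of z] pser_sums[OF assms(2), of z]]
  unfolding pser_def[of "\<lambda>k. a k - b k"] by (simp add: sums_iff left_diff_distrib)

lemma pser_cmult:
  assumes "exp_bounded a"
  shows "pser (\<lambda>k. C * a k) z = of_real C * pser a z"
  using sums_mult[OF pser_sums[OF assms, of z], of "of_real C"]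
  unfolding pser_def[of "\<lambda>k. C * a k"] by (simp add: sums_iff mult_ac)

lemma exp_bounded_cmult: "exp_bounded a \<Longrightarrow> exp_bounded (\<lambda>k. C * a k)"
  by (rule exp_bounded_mult_linear[where K="\<bar>C\<bar>"])
     (auto simp: mult_le_cancel_left1)

text \<open>Since (k + N)! \<ge> k!, factoring out the N-th power leaves an exponential series
  again. With r proportional to 1 / \<beta>, the factor (r |z|)^N is the source of \<beta>^(-N) in
  the expansions.\<close>

lemma pser_tail:
  assumes C: "\<And>k. \<bar>a k\<bar> \<le> C * r ^ k / fact k" and r: "r \<ge> 0"
  shows "norm (pser a z - (\<Sum>k<N. of_real (a k) * z ^ k)) \<le> C * (r * norm z) ^ N * exp (r * norm z)"
proof -
  have a: "exp_bounded a" using C by (rule exp_boundedI)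
  have C0: "C \<ge> 0" using order_trans[OF abs_ge_zero C[of 0]] by simp
  have "(\<lambda>k. of_real (a (k + N)) * z ^ (k + N)) sums (pser a z - (\<Sum>k<N. of_real (a k) * z ^ k))"
    by (rule sums_split_initial_segment[OF pser_sums[OF a]])
  moreover have "(\<lambda>k. C * (r * norm z) ^ N * ((r * norm z) ^ k /\<^sub>R fact k)) sums (C * (r * norm z) ^ N * exp (r * norm z))"
    by (intro sums_mult exp_converges)
  moreover have "norm (of_real (a (k + N)) * z ^ (k + N)) \<le> C * (r * norm z) ^ N * ((r * norm z) ^ k /\<^sub>R fact k)" for k
  proof -
    have "norm (of_real (a (k + N)) * z ^ (k + N)) \<le> (C * r ^ (k + N) / fact (k + N)) * norm z ^ (k + N)"
      unfolding norm_mult norm_power norm_of_real by (intro mult_right_mono C) auto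
    also have "\<dots> \<le> (C * r ^ (k + N) / fact k) * norm z ^ (k + N)"
      using C0 r by (intro mult_right_mono divide_left_mono fact_mono) auto
    also have "\<dots> = C * (r * norm z) ^ N * ((r * norm z) ^ k /\<^sub>R fact k)"
      by (simp add: power_add power_mult_distrib divide_inverse mult_ac)
    finally show ?thesis .
  qed
  ultimately show ?thesis
    by (rule norm_sums_le)
qed

section \<open>The logarithmic Kummer solution\<close>

text \<open>The Taylor coefficients of Kummer's function 1F1(m - 1/2; m + 1; z).\<close>

definition kummer_coeff :: "nat \<Rightarrow> nat \<Rightarrow> real" where
  "kummer_coeff m k = pochhammer (real m - 1/2) k / (fact k * pochhammer (real m + 1) k)"

definition psi_coeff :: "nat \<Rightarrow> nat \<Rightarrow> real" where
  "psi_coeff m k = Digamma (real m - 1/2 + real k) - Digamma (1 + real k) - Digamma (real m + real k + 1)"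

definition kummer :: "nat \<Rightarrow> complex \<Rightarrow> complex" where
  "kummer m = pser (kummer_coeff m)"

definition kummer_psi :: "nat \<Rightarrow> complex \<Rightarrow> complex" where
  "kummer_psi m = pser (\<lambda>k. psi_coeff m k * kummer_coeff m k)"

text \<open>The logarithmic series of Kummer's U(m - 1/2, m + 1, z) without its constant factor. For
  m \<ge> 1 it does not solve Kummer's equation by itself; a finite sum of negative powers completes
  it.\<close>

definition kummer_log :: "nat \<Rightarrow> complex \<Rightarrow> complex" where
  "kummer_log m z = ln z * kummer m z + kummer_psi m z"

lemma kummer_coeff_0 [simp]: "kummer_coeff m 0 = 1"
  by (simp add: kummer_coeff_def)

lemma kummer_coeff_Suc:
  assumes "m \<ge> 1"
  shows "(real k + 1) * (real m + 1 + real k) * kummer_coeff m (Suc k) = (real m - 1/2 + real k) * kummer_coeff m k"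
proof -
  have "pochhammer (real m + 1) k \<noteq> 0" using pochhammer_pos[of "real m + 1" k] by simp
  moreover have "real m + 1 + real k \<noteq> 0" "real k + 1 \<noteq> 0" by linarith+
  ultimately show ?thesis
    unfolding kummer_coeff_def pochhammer_Suc fact_Suc by (simp add: divide_simps)
qed

text \<open>Differentiation raises both Kummer parameters by 1, which is the step from
  \<open>m\<close> to \<open>Suc m\<close>.\<close>

lemma kummer_coeff_shift:
  assumes "m \<ge> 1"
  shows "real (Suc k) * kummer_coeff m (Suc k) = (real m - 1/2) / (real m + 1) * kummer_coeff (Suc m) k"
proof -
  have "pochhammer (real m + 2) k \<noteq> 0" using pochhammer_pos[of "real m + 2" k] by simp
  moreover have "real m + 1 \<noteq> 0" "real k + 1 \<noteq> 0" by linarith+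
  moreover have "real m + 1 + 1 = real m + 2" "real m - 1/2 + 1 = real m + 1/2" "real (Suc m) - 1/2 = real m + 1/2" "real (Suc m) + 1 = real m + 2" by auto
  ultimately show ?thesis
    unfolding kummer_coeff_def pochhammer_rec fact_Suc by (simp only:) (simp add: divide_simps)
qed

lemma kummer_coeff_nonneg:
  assumes "m \<ge> 1"
  shows "kummer_coeff m k \<ge> 0"
  unfolding kummer_coeff_def using assms pochhammer_pos[of "real m - 1/2" k] pochhammer_pos[of "real m + 1" k]
  by (intro divide_nonneg_pos mult_pos_pos) auto

text \<open>The ratio of successive coefficients is at most 1 / (k + 1), because m - 1/2 + k \<le> m
  + 1 + k.\<close>

lemma kummer_coeff_le:
  assumes "m \<ge> 1"
  shows "kummer_coeff m k \<le> 1 / fact k"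
proof (induction k)
  case (Suc k)
  have p: "(real k + 1) * (real m + 1 + real k) > 0" by (intro mult_pos_pos) linarith+
  have "kummer_coeff m (Suc k) = (real m - 1/2 + real k) * kummer_coeff m k / ((real k + 1) * (real m + 1 + real k))"
    using kummer_coeff_Suc[OF assms, of k] p by (simp add: eq_divide_eq mult_ac)
  also have "\<dots> \<le> (real m + 1 + real k) * (1 / fact k) / ((real k + 1) * (real m + 1 + real k))"
    using Suc p kummer_coeff_nonneg[OF assms, of k] by (intro divide_right_mono mult_mono) auto
  also have "\<dots> = 1 / fact (Suc k)" using p by (simp add: divide_simps)
  finally show ?case .
qed simp

lemma exp_bounded_kummer: "m \<ge> 1 \<Longrightarrow> exp_bounded (kummer_coeff m)"
  using kummer_coeff_nonneg kummer_coeff_le by (intro exp_boundedI[where C=1 and r=1]) auto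

lemma psi_coeff_Suc:
  assumes "m \<ge> 1"
  shows "psi_coeff m (Suc k) = psi_coeff m k + 1 / (real m - 1/2 + real k) - 1 / (real k + 1) - 1 / (real m + 1 + real k)"
proof -
  have "Digamma ((real m - 1/2 + real k) + 1) = Digamma (real m - 1/2 + real k) + 1 / (real m - 1/2 + real k)"
    using assms by (intro Digamma_plus1) auto
  moreover have "Digamma ((1 + real k) + 1) = Digamma (1 + real k) + 1 / (1 + real k)"
    by (intro Digamma_plus1) auto
  moreover have "Digamma ((real m + real k + 1) + 1) = Digamma (real m + real k + 1) + 1 / (real m + real k + 1)"
    by (intro Digamma_plus1) auto
  ultimately show ?thesis unfolding psi_coeff_def by (simp add: add_ac diff_add_eq)
qed

text \<open>Two of the three digamma arguments agree for (m, k + 1) and (m + 1, k); only that of psi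
  (1 + k) moves and leaves one correction term.\<close>

lemma psi_coeff_shift: "psi_coeff m (Suc k) = psi_coeff (Suc m) k - 1 / real (Suc k)"
proof -
  have "Digamma ((1 + real k) + 1) = Digamma (1 + real k) + 1 / (1 + real k)"
    by (intro Digamma_plus1) auto
  then show ?thesis unfolding psi_coeff_def by (simp add: add_ac diff_add_eq)
qed

text \<open>Each increment has modulus at most 2 + 1 + 1. The true growth is logarithmic, but a
  linear bound is what \<open>exp_bounded_mult_linear\<close> asks for.\<close>

lemma psi_coeff_bound:
  assumes m: "m \<ge> 1"
  shows "\<exists>K. \<forall>k. \<bar>psi_coeff m k\<bar> \<le> K * real (Suc k)"
proof (intro exI allI)
  fix k
  show "\<bar>psi_coeff m k\<bar> \<le> (\<bar>psi_coeff m 0\<bar> + 4) * real (Suc k)"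
  proof (induction k)
    case (Suc k)
    have "1 / (real m - 1/2 + real k) \<le> 2" "1 / (real m - 1/2 + real k) \<ge> 0"
      "1 / (real k + 1) \<le> 1" "1 / (real k + 1) \<ge> 0" "1 / (real m + 1 + real k) \<le> 1" "1 / (real m + 1 + real k) \<ge> 0"
      using m by (auto simp: divide_le_eq)
    then have "\<bar>psi_coeff m (Suc k)\<bar> \<le> \<bar>psi_coeff m k\<bar> + 4"
      unfolding psi_coeff_Suc[OF m] by (simp only: abs_le_iff) linarith
    also have "\<dots> \<le> (\<bar>psi_coeff m 0\<bar> + 4) * real (Suc k) + (\<bar>psi_coeff m 0\<bar> + 4)" using Suc by linarith
    finally show ?case by (simp add: algebra_simps)
  qed simp
qed

lemma exp_bounded_kummer_psi:
  assumes m: "m \<ge> 1"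
  shows "exp_bounded (\<lambda>k. psi_coeff m k * kummer_coeff m k)"
proof -
  obtain K where "\<And>k. \<bar>psi_coeff m k\<bar> \<le> K * real (Suc k)" using psi_coeff_bound[OF m] by blast
  then show ?thesis by (rule exp_bounded_mult_linear[OF exp_bounded_kummer[OF m]])
qed

lemma kummer_0 [simp]: "kummer m 0 = 1"
  by (simp add: kummer_def pser_0)

lemma kummer_psi_0: "kummer_psi m 0 = of_real (psi_coeff m 0)"
  by (simp add: kummer_psi_def pser_0)

lemma kummer_has_field_derivative:
  assumes m: "m \<ge> 1"
  shows "(kummer m has_field_derivative of_real ((real m - 1/2) / (real m + 1)) * kummer (Suc m) z) (at z)"
proof -
  have "pser (\<lambda>k. real (Suc k) * kummer_coeff m (Suc k)) z =
      of_real ((real m - 1/2) / (real m + 1)) * kummer (Suc m) z"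
    unfolding kummer_coeff_shift[OF m] kummer_def by (intro pser_cmult exp_bounded_kummer) simp
  then show ?thesis
    using pser_has_field_derivative[OF exp_bounded_kummer[OF m], of z] unfolding kummer_def by (simp only:)
qed

lemma kummer_psi_has_field_derivative:
  assumes m: "m \<ge> 1"
  shows "(kummer_psi m has_field_derivative of_real ((real m - 1/2) / (real m + 1)) * kummer_psi (Suc m) z
           - pser (\<lambda>k. kummer_coeff m (Suc k)) z) (at z)"
proof -
  have "real (Suc k) * (psi_coeff m (Suc k) * kummer_coeff m (Suc k)) =
      (real m - 1/2) / (real m + 1) * (psi_coeff (Suc m) k * kummer_coeff (Suc m) k) - kummer_coeff m (Suc k)" for k
  proof -
    have "real (Suc k) * (psi_coeff m (Suc k) * kummer_coeff m (Suc k)) =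
       psi_coeff (Suc m) k * (real (Suc k) * kummer_coeff m (Suc k)) - kummer_coeff m (Suc k)"
      unfolding psi_coeff_shift by (simp add: field_simps del: of_nat_Suc)
    then show ?thesis unfolding kummer_coeff_shift[OF m] by simp
  qed
  note e = this
  have "pser (\<lambda>k. real (Suc k) * (psi_coeff m (Suc k) * kummer_coeff m (Suc k))) z =
      of_real ((real m - 1/2) / (real m + 1)) * kummer_psi (Suc m) z - pser (\<lambda>k. kummer_coeff m (Suc k)) z"
    unfolding e kummer_psi_def
    by (subst pser_diff, intro exp_bounded_cmult exp_bounded_kummer_psi, simp,
        intro exp_bounded_Suc exp_bounded_kummer m, subst pser_cmult, intro exp_bounded_kummer_psi, simp_all)
  then show ?thesis
    using pser_has_field_derivative[OF exp_bounded_kummer_psi[OF m], of z] unfolding kummer_psi_def by (simp only:)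
qed

lemma kummer_shift:
  assumes m: "m \<ge> 1"
  shows "kummer m z = 1 + z * pser (\<lambda>k. kummer_coeff m (Suc k)) z"
  unfolding kummer_def using pser_shift[OF exp_bounded_kummer[OF m], of z] by simp

text \<open>The derivative of the logarithm contributes \<open>kummer m z / z\<close>. By
  \<open>kummer_shift\<close> all of it except 1 / z cancels against the correction series produced
  by \<open>psi_coeff_shift\<close>. The surviving 1 / z becomes a new term of the finite sum in
  \<open>laplace_fd_weight\<close>.\<close>

lemma kummer_log_has_field_derivative:
  assumes m: "m \<ge> 1" and z: "Re z > 0"
  shows "(kummer_log m has_field_derivative
      of_real ((real m - 1/2) / (real m + 1)) * kummer_log (Suc m) z + 1 / z) (at z)"
proof -
  have nz: "z \<noteq> 0" "z \<notin> \<real>\<^sub>\<le>\<^sub>0" using z by (auto simp: complex_nonpos_Reals_iff)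
  define \<alpha> where "\<alpha> = complex_of_real ((real m - 1/2) / (real m + 1))"
  let ?S = "pser (\<lambda>k. kummer_coeff m (Suc k)) z"
  have "((\<lambda>z. ln z * kummer m z + kummer_psi m z) has_field_derivative
      (inverse z * kummer m z + \<alpha> * kummer (Suc m) z * ln z) + (\<alpha> * kummer_psi (Suc m) z - ?S)) (at z)"
    unfolding \<alpha>_def using nz by (intro DERIV_add DERIV_mult has_field_derivative_Ln kummer_has_field_derivative
        kummer_psi_has_field_derivative m)
  moreover have "(inverse z * kummer m z + \<alpha> * kummer (Suc m) z * ln z) + (\<alpha> * kummer_psi (Suc m) z - ?S)
      = \<alpha> * kummer_log (Suc m) z + 1 / z"
    unfolding kummer_log_def kummer_shift[OF m] using nz by (simp add: field_simps)
  ultimately show ?thesis unfolding kummer_log_def[abs_def] \<alpha>_def by (simp only:)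
qed

section \<open>Kummer's equation for m = 1, with parameters a = 1/2 and b = 2\<close>

lemma pser_kummer_operator:
  assumes a: "exp_bounded a"
  defines "a1 \<equiv> \<lambda>k. real (Suc k) * a (Suc k)"
  defines "a2 \<equiv> \<lambda>k. real (Suc k) * a1 (Suc k)"
  shows "z * pser a2 z + (2 - z) * pser a1 z - pser a z / 2 =
    pser (\<lambda>k. (real k + 1) * (real k + 2) * a (Suc k) - (real k + 1/2) * a k) z"
proof -
  have b1: "exp_bounded a1" unfolding a1_def by (rule exp_bounded_diffs[OF a])
  have b2: "exp_bounded a2" unfolding a2_def by (rule exp_bounded_diffs[OF b1])
  have k: "exp_bounded (\<lambda>k. real k * a k)" "exp_bounded (\<lambda>k. real k * a1 k)"
    by (rule exp_bounded_mult_linear[OF a, where K=1], simp) (rule exp_bounded_mult_linear[OF b1, where K=1], simp)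
  have "(\<lambda>k. of_real (real k * a1 k) * z ^ k + 2 * (of_real (a1 k) * z ^ k) - of_real (real k * a k) * z ^ k
      - of_real (a k) * z ^ k / 2) sums
    (pser (\<lambda>k. real k * a1 k) z + 2 * pser a1 z - pser (\<lambda>k. real k * a k) z - pser a z / 2)"
    by (intro sums_add sums_diff sums_divide sums_mult pser_sums a b1 k)
  moreover have "(\<lambda>k. of_real (real k * a1 k) * z ^ k + 2 * (of_real (a1 k) * z ^ k) - of_real (real k * a k) * z ^ k
      - of_real (a k) * z ^ k / 2) =
    (\<lambda>k. of_real ((real k + 1) * (real k + 2) * a (Suc k) - (real k + 1/2) * a k) * z ^ k)"
    by (rule ext) (simp add: a1_def algebra_simps)
  ultimately have "pser (\<lambda>k. (real k + 1) * (real k + 2) * a (Suc k) - (real k + 1/2) * a k) z =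
     pser (\<lambda>k. real k * a1 k) z + 2 * pser a1 z - pser (\<lambda>k. real k * a k) z - pser a z / 2"
    unfolding pser_def[of "\<lambda>k. (real k + 1) * (real k + 2) * a (Suc k) - (real k + 1/2) * a k"] by (simp only: sums_iff)
  moreover have "pser (\<lambda>k. real k * a1 k) z = z * pser a2 z" "pser (\<lambda>k. real k * a k) z = z * pser a1 z"
    using pser_shift[OF k(2), of z] pser_shift[OF k(1), of z] by (simp_all add: a1_def a2_def)
  ultimately show ?thesis by (simp add: algebra_simps)
qed

lemma kummer_1_ode:
  defines "D1 \<equiv> pser (\<lambda>k. real (Suc k) * kummer_coeff 1 (Suc k))"
  defines "D2 \<equiv> pser (\<lambda>k. real (Suc k) * (real (Suc (Suc k)) * kummer_coeff 1 (Suc (Suc k))))"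
  shows "z * D2 z + (2 - z) * D1 z - kummer 1 z / 2 = 0"
proof -
  have "(real k + 1) * (real k + 2) * kummer_coeff 1 (Suc k) - (real k + 1/2) * kummer_coeff 1 k = 0" for k
    using kummer_coeff_Suc[of 1 k] by (simp add: algebra_simps)
  then show ?thesis unfolding D1_def D2_def kummer_def
    using pser_kummer_operator[OF exp_bounded_kummer[of 1], of z] by (simp only: pser_def) simp
qed

text \<open>With M = \<open>kummer 1\<close>, the operator applied to ln z M leaves 2 M' - M + M / z
  besides the logarithmic term. The right-hand side is the negative of this with M / z replaced by
  its regular part (M - 1) / z; the missing 1 / z is later balanced by the explicit pole of the
  transform.\<close>

lemma kummer_psi_1_ode:
  defines "D1 \<equiv> pser (\<lambda>k. real (Suc k) * (psi_coeff 1 (Suc k) * kummer_coeff 1 (Suc k)))"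
  defines "D2 \<equiv> pser (\<lambda>k. real (Suc k) * (real (Suc (Suc k)) * (psi_coeff 1 (Suc (Suc k)) * kummer_coeff 1 (Suc (Suc k)))))"
  shows "z * D2 z + (2 - z) * D1 z - kummer_psi 1 z / 2 =
     kummer 1 z - 2 * pser (\<lambda>k. real (Suc k) * kummer_coeff 1 (Suc k)) z - pser (\<lambda>k. kummer_coeff 1 (Suc k)) z"
proof -
  have "(real k + 1) * (real k + 2) * (psi_coeff 1 (Suc k) * kummer_coeff 1 (Suc k)) - (real k + 1/2) * (psi_coeff 1 k * kummer_coeff 1 k)
     = kummer_coeff 1 k - 2 * (real (Suc k) * kummer_coeff 1 (Suc k)) - kummer_coeff 1 (Suc k)" for k
  proof -
    define p where "p = kummer_coeff 1 (Suc k)"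
    have p: "kummer_coeff 1 k = (real k + 1) * (real k + 2) * p / (real k + 1/2)"
      using kummer_coeff_Suc[of 1 k] by (simp add: p_def field_simps)
    have s: "psi_coeff 1 (Suc k) = psi_coeff 1 k + 1 / (real k + 1/2) - 1 / (real k + 1) - 1 / (real k + 2)"
      using psi_coeff_Suc[of 1 k] by (simp add: add_ac)
    have nz: "real k + 1/2 \<noteq> 0" "real k + 1 \<noteq> 0" "real k + 2 \<noteq> 0" by linarith+
    \<comment> \<open>By the recurrence of the Kummer coefficients the digamma values enter only
      through their increment.\<close>
    have "(real k + 1) * (real k + 2) * (psi_coeff 1 (Suc k) * p) - (real k + 1/2) * (psi_coeff 1 k * kummer_coeff 1 k)
      = (real k + 1) * (real k + 2) * p * (psi_coeff 1 (Suc k) - psi_coeff 1 k)"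
      unfolding p using nz by (simp add: field_simps)
    also have "psi_coeff 1 (Suc k) - psi_coeff 1 k = 1 / (real k + 1/2) - 1 / (real k + 1) - 1 / (real k + 2)"
      unfolding s by simp
    also have "(real k + 1) * (real k + 2) * p * (1 / (real k + 1/2) - 1 / (real k + 1) - 1 / (real k + 2))
        = (real k + 1) * (real k + 2) * p / (real k + 1/2) - (real k + 2) * p - (real k + 1) * p"
      unfolding right_diff_distrib using nz by simp
    also have "\<dots> = kummer_coeff 1 k - (real k + 2) * p - (real k + 1) * p"
      unfolding p by simp
    finally show ?thesis unfolding p_def by (simp add: algebra_simps)
  qed
  note e = this
  have "pser (\<lambda>k. kummer_coeff 1 k - 2 * (real (Suc k) * kummer_coeff 1 (Suc k)) - kummer_coeff 1 (Suc k)) z =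
    kummer 1 z - 2 * pser (\<lambda>k. real (Suc k) * kummer_coeff 1 (Suc k)) z - pser (\<lambda>k. kummer_coeff 1 (Suc k)) z"
    unfolding kummer_def
    by (simp add: pser_diff pser_cmult exp_bounded_diff exp_bounded_cmult exp_bounded_diffs exp_bounded_Suc exp_bounded_kummer
        del: of_nat_Suc)
  then show ?thesis unfolding D1_def D2_def kummer_psi_def
    using pser_kummer_operator[OF exp_bounded_kummer_psi[of 1], of z] unfolding e by simp
qed

section \<open>The Laplace transform of the Fermi-Dirac weight\<close>

text \<open>The weight x^q sqrt (1 + \<beta> x / 2) with q = m - 3/2 in the variable u = \<beta> x /
  2, up to a power of 2 / \<beta>.\<close>

definition fd_weight :: "nat \<Rightarrow> real \<Rightarrow> real" where
  "fd_weight m u = u powr (real m - 3/2) * sqrt (1 + u)"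

lemma fd_weight_Suc: "u > 0 \<Longrightarrow> fd_weight (Suc m) u = u * fd_weight m u"
  unfolding fd_weight_def by (simp add: powr_mult_base field_simps)

lemma fd_weight_1: "u > 0 \<Longrightarrow> fd_weight 1 u = sqrt (1 + u) / sqrt u"
  unfolding fd_weight_def by (simp add: powr_minus_divide powr_half_sqrt)

lemma laplaceable_fd_weight:
  assumes m: "m \<ge> 1"
  shows "laplaceable (fd_weight m)"
proof (rule laplaceable_bound)
  show "laplaceable (\<lambda>u. u powr (real m - 3/2) + u powr (real m - 1/2))"
    using m by (intro laplaceable_add laplaceable_powr) auto
  show "fd_weight m \<in> borel_measurable borel" unfolding fd_weight_def by measurable
  fix u :: real assume u: "u > 0"
  have "sqrt (1 + u) \<le> 1 + u" using u by (intro real_le_lsqrt) (auto simp: power2_eq_square algebra_simps)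
  then have "fd_weight m u \<le> u powr (real m - 3/2) * (1 + u)"
    unfolding fd_weight_def by (intro mult_left_mono) auto
  also have "\<dots> = u powr (real m - 3/2) + u powr (real m - 1/2)"
    using u powr_mult_base[of u "real m - 3/2"] by (simp add: algebra_simps)
  finally show "\<bar>fd_weight m u\<bar> \<le> 1 * \<bar>u powr (real m - 3/2) + u powr (real m - 1/2)\<bar>"
    using u by (simp add: fd_weight_def)
qed

lemma laplace_fd_weight_deriv:
  assumes m: "m \<ge> 1" and z: "Re z > 0"
  shows "(laplace (fd_weight m) has_field_derivative - laplace (fd_weight (Suc m)) z) (at z)"
proof -
  have "laplace (fd_weight (Suc m)) z = laplace (\<lambda>u. u * fd_weight m u) z"
    by (rule laplace_cong) (rule fd_weight_Suc)
  then show ?thesis using laplace_has_field_derivative[OF laplaceable_fd_weight[OF m] z] by simp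
qed

text \<open>This is Kummer's equation for w = \<open>laplace (fd_weight 1)\<close>, because w' = -
  \<open>laplace (fd_weight 2)\<close> and w'' = \<open>laplace (fd_weight 3)\<close>.\<close>

lemma laplace_fd_weight_ode:
  assumes z: "Re z > 0"
  shows "z * laplace (fd_weight 3) z - (2 - z) * laplace (fd_weight 2) z - laplace (fd_weight 1) z / 2 = 0"
proof -
  \<comment> \<open>\<open>?F\<close> equals u^(1/2) (1 + u)^(3/2); it is chosen because its
    derivative \<open>?f\<close> is again a combination of weights, so that
    \<open>laplace_deriv\<close> yields a linear relation between their transforms.\<close>
  let ?F = "\<lambda>u. fd_weight 2 u + fd_weight 3 u"
  let ?f = "\<lambda>u. 1/2 * fd_weight 1 u + 2 * fd_weight 2 u"
  have w2: "fd_weight 2 u = sqrt u * sqrt (1 + u)" if "u > 0" for u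
  proof -
    have "fd_weight 2 u = u * (sqrt (1 + u) / sqrt u)"
      using fd_weight_Suc[OF that, of 1] fd_weight_1[OF that] by (simp add: numeral_2_eq_2)
    also have "\<dots> = (u / sqrt u) * sqrt (1 + u)" by simp
    finally show ?thesis using that by (simp add: real_div_sqrt)
  qed
  have w3: "fd_weight 3 u = u * (sqrt u * sqrt (1 + u))" if "u > 0" for u
    using fd_weight_Suc[OF that, of 2] w2[OF that] by (simp add: numeral_3_eq_3 numeral_2_eq_2)
  have F: "?F u = sqrt u * sqrt (1 + u) * (1 + u)" if "u > 0" for u
    using w2[OF that] w3[OF that] by (simp add: algebra_simps)
  have "laplace ?f z = z * laplace ?F z"
  proof (rule laplace_deriv[OF _ _ z])
    show "laplaceable ?F" "laplaceable ?f"
      by (intro laplaceable_add laplaceable_cmult laplaceable_fd_weight; simp)+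
    show "(?F has_real_derivative ?f u) (at u)" if u: "u > 0" for u
    proof (rule has_field_derivative_transform_within_open[where S="{0<..}"])
      have sp: "sqrt u > 0" "sqrt (1 + u) > 0" using u by auto
      have "((\<lambda>u. sqrt u * sqrt (1 + u) * (1 + u)) has_real_derivative
          (inverse (sqrt u) / 2 * sqrt (1 + u) + sqrt u * (inverse (sqrt (1 + u)) / 2)) * (1 + u) + sqrt u * sqrt (1 + u)) (at u)"
      proof -
        have 1: "(sqrt has_real_derivative inverse (sqrt u) / 2) (at u)" by (rule DERIV_real_sqrt[OF u])
        have "((\<lambda>u. sqrt (1 + u)) has_real_derivative inverse (sqrt (1 + u)) / 2 * (0 + 1)) (at u)"
          using u by (intro DERIV_chain2[OF DERIV_real_sqrt] DERIV_add DERIV_const DERIV_ident) auto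
        from DERIV_mult[OF DERIV_mult[OF 1 this] DERIV_add[OF DERIV_const DERIV_ident], of 1]
        show ?thesis by (rule DERIV_cong) (simp add: algebra_simps)
      qed
      also have "(inverse (sqrt u) / 2 * sqrt (1 + u) + sqrt u * (inverse (sqrt (1 + u)) / 2)) * (1 + u) + sqrt u * sqrt (1 + u) = ?f u"
      proof -
        define S R where "S = sqrt u" and "R = sqrt (1 + u)"
        have SR: "S > 0" "R > 0" "u = S * S" "1 + u = R * R" "R * R = 1 + S * S" using sp u by (auto simp: S_def R_def)
        have "(inverse S / 2 * R + S * (inverse R / 2)) * (1 + u) + S * R = inverse S / 2 * R * (1 + u) + S / 2 * (inverse R * (R * R)) + S * R"
          using SR by (simp add: algebra_simps)
        also have "\<dots> = 1/2 * (R / S) + 2 * (S * R)"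
        proof -
          have i: "inverse S * (S * S) = S" "inverse R * (R * R) = R" using SR(1,2) by simp_all
          have "inverse S / 2 * R * (1 + u) = inverse S * R / 2 + (inverse S * (S * S)) * R / 2"
            unfolding SR(3) by (simp add: algebra_simps)
          also have "inverse S * R / 2 + (inverse S * (S * S)) * R / 2 = R / S / 2 + S * R / 2"
            unfolding i(1) by (simp only: divide_inverse mult.commute)
          finally have e: "inverse S / 2 * R * (1 + u) = R / S / 2 + S * R / 2" .
          show ?thesis unfolding i(2) e by simp
        qed
        finally show ?thesis using fd_weight_1[OF u] w2[OF u] unfolding S_def R_def by simp
      qed
      finally show "((\<lambda>u. sqrt u * sqrt (1 + u) * (1 + u)) has_real_derivative ?f u) (at u)" .
    qed (use u F in auto)
    have "continuous_on {0<..} (\<lambda>u::real. 1/2 * (sqrt (1 + u) / sqrt u) + 2 * (sqrt u * sqrt (1 + u)))"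
      by (intro continuous_intros) auto
    then show "continuous_on {0<..} ?f"
      by (rule continuous_on_eq) (simp add: fd_weight_1[unfolded One_nat_def] w2)
    have "((\<lambda>u. sqrt u * sqrt (1 + u) * (1 + u)) \<longlongrightarrow> sqrt 0 * sqrt (1 + 0) * (1 + 0)) (at_right 0)"
      by (intro tendsto_intros)
    then have "((\<lambda>u. sqrt u * sqrt (1 + u) * (1 + u)) \<longlongrightarrow> 0) (at_right 0)" by simp
    then show "(?F \<longlongrightarrow> 0) (at_right 0)"
      by (rule Lim_transform_eventually) (auto simp: eventually_at_right_less F intro!: eventually_at_rightI[of 0 1])
    show "\<bar>?F u\<bar> \<le> 1 * (1 + u) ^ 2" if u: "u > 0" for u
    proof -
      have "sqrt u * sqrt (1 + u) \<le> sqrt (1 + u) * sqrt (1 + u)" using u by (intro mult_right_mono) auto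
      then have "sqrt u * sqrt (1 + u) * (1 + u) \<le> (1 + u) * (1 + u)" using u by (intro mult_right_mono) auto
      then show ?thesis using u by (simp add: F power2_eq_square)
    qed
  qed
  moreover have "laplace ?f z = 1/2 * laplace (fd_weight 1) z + 2 * laplace (fd_weight 2) z"
  proof -
    have "laplace ?f z = of_real (1/2) * laplace (fd_weight 1) z + of_real 2 * laplace (fd_weight 2) z"
      unfolding laplace_cmult[symmetric]
      by (rule laplace_add[OF _ _ z]; intro laplaceable_cmult laplaceable_fd_weight; simp)
    then show ?thesis by (simp only: of_real_divide of_real_1 of_real_numeral)
  qed
  moreover have "laplace ?F z = laplace (fd_weight 2) z + laplace (fd_weight 3) z"
    using z by (simp add: laplace_add laplaceable_fd_weight)
  ultimately show ?thesis by (simp add: algebra_simps)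
qed

section \<open>Logarithmic behaviour of the transform at the origin\<close>

lemma laplace_powr_1:
  assumes p: "p > -1"
  shows "laplace (\<lambda>u. u powr p) 1 = of_real (Gamma (p + 1))"
proof -
  have i: "set_integrable lborel {0<..} (\<lambda>u. u powr p * exp (- (1 * u)))"
    by (rule laplaceableD[OF laplaceable_powr[OF p]]) simp
  have "((\<lambda>t. t powr (p + 1 - 1) / exp t) has_integral Gamma (p + 1)) {0..}"
    by (rule Gamma_integral_real) (use p in simp)
  then have "((\<lambda>t. t powr p / exp t) has_integral Gamma (p + 1)) {0..}" by simp
  then have "((\<lambda>t. t powr p / exp t) has_integral Gamma (p + 1)) {0<..}"
  proof (subst has_integral_spike_set_eq[where T="{0..}"])
    show "negligible {x \<in> {0<..} - {0..}. x powr p / exp x \<noteq> 0}"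
      by (rule negligible_subset[of "{0}"]) auto
    show "negligible {x \<in> {0..} - {0<..}. x powr p / exp x \<noteq> 0}"
      by (rule negligible_subset[of "{0}"]) auto
  qed
  then have "integral {0<..} (\<lambda>u. u powr p * exp (- (1 * u))) = Gamma (p + 1)"
    by (intro integral_unique) (simp add: exp_minus divide_inverse)
  with set_borel_integral_eq_integral(2)[OF i] have "(LINT u:{0<..}|lborel. u powr p * exp (- (1 * u))) = Gamma (p + 1)" by simp
  then show ?thesis using laplace_of_real[of "\<lambda>u. u powr p" 1] by simp
qed

text \<open>The inequality ln y \<le> y, used at v for large v and at v^(-1/2) for small v, gives
  one majorant that is integrable at both ends.\<close>

lemma abs_ln_le:
  assumes "(v::real) > 0"
  shows "\<bar>ln v\<bar> \<le> v + 2 * v powr (-1/2)"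
proof -
  have 1: "ln v \<le> v" using ln_le_minus_one[OF assms] by linarith
  have "ln (v powr (-1/2)) \<le> v powr (-1/2)" using ln_le_minus_one[of "v powr (-1/2)"] assms by simp
  then have "- ln v \<le> 2 * v powr (-1/2)" using assms by (simp add: ln_powr)
  with 1 assms show ?thesis by (auto simp: abs_le_iff intro: add_increasing2 add_increasing)
qed

lemma laplaceable_ln: "laplaceable ln"
proof (rule laplaceable_bound)
  have "laplaceable (\<lambda>v. v)" using laplaceable_power[of 1] by simp
  then show "laplaceable (\<lambda>v. v + 2 * v powr (-1/2))"
    by (intro laplaceable_add laplaceable_cmult laplaceable_powr) auto
  show "\<bar>ln v\<bar> \<le> 1 * \<bar>v + 2 * v powr (-1/2)\<bar>" if "v > 0" for v :: real
    using abs_ln_le[OF that] by (simp add: abs_le_iff)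
qed measurable

lemma abs_exp_minus_1: "\<bar>exp y - 1\<bar> \<le> \<bar>y\<bar> * (1 + exp (y::real))"
proof (cases "y \<ge> 0")
  case True
  have "1 - y \<le> exp (-y)" using exp_ge_add_one_self[of "-y"] by simp
  then have "(1 - y) * exp y \<le> exp (-y) * exp y" by (rule mult_right_mono) simp
  then have "exp y - 1 \<le> y * exp y" by (simp add: exp_minus algebra_simps)
  also have "\<dots> \<le> y * (1 + exp y)" using True by (intro mult_left_mono) auto
  finally show ?thesis using True by simp
next
  case False
  then have "exp y < 1" by simp
  then have "\<bar>exp y - 1\<bar> = 1 - exp y" by simp
  also have "\<dots> \<le> \<bar>y\<bar> * 1" using exp_ge_add_one_self[of y] False unfolding mult_1_right by linarith
  also have "\<dots> \<le> \<bar>y\<bar> * (1 + exp y)" by (intro mult_left_mono) auto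
  finally show ?thesis .
qed

text \<open>With h = 1 / (n + 1), the functions (v^h - 1) / h tend to ln v, and by Euler's integral
  their transforms at 1 are difference quotients of Gamma at 1.\<close>

lemma laplace_ln_1: "laplace ln 1 = - euler_mascheroni"
proof -
  let ?s = "\<lambda>n v. real (Suc n) * (v powr (1 / real (Suc n)) - 1)"
  have "(\<lambda>n. LINT v|lborel. indicator {0<..} v *\<^sub>R (?s n v * exp (- (1 * v)))) \<longlonglongrightarrow>
        (LINT v|lborel. indicator {0<..} v *\<^sub>R (ln v * exp (- (1 * v))))"
  proof (rule integral_dominated_convergence[where w="\<lambda>v::real. indicator {0<..} v *\<^sub>R (\<bar>ln v * (2 + v)\<bar> * exp (- (1 * v)))"])
    have "laplaceable (\<lambda>v. 2 * ln v + v * ln v)"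
      by (intro laplaceable_add laplaceable_cmult laplaceable_mult_id laplaceable_ln)
    then have "laplaceable (\<lambda>v. \<bar>ln v * (2 + v)\<bar>)"
      by (rule laplaceable_bound[where C=1]) (auto simp: algebra_simps)
    from laplaceableD[OF this, of 1] show "integrable lborel (\<lambda>v::real. indicator {0<..} v *\<^sub>R (\<bar>ln v * (2 + v)\<bar> * exp (- (1 * v))))"
      by (simp add: set_integrable_def)
    have n0: "(\<lambda>n. 1 / real (Suc n)) \<longlonglongrightarrow> 0"
      using LIMSEQ_inverse_real_of_nat by (simp add: inverse_eq_divide)
    show "AE v in lborel. (\<lambda>n. indicator {0<..} v *\<^sub>R (?s n v * exp (- (1 * v)))) \<longlonglongrightarrow> indicator {0<..} v *\<^sub>R (ln v * exp (- (1 * v)))"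
    proof (intro AE_I2)
      fix v :: real
      show "(\<lambda>n. indicator {0<..} v *\<^sub>R (?s n v * exp (- (1 * v)))) \<longlonglongrightarrow> indicator {0<..} v *\<^sub>R (ln v * exp (- (1 * v)))"
      proof (cases "v > 0")
        case True
        have "((\<lambda>h. exp (h * ln v)) has_real_derivative ln v) (at 0)"
          by (auto intro!: derivative_eq_intros)
        then have "((\<lambda>h. (exp ((0 + h) * ln v) - exp (0 * ln v)) / h) \<longlongrightarrow> ln v) (at 0)"
          unfolding DERIV_def .
        from filterlim_compose[OF this, of "\<lambda>n. 1 / real (Suc n)"]
        have "(\<lambda>n. (exp ((0 + 1 / real (Suc n)) * ln v) - exp (0 * ln v)) / (1 / real (Suc n))) \<longlonglongrightarrow> ln v"
          using n0 by (auto simp: filterlim_at)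
        moreover have "(\<lambda>n. (exp ((0 + 1 / real (Suc n)) * ln v) - exp (0 * ln v)) / (1 / real (Suc n))) = (\<lambda>n. ?s n v)"
          using True by (auto simp: powr_def)
        ultimately have "(\<lambda>n. ?s n v) \<longlonglongrightarrow> ln v" by simp
        then show ?thesis by (intro tendsto_intros)
      qed simp
    qed
    show "AE v in lborel. norm (indicator {0<..} v *\<^sub>R (?s n v * exp (- (1 * v)))) \<le> indicator {0<..} v *\<^sub>R (\<bar>ln v * (2 + v)\<bar> * exp (- (1 * v)))" for n
    proof (intro AE_I2)
      fix v :: real
      show "norm (indicator {0<..} v *\<^sub>R (?s n v * exp (- (1 * v)))) \<le> indicator {0<..} v *\<^sub>R (\<bar>ln v * (2 + v)\<bar> * exp (- (1 * v)))"
      proof (cases "v > 0")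
        case True
        let ?h = "1 / real (Suc n)"
        have e: "v powr ?h = exp (?h * ln v)" using True by (simp add: powr_def)
        \<comment> \<open>Since 0 < h \<le> 1, the power is at most v for v \<ge> 1 and at most 1
          otherwise; the majorant thus becomes independent of \<open>n\<close>.\<close>
        have "v powr ?h \<le> 1 + v"
        proof (cases "v \<ge> 1")
          case True
          then have "v powr ?h \<le> v powr 1" by (intro powr_mono) auto
          then show ?thesis using True by simp
        next
          case False
          then have "v powr ?h \<le> 1" using \<open>v > 0\<close> by (intro powr_le1) auto
          then show ?thesis using \<open>v > 0\<close> by simp
        qed
        have "\<bar>v powr ?h - 1\<bar> \<le> \<bar>?h * ln v\<bar> * (1 + v powr ?h)"
          unfolding e by (rule abs_exp_minus_1)
        also have "\<dots> \<le> \<bar>?h * ln v\<bar> * (2 + v)" using \<open>v powr ?h \<le> 1 + v\<close> by (intro mult_left_mono) auto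
        finally have "real (Suc n) * \<bar>v powr ?h - 1\<bar> \<le> real (Suc n) * (\<bar>?h * ln v\<bar> * (2 + v))"
          by (intro mult_left_mono) auto
        also have "\<dots> = \<bar>ln v * (2 + v)\<bar>" using True by (simp add: abs_mult)
        finally show ?thesis using True by (simp add: abs_mult mult_right_mono)
      qed simp
    qed
  qed measurable
  then have 1: "(\<lambda>n. LINT v:{0<..}|lborel. ?s n v * exp (- (1 * v))) \<longlonglongrightarrow> (LINT v:{0<..}|lborel. ln v * exp (- (1 * v)))"
    by (simp only: set_lebesgue_integral_def)
  have "(LINT v:{0<..}|lborel. ?s n v * exp (- (1 * v))) = (Gamma (1 + 1 / real (Suc n)) - 1) / (1 / real (Suc n))" for n
  proof -
    have "complex_of_real (LINT v:{0<..}|lborel. ?s n v * exp (- (1 * v))) = laplace (?s n) 1"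
      by (subst laplace_of_real[symmetric]) simp
    also have "\<dots> = of_real (real (Suc n)) * (of_real (Gamma (1 + 1 / real (Suc n))) - 1)"
    proof -
      have p: "-1 < 1 / real (Suc n)" by (rule order_less_le_trans[of _ 0]) auto
      have "laplace (\<lambda>u. u powr (1 / real (Suc n)) - u ^ 0) 1 = of_real (Gamma (1 / real (Suc n) + 1)) - fact 0 / 1 ^ Suc 0"
        by (subst laplace_diff[OF laplaceable_powr[OF p] laplaceable_power]) (simp_all only: laplace_powr_1[OF p] laplace_power one_complex.sel zero_less_one)
      then show ?thesis unfolding laplace_cmult by (simp add: add.commute del: of_nat_Suc)
    qed
    also have "\<dots> = complex_of_real ((Gamma (1 + 1 / real (Suc n)) - 1) / (1 / real (Suc n)))"
      by (simp del: of_nat_Suc)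
    finally show ?thesis by (simp only: of_real_eq_iff)
  qed
  note e = this
  have 2: "(\<lambda>n. (Gamma (1 + 1 / real (Suc n)) - 1) / (1 / real (Suc n))) \<longlonglongrightarrow> - euler_mascheroni"
  proof -
    have "(Gamma has_real_derivative Gamma 1 * Digamma 1) (at (1::real))"
      by (rule has_field_derivative_Gamma) simp
    then have "((\<lambda>h. (Gamma (1 + h) - Gamma 1) / h) \<longlongrightarrow> (- euler_mascheroni :: real)) (at 0)"
      by (simp add: DERIV_def)
    from filterlim_compose[OF this, of "\<lambda>n. 1 / real (Suc n)"] show ?thesis
      using LIMSEQ_inverse_real_of_nat by (auto simp: filterlim_at inverse_eq_divide)
  qed
  have "(LINT v:{0<..}|lborel. ln v * exp (- (1 * v))) = (- euler_mascheroni :: real)"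
    using 1 unfolding e by (rule LIMSEQ_unique) (rule 2)
  then show ?thesis using laplace_of_real[of ln 1] by simp
qed

text \<open>Subtracting 1, the limit of the weight at infinity, leaves a function of size 1 / (2 u),
  so the antiderivative grows like ln u / 2. In the transform, the 1 accounts for the pole 1 / z and
  this growth for the logarithm.\<close>

lemma fd_weight_1_antiderivative:
  assumes u: "u > 0"
  shows "((\<lambda>u. sqrt u * sqrt (1 + u) + ln (sqrt u + sqrt (1 + u)) - u) has_real_derivative fd_weight 1 u - 1) (at u)"
proof -
  define S R where "S = sqrt u" and "R = sqrt (1 + u)"
  have SR: "S > 0" "R > 0" "u = S * S" "R * R = 1 + S * S" using u by (auto simp: S_def R_def)
  have 1: "(sqrt has_real_derivative inverse S / 2) (at u)" unfolding S_def by (rule DERIV_real_sqrt[OF u])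
  have 2: "((\<lambda>u. sqrt (1 + u)) has_real_derivative inverse R / 2) (at u)"
    using u DERIV_chain2[OF DERIV_real_sqrt DERIV_add[OF DERIV_const DERIV_ident], of "1" u UNIV] by (simp add: R_def)
  have 3: "((\<lambda>u. ln (sqrt u + sqrt (1 + u))) has_real_derivative inverse (S + R) * (inverse S / 2 + inverse R / 2)) (at u)"
    unfolding S_def R_def
    by (rule DERIV_chain2[OF DERIV_ln DERIV_add[OF 1 2, unfolded S_def R_def]]) (use u in \<open>auto intro: add_pos_pos\<close>)
  have "((\<lambda>u. sqrt u * sqrt (1 + u) + ln (sqrt u + sqrt (1 + u)) - u) has_real_derivative
      (inverse S / 2 * sqrt (1 + u) + inverse R / 2 * sqrt u) + inverse (S + R) * (inverse S / 2 + inverse R / 2) - 1) (at u)"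
    by (intro DERIV_diff DERIV_add DERIV_ident DERIV_mult 1 2 3)
  moreover have "(inverse S / 2 * sqrt (1 + u) + inverse R / 2 * sqrt u) + inverse (S + R) * (inverse S / 2 + inverse R / 2) = R / S"
  proof -
    have "inverse (S + R) * (inverse S / 2 + inverse R / 2) = 1 / (2 * S * R)"
      using SR by (simp add: divide_simps)
    moreover have "inverse S / 2 * R + inverse R / 2 * S = (R * R + S * S) / (2 * S * R)"
      using SR(1,2) by (simp add: divide_simps)
    ultimately have "(inverse S / 2 * R + inverse R / 2 * S) + inverse (S + R) * (inverse S / 2 + inverse R / 2)
       = (R * R + S * S + 1) / (2 * S * R)" by (simp add: add_divide_distrib)
    also have "R * R + S * S + 1 = 2 * (R * R)" using SR by simp
    also have "2 * (R * R) / (2 * S * R) = R / S" using SR(1,2) by simp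
    finally show ?thesis by (simp add: S_def R_def)
  qed
  ultimately show ?thesis using fd_weight_1[OF u] by (simp add: S_def R_def)
qed

text \<open>Writing sqrt (1 + u) = sqrt u sqrt (1 + 1/u) allows the difference to be rationalised
  and separates the logarithm. The bracket tends to 1/2 + ln 2 for large \<open>u\<close>.\<close>

lemma antiderivative_asymp:
  fixes u :: real
  assumes u: "u > 0"
  shows "sqrt u * sqrt (1 + u) + ln (sqrt u + sqrt (1 + u)) - u =
    ln u / 2 + (1 / (sqrt (1 + 1 / u) + 1) + ln (1 + sqrt (1 + 1 / u)))"
proof -
  define R where "R = sqrt (1 + 1 / u)"
  have R: "R > 0" "R * R = 1 + 1 / u" using u by (auto simp: R_def add_pos_pos)
  have "1 + u = u * (1 + 1 / u)" using u by (simp add: field_simps)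
  then have e: "sqrt (1 + u) = sqrt u * R" by (simp add: R_def real_sqrt_mult[symmetric])
  have "sqrt u * sqrt (1 + u) = (sqrt u * sqrt u) * R" unfolding e by simp
  then have "sqrt u * sqrt (1 + u) - u = u * (R - 1)" using u by (simp add: algebra_simps)
  also have "\<dots> = u * ((R * R - 1) / (R + 1))" using R(1) by (simp add: field_simps)
  also have "\<dots> = 1 / (R + 1)" using u unfolding R(2) by simp
  finally have 1: "sqrt u * sqrt (1 + u) - u = 1 / (R + 1)" .
  have "sqrt u + sqrt (1 + u) = sqrt u * (1 + R)" unfolding e by (simp add: algebra_simps)
  then have "ln (sqrt u + sqrt (1 + u)) = ln (sqrt u) + ln (1 + R)"
    using u R(1) by (simp add: ln_mult)
  also have "ln (sqrt u) = ln u / 2" using u by (simp add: ln_sqrt)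
  finally show ?thesis using 1 unfolding R_def by linarith
qed

text \<open>Without its pole the transform at \<open>t\<close> is t times the transform of the
  antiderivative \<Phi>, that is, the integral of \<Phi> (v / t) e^(-v) over v > 0. By
  \<open>antiderivative_asymp\<close> the term - ln t / 2 splits off; dominated convergence leaves
  1/2 + ln 2 plus half of the integral in \<open>laplace_ln_1\<close>.\<close>

lemma laplace_fd_weight_1_limit:
  "((\<lambda>t. laplace (fd_weight 1) (of_real t) - 1 / of_real t + of_real (ln t / 2)) \<longlongrightarrow>
      of_real (1/2 + ln 2 - euler_mascheroni / 2)) (at_right 0)"
proof -
  define \<Phi> where "\<Phi> = (\<lambda>u::real. sqrt u * sqrt (1 + u) + ln (sqrt u + sqrt (1 + u)) - u)"
  define g where "g = (\<lambda>u::real. 1 / (sqrt (1 + 1 / u) + 1) + ln (1 + sqrt (1 + 1 / u)))"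
  have \<Phi>g: "\<Phi> u = ln u / 2 + g u" if "u > 0" for u
    unfolding \<Phi>_def g_def by (rule antiderivative_asymp[OF that])
  have bnd: "\<bar>\<Phi> u\<bar> \<le> 4 * (1 + u)" if u: "u > 0" for u
  proof -
    have s: "sqrt u \<le> 1 + u" "sqrt (1 + u) \<le> 1 + u" using u
      by (auto intro!: real_le_lsqrt simp: power2_eq_square algebra_simps)
    have "sqrt u * sqrt (1 + u) \<le> sqrt (1 + u) * sqrt (1 + u)" using u by (intro mult_right_mono) auto
    then have p: "sqrt u * sqrt (1 + u) \<le> 1 + u" "0 \<le> sqrt u * sqrt (1 + u)" using u by auto
    have "1 \<le> sqrt (1 + u)" "0 \<le> sqrt u" using u by auto
    then have a: "1 \<le> sqrt u + sqrt (1 + u)" by linarith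
    then have "0 \<le> ln (sqrt u + sqrt (1 + u))" by simp
    moreover have "ln (sqrt u + sqrt (1 + u)) \<le> sqrt u + sqrt (1 + u)"
      using ln_le_minus_one[of "sqrt u + sqrt (1 + u)"] a by linarith
    moreover have "\<bar>A + L - u\<bar> \<le> 4 * (1 + u)"
      if "0 \<le> L" "L \<le> S + R" "S \<le> 1 + u" "R \<le> 1 + u" "A \<le> 1 + u" "0 \<le> A" for A L S R :: real
      using that u by argo
    ultimately show ?thesis unfolding \<Phi>_def using s p by blast
  qed
  have l\<Phi>: "laplaceable \<Phi>"
  proof (rule laplaceable_bound)
    show "laplaceable (\<lambda>u. u ^ 0 + u ^ 1)" by (intro laplaceable_add laplaceable_power)
    show "\<Phi> \<in> borel_measurable borel" unfolding \<Phi>_def by measurable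
    show "\<bar>\<Phi> u\<bar> \<le> 4 * \<bar>u ^ 0 + u ^ 1\<bar>" if "u > 0" for u using bnd[OF that] that by simp
  qed
  have lw: "laplaceable (\<lambda>u. fd_weight 1 u - u ^ 0)"
    by (intro laplaceable_diff laplaceable_power laplaceable_fd_weight) simp
  have 1: "laplace (fd_weight 1) (of_real t) - 1 / of_real t = of_real t * laplace \<Phi> (of_real t)" if t: "t > 0" for t
  proof -
    have z: "Re (of_real t) > 0" using t by simp
    have "laplace (\<lambda>u. fd_weight 1 u - u ^ 0) (of_real t) = of_real t * laplace \<Phi> (of_real t)"
    proof (rule laplace_deriv[OF l\<Phi> lw z])
      show "(\<Phi> has_real_derivative fd_weight 1 u - u ^ 0) (at u)" if "u > 0" for u
        using fd_weight_1_antiderivative[OF that] unfolding \<Phi>_def by simp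
      have "continuous_on {0<..} (\<lambda>u::real. sqrt (1 + u) / sqrt u - 1)"
        by (intro continuous_intros) auto
      then show "continuous_on {0<..} (\<lambda>u. fd_weight 1 u - u ^ 0)"
        by (rule continuous_on_eq) (simp add: fd_weight_1[unfolded One_nat_def])
      have "(\<Phi> \<longlongrightarrow> sqrt 0 * sqrt (1 + 0) + ln (sqrt 0 + sqrt (1 + 0)) - 0) (at_right 0)"
        unfolding \<Phi>_def by (intro tendsto_intros) auto
      then show "(\<Phi> \<longlongrightarrow> 0) (at_right 0)" by simp
      show "\<bar>\<Phi> u\<bar> \<le> 4 * (1 + u) ^ 2" if "u > 0" for u
      proof -
        have "4 * (1 + u) * 1 \<le> 4 * (1 + u) * (1 + u)" using that by (intro mult_left_mono) auto
        with bnd[OF that] have "\<bar>\<Phi> u\<bar> \<le> 4 * (1 + u) * (1 + u)" by linarith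
        then show ?thesis by (simp only: power2_eq_square mult.assoc)
      qed
    qed
    moreover have "laplace (\<lambda>u. fd_weight 1 u - u ^ 0) (of_real t) = laplace (fd_weight 1) (of_real t) - fact 0 / of_real t ^ Suc 0"
      using z by (simp only: laplace_diff[OF laplaceable_fd_weight[of 1] laplaceable_power z] laplace_power order_refl)
    ultimately show ?thesis by simp
  qed
  \<comment> \<open>Here x = 1 / t, so that the limit can be taken at infinity.\<close>
  have 2: "laplace (fd_weight 1) (of_real (inverse x)) - 1 / of_real (inverse x) + of_real (ln (inverse x) / 2) =
      of_real (LINT v|lborel. indicator {0<..} v *\<^sub>R ((g (x * v) + ln v / 2) * exp (- (1 * v))))" if x: "x > 0" for x
  proof -
    have lx: "laplaceable (\<lambda>v. \<Phi> (x * v))"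
    proof (rule laplaceable_bound)
      show "laplaceable (\<lambda>u. u ^ 0 + x * u ^ 1)" by (intro laplaceable_add laplaceable_cmult laplaceable_power)
      show "(\<lambda>v. \<Phi> (x * v)) \<in> borel_measurable borel" using l\<Phi> laplaceable_measurable by measurable
      show "\<bar>\<Phi> (x * v)\<bar> \<le> 4 * \<bar>v ^ 0 + x * v ^ 1\<bar>" if "v > 0" for v using bnd[of "x * v"] that x by simp
    qed
    have "laplace (fd_weight 1) (of_real (inverse x)) - 1 / of_real (inverse x) = laplace (\<lambda>v. \<Phi> (x * v)) 1"
      unfolding 1[OF positive_imp_inverse_positive[OF x]] laplace_scale[OF x] by (simp add: divide_inverse)
    moreover have "of_real (ln (inverse x) / 2) = laplace (\<lambda>v. (- ln x / 2) * v ^ 0) 1"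
      unfolding laplace_cmult using x by (simp add: laplace_1 ln_inverse)
    ultimately have "laplace (fd_weight 1) (of_real (inverse x)) - 1 / of_real (inverse x) + of_real (ln (inverse x) / 2) =
        laplace (\<lambda>v. \<Phi> (x * v) + (- ln x / 2) * v ^ 0) 1"
      by (simp add: laplace_add[OF lx laplaceable_cmult[OF laplaceable_power], of 1 "- ln x / 2" 0, simplified])
    also have "\<dots> = laplace (\<lambda>v. g (x * v) + ln v / 2) 1"
      by (rule laplace_cong) (use x in \<open>simp add: \<Phi>g ln_mult add_divide_distrib\<close>)
    finally show ?thesis
      using laplace_of_real[of "\<lambda>v. g (x * v) + ln v / 2" 1] by (simp only: set_lebesgue_integral_def of_real_1)
  qed
  have lim: "((\<lambda>x. LINT v|lborel. indicator {0<..} v *\<^sub>R ((g (x * v) + ln v / 2) * exp (- (1 * v)))) \<longlongrightarrow>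
      (LINT v|lborel. indicator {0<..} v *\<^sub>R ((1/2 + ln 2 + ln v / 2) * exp (- (1 * v))))) at_top"
  proof (rule integral_dominated_convergence_at_top[where w="\<lambda>v. indicator {0<..} v *\<^sub>R ((2 + v powr (-1/2) + \<bar>ln v\<bar>) * exp (- (1 * v)))"])
    have la: "laplaceable (\<lambda>v. \<bar>ln v\<bar>)"
      by (rule laplaceable_bound[OF laplaceable_ln, where C=1]) auto
    have "laplaceable (\<lambda>v. 2 * v ^ 0 + v powr (-1/2) + \<bar>ln v\<bar>)"
      by (intro laplaceable_add laplaceable_cmult laplaceable_power laplaceable_powr la) simp
    from laplaceableD[OF this, of 1]
    show "integrable lborel (\<lambda>v::real. indicator {0<..} v *\<^sub>R ((2 + v powr (-1/2) + \<bar>ln v\<bar>) * exp (- (1 * v))))"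
      by (simp add: set_integrable_def)
    show "AE v in lborel. ((\<lambda>x. indicator {0<..} v *\<^sub>R ((g (x * v) + ln v / 2) * exp (- (1 * v)))) \<longlongrightarrow>
        indicator {0<..} v *\<^sub>R ((1/2 + ln 2 + ln v / 2) * exp (- (1 * v)))) at_top"
    proof (intro AE_I2)
      fix v :: real
      show "((\<lambda>x. indicator {0<..} v *\<^sub>R ((g (x * v) + ln v / 2) * exp (- (1 * v)))) \<longlongrightarrow>
        indicator {0<..} v *\<^sub>R ((1/2 + ln 2 + ln v / 2) * exp (- (1 * v)))) at_top"
      proof (cases "v > 0")
        case True
        have "filterlim (\<lambda>x. x * v) at_top at_top"
          by (rule filterlim_at_top_mult_tendsto_pos[OF tendsto_const True filterlim_ident])
        then have "((\<lambda>x. 1 / (x * v)) \<longlongrightarrow> 0) at_top"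
          by (rule real_tendsto_divide_at_top[OF tendsto_const])
        then have "((\<lambda>x. g (x * v)) \<longlongrightarrow> 1 / (sqrt (1 + 0) + 1) + ln (1 + sqrt (1 + 0))) at_top"
          unfolding g_def by (intro tendsto_intros) auto
        then have "((\<lambda>x. g (x * v)) \<longlongrightarrow> 1 / 2 + ln 2) at_top" by simp
        then show ?thesis by (intro tendsto_intros)
      qed simp
    qed
    show "eventually (\<lambda>x. AE v in lborel. norm (indicator {0<..} v *\<^sub>R ((g (x * v) + ln v / 2) * exp (- (1 * v))))
       \<le> indicator {0<..} v *\<^sub>R ((2 + v powr (-1/2) + \<bar>ln v\<bar>) * exp (- (1 * v)))) at_top"
      using eventually_ge_at_top[of 1]
    proof eventually_elim
      case (elim x)
      show ?case
      proof (intro AE_I2)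
        fix v :: real
        show "norm (indicator {0<..} v *\<^sub>R ((g (x * v) + ln v / 2) * exp (- (1 * v))))
          \<le> indicator {0<..} v *\<^sub>R ((2 + v powr (-1/2) + \<bar>ln v\<bar>) * exp (- (1 * v)))"
        proof (cases "v > 0")
          case True
          have xv: "x * v > 0" using True elim by simp
          \<comment> \<open>For x \<ge> 1 the square root in \<open>g (x * v)\<close> is at most 1 +
            v^(-1/2), independently of \<open>x\<close>, and this singularity at 0 is
            integrable.\<close>
          have "1 / (x * v) \<le> 1 / v" using True elim by (intro divide_left_mono) auto
          then have "sqrt (1 + 1 / (x * v)) \<le> sqrt (1 + 1 / v)" by simp
          also have "\<dots> \<le> sqrt 1 + sqrt (1 / v)" using True by (intro sqrt_add_le_add_sqrt) auto
          also have "sqrt (1 / v) = v powr (-1/2)" using True by (simp add: powr_minus_divide powr_half_sqrt real_sqrt_divide)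
          finally have r: "sqrt (1 + 1 / (x * v)) \<le> 1 + v powr (-1/2)" by simp
          have R0: "sqrt (1 + 1 / (x * v)) \<ge> 0" using xv by simp
          have a: "0 \<le> 1 / (sqrt (1 + 1 / (x * v)) + 1)" "1 / (sqrt (1 + 1 / (x * v)) + 1) \<le> 1"
          proof -
            define q where "q = sqrt (1 + 1 / (x * v))"
            have "q \<ge> 0" using R0 by (simp add: q_def)
            then show "0 \<le> 1 / (sqrt (1 + 1 / (x * v)) + 1)" "1 / (sqrt (1 + 1 / (x * v)) + 1) \<le> 1"
              unfolding q_def[symmetric] by simp_all
          qed
          have b: "0 \<le> ln (1 + sqrt (1 + 1 / (x * v)))" using R0 by simp
          have c: "ln (1 + sqrt (1 + 1 / (x * v))) \<le> sqrt (1 + 1 / (x * v))"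
            using R0 by (rule ln_add_one_self_le_self)
          have "\<bar>g (x * v)\<bar> \<le> 2 + v powr (-1/2)" unfolding g_def using a b c r by linarith
          then have "\<bar>g (x * v) + ln v / 2\<bar> \<le> 2 + v powr (-1/2) + \<bar>ln v\<bar>" by linarith
          then show ?thesis using True by (simp add: abs_mult mult_right_mono)
        qed simp
      qed
    qed
  qed (auto simp: g_def)
  have val: "(LINT v|lborel. indicator {0<..} v *\<^sub>R ((1/2 + ln 2 + ln v / 2) * exp (- (1 * v)))) = (1/2 + ln 2 - euler_mascheroni / 2 :: real)"
  proof -
    have "complex_of_real (LINT v:{0<..}|lborel. ((1/2 + ln 2) * v ^ 0 + 1/2 * ln v) * exp (- (1 * v))) =
       laplace (\<lambda>v. (1/2 + ln 2) * v ^ 0 + 1/2 * ln v) 1"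
      by (subst laplace_of_real[symmetric]) simp
    also have "\<dots> = laplace (\<lambda>v. (1/2 + ln 2) * v ^ 0) 1 + laplace (\<lambda>v. 1/2 * ln v) 1"
      by (rule laplace_add; (intro laplaceable_cmult laplaceable_ln laplaceable_power)?) simp
    also have "\<dots> = of_real (1/2 + ln 2) * 1 + of_real (1/2) * - euler_mascheroni"
      unfolding laplace_cmult laplace_ln_1 by (simp add: laplace_1)
    also have "\<dots> = of_real (1/2 + ln 2 - euler_mascheroni / 2)" by (simp add: of_real_euler_mascheroni)
    finally have "(LINT v:{0<..}|lborel. ((1/2 + ln 2) * v ^ 0 + 1/2 * ln v) * exp (- (1 * v))) = (1/2 + ln 2 - euler_mascheroni / 2 :: real)"
      by (simp only: of_real_eq_iff)
    then show ?thesis by (simp add: set_lebesgue_integral_def)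
  qed
  have "((\<lambda>x. complex_of_real (LINT v|lborel. indicator {0<..} v *\<^sub>R ((g (x * v) + ln v / 2) * exp (- (1 * v)))))
     \<longlongrightarrow> of_real (1/2 + ln 2 - euler_mascheroni / 2)) at_top"
    by (intro tendsto_of_real lim[unfolded val])
  then have "((\<lambda>x. laplace (fd_weight 1) (of_real (inverse x)) - 1 / of_real (inverse x) + of_real (ln (inverse x) / 2))
     \<longlongrightarrow> of_real (1/2 + ln 2 - euler_mascheroni / 2)) at_top"
    by (rule Lim_transform_eventually) (use eventually_gt_at_top[of 0] in eventually_elim, simp only: 2)
  then show ?thesis unfolding filterlim_at_right_to_top .
qed

text \<open>The weight sqrt (u (1 + u)) lies between u and u + 1/2, so its transform differs from 1
  / t^2 by at most 1 / (2 t). This controls the derivative of the transform in the Wronskian at the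
  origin.\<close>

lemma laplace_fd_weight_2_limit:
  "((\<lambda>t. of_real t ^ 2 * laplace (fd_weight 2) (of_real t)) \<longlongrightarrow> 1) (at_right 0)"
proof -
  have b: "norm (of_real t ^ 2 * laplace (fd_weight 2) (of_real t) - 1) \<le> t / 2" if t: "t > 0" for t :: real
  proof -
    have z: "Re (of_real t) > 0" using t by simp
    have l: "laplaceable (\<lambda>u. fd_weight 2 u - u ^ 1)"
      by (intro laplaceable_diff laplaceable_fd_weight laplaceable_power) simp
    have lc: "set_integrable lborel {0<..} (\<lambda>u. 1/2 * u ^ 0 * exp (- (Re (of_real t) * u)))"
      by (rule laplaceableD[OF laplaceable_cmult[OF laplaceable_power] z])
    have "norm (laplace (\<lambda>u. fd_weight 2 u - u ^ 1) (of_real t)) \<le>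
        (LINT u:{0<..}|lborel. \<bar>fd_weight 2 u - u ^ 1\<bar> * exp (- (Re (of_real t) * u)))"
      by (rule norm_laplace_le[OF l z])
    also have "\<dots> \<le> (LINT u:{0<..}|lborel. 1/2 * u ^ 0 * exp (- (Re (of_real t) * u)))"
    proof (rule set_integral_mono[OF _ lc])
      show "set_integrable lborel {0<..} (\<lambda>u. \<bar>fd_weight 2 u - u ^ 1\<bar> * exp (- (Re (of_real t) * u)))"
        using set_integrable_abs[OF laplaceableD[OF l z]] by (simp add: abs_mult)
      fix u :: real assume "u \<in> {0<..}"
      then have u: "u > 0" by simp
      have "fd_weight 2 u = u * (sqrt (1 + u) / sqrt u)"
        using fd_weight_Suc[OF u, of 1] fd_weight_1[OF u] by (simp add: numeral_2_eq_2)
      also have "\<dots> = (u / sqrt u) * sqrt (1 + u)" by simp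
      also have "\<dots> = sqrt (u * (1 + u))" using u by (simp add: real_div_sqrt real_sqrt_mult)
      finally have e: "fd_weight 2 u = sqrt (u * (1 + u))" .
      have "u \<le> sqrt (u * (1 + u))" using u by (intro real_le_rsqrt) (simp add: power2_eq_square algebra_simps)
      moreover have "sqrt (u * (1 + u)) \<le> (u + (1 + u)) / 2" using u by (intro arith_geo_mean_sqrt) auto
      ultimately have "\<bar>fd_weight 2 u - u ^ 1\<bar> \<le> 1/2 * u ^ 0" unfolding e by simp
      then show "\<bar>fd_weight 2 u - u ^ 1\<bar> * exp (- (Re (of_real t) * u)) \<le> 1/2 * u ^ 0 * exp (- (Re (of_real t) * u))"
        by (intro mult_right_mono) auto
    qed
    also have "\<dots> = 1 / (2 * t)"
    proof -
      have "complex_of_real (LINT u:{0<..}|lborel. 1/2 * u ^ 0 * exp (- (t * u))) = of_real (1/2) * laplace (\<lambda>u. u ^ 0) (of_real t)"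
        unfolding laplace_of_real[symmetric] laplace_cmult ..
      also have "\<dots> = of_real (1 / (2 * t))" using laplace_power[OF z, of 0] by simp
      finally show ?thesis by (simp only: of_real_eq_iff Re_complex_of_real)
    qed
    finally have "norm (laplace (fd_weight 2) (of_real t) - 1 / of_real t ^ 2) \<le> 1 / (2 * t)"
      using laplace_diff[OF laplaceable_fd_weight[of 2] laplaceable_power[of 1] z] laplace_power[OF z, of 1]
      by (simp add: power2_eq_square)
    then have "t ^ 2 * norm (laplace (fd_weight 2) (of_real t) - 1 / of_real t ^ 2) \<le> t ^ 2 * (1 / (2 * t))"
      by (intro mult_left_mono) auto
    also have "t ^ 2 * (1 / (2 * t)) = t / 2" using t by (simp add: power2_eq_square)
    also have "t ^ 2 * norm (laplace (fd_weight 2) (of_real t) - 1 / of_real t ^ 2) =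
        norm (of_real t ^ 2 * (laplace (fd_weight 2) (of_real t) - 1 / of_real t ^ 2))"
      by (simp add: norm_mult norm_power)
    also have "of_real t ^ 2 * (laplace (fd_weight 2) (of_real t) - 1 / of_real t ^ 2) =
        of_real t ^ 2 * laplace (fd_weight 2) (of_real t) - 1"
      using t by (simp add: right_diff_distrib)
    finally show ?thesis .
  qed
  have "((\<lambda>t. of_real t ^ 2 * laplace (fd_weight 2) (of_real t) - 1) \<longlongrightarrow> 0) (at_right 0)"
  proof (rule Lim_null_comparison)
    show "eventually (\<lambda>t. norm (of_real t ^ 2 * laplace (fd_weight 2) (of_real t) - 1) \<le> t / 2) (at_right 0)"
      using eventually_at_right_less[of 0] by eventually_elim (rule b)
    have "((\<lambda>t::real. t / 2) \<longlongrightarrow> 0 / 2) (at_right 0)" by (intro tendsto_intros) auto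
    then show "((\<lambda>t::real. t / 2) \<longlongrightarrow> 0) (at_right 0)" by simp
  qed
  then show ?thesis by (simp add: LIM_zero_iff)
qed

section \<open>The connection formula\<close>

lemma tendsto_t_ln_t: "((\<lambda>t. t * ln t) \<longlongrightarrow> (0::real)) (at_right 0)"
proof -
  have "((\<lambda>x::real. ln x / x) \<longlongrightarrow> 0) at_top"
    by (rule ln_x_over_x_tendsto_0)
  from tendsto_minus[OF this] have "((\<lambda>x. - (ln x / x)) \<longlongrightarrow> (0::real)) at_top" by simp
  then have "((\<lambda>x. inverse x * ln (inverse x)) \<longlongrightarrow> (0::real)) at_top"
  proof (rule Lim_transform_eventually)
    show "eventually (\<lambda>x. - (ln x / x) = inverse x * ln (inverse x)) (at_top :: real filter)"
      using eventually_gt_at_top[of 0] by eventually_elim (simp add: ln_inverse divide_inverse)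
  qed
  then show ?thesis unfolding filterlim_at_right_to_top .
qed

text \<open>Let \<open>d\<close> be the difference of both sides, a solution of Kummer's equation,
  and M = \<open>kummer 1\<close> with M(0) = 1. Near the origin the vanishing Wronskian makes
  \<open>d\<close> a multiple of M, and the limit 0 of \<open>d\<close> excludes every nonzero
  multiple. This limit is where the additive constant of the formula is decided.\<close>

lemma laplace_fd_weight_1:
  assumes z: "Re z > 0"
  shows "laplace (fd_weight 1) z = 1 / z - kummer_log 1 z / 2"
proof -
  define H where "H = {z::complex. Re z > 0}"
  have H: "open H" "convex H" unfolding H_def by (rule open_halfspace_Re_gt convex_halfspace_Re_gt)+
  define w1 w2 w3 where "w1 = laplace (fd_weight 1)" and "w2 = laplace (fd_weight 2)" and "w3 = laplace (fd_weight 3)"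
  define M M1 M2 where "M = kummer 1" and "M1 = pser (\<lambda>k. real (Suc k) * kummer_coeff 1 (Suc k))"
    and "M2 = pser (\<lambda>k. real (Suc k) * (real (Suc (Suc k)) * kummer_coeff 1 (Suc (Suc k))))"
  define G G1 G2 where "G = kummer_psi 1"
    and "G1 = pser (\<lambda>k. real (Suc k) * (psi_coeff 1 (Suc k) * kummer_coeff 1 (Suc k)))"
    and "G2 = pser (\<lambda>k. real (Suc k) * (real (Suc (Suc k)) * (psi_coeff 1 (Suc (Suc k)) * kummer_coeff 1 (Suc (Suc k)))))"
  define S where "S = pser (\<lambda>k. kummer_coeff 1 (Suc k))"
  have bM: "exp_bounded (kummer_coeff 1)" "exp_bounded (\<lambda>k. real (Suc k) * kummer_coeff 1 (Suc k))"
      "exp_bounded (\<lambda>k. kummer_coeff 1 (Suc k))"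
    by (intro exp_bounded_diffs exp_bounded_Suc exp_bounded_kummer order_refl)+
  have bG: "exp_bounded (\<lambda>k. psi_coeff 1 k * kummer_coeff 1 k)"
      "exp_bounded (\<lambda>k. real (Suc k) * (psi_coeff 1 (Suc k) * kummer_coeff 1 (Suc k)))"
    by (intro exp_bounded_diffs[of "\<lambda>k. psi_coeff 1 k * kummer_coeff 1 k"] exp_bounded_kummer_psi order_refl)+
  have dM: "(M has_field_derivative M1 z) (at z)" "(M1 has_field_derivative M2 z) (at z)" for z
    unfolding M_def M1_def M2_def kummer_def
    by (rule pser_has_field_derivative[OF bM(1)]) (rule pser_has_field_derivative[OF bM(2)])
  have dG: "(G has_field_derivative G1 z) (at z)" "(G1 has_field_derivative G2 z) (at z)" for z
    unfolding G_def G1_def G2_def kummer_psi_def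
    by (rule pser_has_field_derivative[OF bG(1)]) (rule pser_has_field_derivative[OF bG(2)])
  have dw: "(w1 has_field_derivative - w2 z) (at z)" "(w2 has_field_derivative - w3 z) (at z)" if "z \<in> H" for z
    using laplace_fd_weight_deriv[of 1 z] laplace_fd_weight_deriv[of 2 z] that
    by (simp_all add: w1_def w2_def w3_def H_def numeral_2_eq_2 numeral_3_eq_3)
  define d where "d = (\<lambda>z. w1 z - 1 / z + (ln z * M z + G z) / 2)"
  define d1 where "d1 = (\<lambda>z. - w2 z + 1 / z ^ 2 + (M z / z + ln z * M1 z + G1 z) / 2)"
  define d2 where "d2 = (\<lambda>z. w3 z - 2 / z ^ 3 + (- M z / z ^ 2 + 2 * M1 z / z + ln z * M2 z + G2 z) / 2)"
  have nzH: "z \<noteq> 0" "z \<notin> \<real>\<^sub>\<le>\<^sub>0" if "z \<in> H" for z using that by (auto simp: H_def complex_nonpos_Reals_iff)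
  have dd: "(d has_field_derivative d1 z) (at z)" if "z \<in> H" for z
    unfolding d_def d1_def using nzH[OF that]
    by (auto intro!: derivative_eq_intros dw[OF that] dM dG simp: field_simps power2_eq_square)
  have dd1: "(d1 has_field_derivative d2 z) (at z)" if "z \<in> H" for z
    unfolding d1_def d2_def using nzH[OF that]
    by (auto intro!: derivative_eq_intros dw[OF that] dM dG simp: field_simps power2_eq_square power3_eq_cube)
  \<comment> \<open>The operator maps 1 / z to 1 / (2 z) and \<open>kummer_log 1\<close> to 1 / z,
    so the two inhomogeneities cancel in \<open>d\<close>.\<close>
  have ode: "z * d2 z + (2 - z) * d1 z - d z / 2 = 0" if zH: "z \<in> H" for z
  proof -
    \<comment> \<open>With a name for the reciprocal the identity is polynomial, and the only
      relation used for \<open>i\<close> is \<open>z * i = 1\<close>.\<close>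
    define i where "i = 1 / z"
    have i: "z * i = 1" using nzH[OF zH] by (simp add: i_def)
    have o1: "z * w3 z - (2 - z) * w2 z - w1 z / 2 = 0"
      using laplace_fd_weight_ode[of z] zH by (simp add: w1_def w2_def w3_def H_def)
    have o2: "z * M2 z + (2 - z) * M1 z - M z / 2 = 0"
      unfolding M_def M1_def M2_def by (rule kummer_1_ode)
    have o3: "z * G2 z + (2 - z) * G1 z - G z / 2 = M z - 2 * M1 z - S z"
      unfolding G_def G1_def G2_def S_def M_def M1_def by (rule kummer_psi_1_ode)
    have o4: "M z = 1 + z * S z" unfolding M_def S_def by (rule kummer_shift) simp
    have e: "d z = w1 z - i + (ln z * M z + G z) / 2"
      "d1 z = - w2 z + i ^ 2 + (M z * i + ln z * M1 z + G1 z) / 2"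
      "d2 z = w3 z - 2 * i ^ 3 + (- M z * i ^ 2 + 2 * M1 z * i + ln z * M2 z + G2 z) / 2"
      by (simp_all add: d_def d1_def d2_def i_def power_divide)
    have "z * d2 z + (2 - z) * d1 z - d z / 2 = (z * w3 z - (2 - z) * w2 z - w1 z / 2)
        + ln z * (z * M2 z + (2 - z) * M1 z - M z / 2) / 2 + (z * G2 z + (2 - z) * G1 z - G z / 2) / 2
        + (- 2 * (z * i) * i ^ 2 + (- M z * (z * i) * i + 2 * M1 z * (z * i)) / 2 + 2 * i ^ 2 + M z * i - (z * i) * i - M z * (z * i) / 2 + i / 2)"
      unfolding e by (simp add: algebra_simps power2_eq_square power3_eq_cube add_divide_distrib diff_divide_distrib)
    also have "\<dots> = (i * M z - S z - i) / 2"
      unfolding o1 o2 o3 i by (simp add: algebra_simps add_divide_distrib diff_divide_distrib)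
    also have "i * M z - S z - i = (z * i) * S z - S z" unfolding o4 by (simp add: algebra_simps)
    also have "\<dots> / 2 = 0" unfolding i by simp
    finally show ?thesis .
  qed
  \<comment> \<open>The factor z^2 exp (- z) is Abel's integrating factor for b = 2; it makes the
    Wronskian of \<open>d\<close> and \<open>M\<close> constant.\<close>
  define W where "W = (\<lambda>z. exp (- z) * (z ^ 2 * (d z * M1 z) - z ^ 2 * d1 z * M z))"
  have dW: "(W has_field_derivative 0) (at z)" if zH: "z \<in> H" for z
  proof -
    have o2: "z * M2 z = (z - 2) * M1 z + M z / 2"
      using kummer_1_ode[of z] unfolding M_def M1_def M2_def by (simp add: algebra_simps)
    have o: "z * d2 z = (z - 2) * d1 z + d z / 2" using ode[OF zH] by (simp add: algebra_simps)
    have "(W has_field_derivative - exp (- z) * (z ^ 2 * (d z * M1 z) - z ^ 2 * d1 z * M z) +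
       exp (- z) * (2 * z * (d z * M1 z) + z ^ 2 * (d1 z * M1 z + d z * M2 z) - ((2 * z * d1 z + z ^ 2 * d2 z) * M z + z ^ 2 * d1 z * M1 z))) (at z)"
      unfolding W_def by (auto intro!: derivative_eq_intros dd[OF zH] dd1[OF zH] dM simp: algebra_simps)
    moreover have "- exp (- z) * (z ^ 2 * (d z * M1 z) - z ^ 2 * d1 z * M z) +
       exp (- z) * (2 * z * (d z * M1 z) + z ^ 2 * (d1 z * M1 z + d z * M2 z) - ((2 * z * d1 z + z ^ 2 * d2 z) * M z + z ^ 2 * d1 z * M1 z))
       = exp (- z) * (z * ((2 - z) * (d z * M1 z - d1 z * M z) + (d z * (z * M2 z) - (z * d2 z) * M z)))"
      by (simp add: algebra_simps power2_eq_square)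
    moreover have "\<dots> = 0" unfolding o o2 by (simp add: algebra_simps)
    ultimately show ?thesis by simp
  qed
  have cont0: "((\<lambda>t. f (of_real t)) \<longlongrightarrow> f 0) (at_right 0)" if "\<And>z. (f has_field_derivative f' z) (at z)" for f f' :: "complex \<Rightarrow> complex"
  proof -
    have "isCont f (of_real 0)" using that DERIV_isCont by force
    moreover have "((\<lambda>t. complex_of_real t) \<longlongrightarrow> of_real 0) (at_right 0)" by (intro tendsto_intros)
    ultimately show ?thesis using isCont_tendsto_compose by force
  qed
  have dS: "(S has_field_derivative pser (\<lambda>k. real (Suc k) * kummer_coeff 1 (Suc (Suc k))) z) (at z)" for z
    unfolding S_def by (rule pser_has_field_derivative[OF bM(3)])
  note lims = cont0[OF dM(1)] cont0[OF dM(2)] cont0[OF dG(1)] cont0[OF dG(2)] cont0[OF dS]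
  have tln: "((\<lambda>t. complex_of_real (t * ln t)) \<longlongrightarrow> 0) (at_right 0)"
    using tendsto_of_real[OF tendsto_t_ln_t] by simp
  have t0: "((\<lambda>t. complex_of_real t) \<longlongrightarrow> 0) (at_right 0)"
    using tendsto_of_real[OF tendsto_ident_at, of 0 "{0<..}"] by simp
  \<comment> \<open>Since M = 1 + z S, the product ln t M equals ln t + (t ln t) S. Only ln t / 2
    has to meet the logarithm of the transform; the term with t ln t tends to 0.\<close>
  have lim_d: "((\<lambda>t. d (of_real t)) \<longlongrightarrow> 0) (at_right 0)"
  proof -
    have "((\<lambda>t. (w1 (of_real t) - 1 / of_real t + of_real (ln t / 2)) + (of_real (t * ln t) * S (of_real t) + G (of_real t)) / 2)
       \<longlongrightarrow> of_real (1/2 + ln 2 - euler_mascheroni / 2) + (0 * S 0 + G 0) / 2) (at_right 0)"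
      unfolding w1_def by (intro tendsto_intros laplace_fd_weight_1_limit tln lims) auto
    \<comment> \<open>The constants match: psi (1/2) - psi (1) - psi (2) = \<gamma> - 2 ln 2 -
      1.\<close>
    moreover have "of_real (1/2 + ln 2 - euler_mascheroni / 2) + (0 * S 0 + G 0) / 2 = 0"
    proof -
      have "G 0 = of_real (psi_coeff 1 0)" unfolding G_def by (rule kummer_psi_0)
      also have "psi_coeff 1 0 = Digamma (1/2) - Digamma 1 - Digamma (1 + 1)" by (simp add: psi_coeff_def)
      also have "Digamma (1 + 1) = Digamma 1 + 1 / (1::real)" by (rule Digamma_plus1) simp
      also have "Digamma (1/2) - Digamma 1 - (Digamma 1 + 1 / 1) = - (2 * (1/2 + ln 2 - euler_mascheroni / 2 :: real))"
        by (simp add: Digamma_one_half)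
      finally have g: "G 0 = - (2 * of_real (1/2 + ln 2 - euler_mascheroni / 2))"
        by (simp only: of_real_minus of_real_mult of_real_numeral)
      have "x + (0 * y + - (2 * x)) / 2 = 0" for x y :: complex by simp
      then show ?thesis unfolding g .
    qed
    moreover have "eventually (\<lambda>t. (w1 (of_real t) - 1 / of_real t + of_real (ln t / 2)) + (of_real (t * ln t) * S (of_real t) + G (of_real t)) / 2 = d (of_real t)) (at_right 0)"
      using eventually_at_right_less[of 0]
    proof eventually_elim
      case (elim t)
      have "M (of_real t) = 1 + of_real t * S (of_real t)" unfolding M_def S_def by (rule kummer_shift) simp
      then show ?case unfolding d_def using elim by (simp add: Ln_of_real algebra_simps add_divide_distrib)
    qed
    ultimately show ?thesis using Lim_transform_eventually by fastforce
  qed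
  have lim_d1: "((\<lambda>t. of_real t ^ 2 * d1 (of_real t)) \<longlongrightarrow> 0) (at_right 0)"
  proof -
    have "((\<lambda>t. - (of_real t ^ 2 * w2 (of_real t)) + 1 + (of_real t * M (of_real t) + of_real t * of_real (t * ln t) * M1 (of_real t) + of_real t ^ 2 * G1 (of_real t)) / 2)
       \<longlongrightarrow> - 1 + 1 + (0 * M 0 + 0 * 0 * M1 0 + 0 ^ 2 * G1 0) / 2) (at_right 0)"
      unfolding w2_def by (intro tendsto_intros laplace_fd_weight_2_limit tln lims t0) auto
    moreover have "eventually (\<lambda>t. - (of_real t ^ 2 * w2 (of_real t)) + 1 + (of_real t * M (of_real t) + of_real t * of_real (t * ln t) * M1 (of_real t) + of_real t ^ 2 * G1 (of_real t)) / 2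
        = of_real t ^ 2 * d1 (of_real t)) (at_right 0)"
      using eventually_at_right_less[of 0]
      by eventually_elim (simp add: d1_def Ln_of_real field_simps power2_eq_square)
    ultimately show ?thesis using Lim_transform_eventually by fastforce
  qed
  have W0: "W z = 0" if zH: "z \<in> H" for z
  proof -
    obtain k where k: "\<And>z. z \<in> H \<Longrightarrow> W z = k"
      using has_field_derivative_zero_constant[OF H(2), of W] dW has_field_derivative_at_within by metis
    have "((\<lambda>t. W (of_real t)) \<longlongrightarrow> exp (- 0) * (0 ^ 2 * (0 * M1 0) - 0 * M 0)) (at_right 0)"
      unfolding W_def by (intro tendsto_intros t0 lim_d lim_d1 lims)
    moreover have "eventually (\<lambda>t. W (of_real t) = k) (at_right 0)"
      using eventually_at_right_less[of 0] by eventually_elim (simp add: k H_def)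
    then have "((\<lambda>t. W (of_real t)) \<longlongrightarrow> k) (at_right 0)" by (rule tendsto_eventually)
    ultimately have "k = 0" using tendsto_unique[OF trivial_limit_at_right_real] by fastforce
    then show ?thesis using k[OF zH] by simp
  qed
  have "isCont M 0" using dM(1) DERIV_isCont by blast
  then obtain r where r: "r > 0" "\<And>z. dist 0 z < r \<Longrightarrow> M z \<noteq> 0"
    using continuous_at_avoid[of 0 M 0] by (auto simp: M_def)
  \<comment> \<open>The quotient d / M is formed only near the origin, where M is known not to
    vanish; the identity theorem then carries d = 0 to the half plane.\<close>
  define U where "U = H \<inter> ball 0 r"
  have U: "open U" "convex U" "U \<subseteq> H" unfolding U_def using H by (auto intro: convex_Int)
  have MU: "M z \<noteq> 0" if "z \<in> U" for z using that r(2)[of z] by (auto simp: U_def)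
  have tU: "eventually (\<lambda>t. complex_of_real t \<in> U) (at_right 0)"
    unfolding eventually_at_right_field using r(1) by (intro exI[of _ r]) (auto simp: U_def H_def)
  have dU: "d z = 0" if zU: "z \<in> U" for z
  proof -
    have "((\<lambda>z. d z / M z) has_field_derivative 0) (at z)" if zU: "z \<in> U" for z
    proof -
      have zH: "z \<in> H" using zU U by auto
      have "z ^ 2 * (d z * M1 z - d1 z * M z) = 0" using W0[OF zH] by (simp add: W_def algebra_simps)
      then have e: "d1 z * M z - d z * M1 z = 0" using nzH[OF zH] by simp
      have "((\<lambda>z. d z / M z) has_field_derivative (d1 z * M z - d z * M1 z) / (M z * M z)) (at z)"
        by (rule DERIV_divide[OF dd[OF zH] dM(1) MU[OF zU]])
      then show ?thesis unfolding e by simp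
    qed
    then obtain k where k: "\<And>z. z \<in> U \<Longrightarrow> d z / M z = k"
      using has_field_derivative_zero_constant[OF U(2), of "\<lambda>z. d z / M z"] has_field_derivative_at_within by metis
    have "((\<lambda>t. d (of_real t) / M (of_real t)) \<longlongrightarrow> 0 / M 0) (at_right 0)"
      by (intro tendsto_intros lim_d lims) (simp add: M_def)
    moreover have "eventually (\<lambda>t. d (of_real t) / M (of_real t) = k) (at_right 0)"
      using tU by eventually_elim (rule k)
    then have "((\<lambda>t. d (of_real t) / M (of_real t)) \<longlongrightarrow> k) (at_right 0)" by (rule tendsto_eventually)
    ultimately have "k = 0" using tendsto_unique[OF trivial_limit_at_right_real] by fastforce
    then show ?thesis using k[OF zU] MU[OF zU] by simp
  qed
  have "d z = 0"
  proof (rule analytic_continuation_open[of U H d "\<lambda>_. 0" z])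
    show "U \<noteq> {}" using tU eventually_happens'[OF trivial_limit_at_right_real] by blast
    show "d holomorphic_on H" using dd H by (auto simp: holomorphic_on_open)
  qed (use U H dU z convex_connected in \<open>auto simp: H_def\<close>)
  then show ?thesis unfolding d_def w1_def kummer_log_def M_def G_def by (simp add: algebra_simps add_divide_distrib)
qed

text \<open>The binomial coefficient of 1/2 over j, that is, the j-th Taylor coefficient of sqrt (1
  + x) at 0.\<close>

definition binom_half :: "nat \<Rightarrow> real" where
  "binom_half j = (-1) ^ j * (pochhammer (-1/2) j / fact j)"

lemma binom_half_Suc: "- binom_half (Suc m) = binom_half m * ((real m - 1/2) / (real m + 1))"
  unfolding binom_half_def pochhammer_Suc fact_Suc by (simp add: divide_simps)

text \<open>The finite sum transforms the terms u^(m - 1 - j) with j < m from the expansion of u^(m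
  - 1) sqrt (1 + 1/u) at large u. In the step to \<open>Suc m\<close> the old terms are
  differentiated, and the new term j = m is the 1 / z left over by the logarithm.\<close>

theorem laplace_fd_weight:
  assumes m: "m \<ge> 1" and z: "Re z > 0"
  shows "laplace (fd_weight m) z = - of_real (binom_half m) * kummer_log m z +
    (\<Sum>j<m. of_real (binom_half j * fact (m - Suc j)) / z ^ (m - j))"
  using m z
proof (induction m arbitrary: z rule: nat_induct_at_least)
  case base
  then show ?case using laplace_fd_weight_1[of z] by (simp add: binom_half_def)
next
  case (Suc m)
  have nz: "z \<noteq> 0" using Suc.prems by auto
  let ?a = "(real m - 1/2) / (real m + 1)"
  let ?g = "\<lambda>z. - of_real (binom_half m) * kummer_log m z +
    (\<Sum>j<m. of_real (binom_half j * fact (m - Suc j)) / z ^ (m - j))"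
  have p: "((\<lambda>z. C / z ^ (m - j)) has_field_derivative - (C * of_nat (m - j) / z ^ (Suc m - j))) (at z)" if "j < m" for j C
  proof -
    define n where "n = m - Suc j"
    have n: "m - j = Suc n" using that unfolding n_def by linarith
    have n': "Suc m - j = Suc (Suc n)" using that n by linarith
    have "((\<lambda>z. C / z ^ Suc n) has_field_derivative - (C * (of_nat (Suc n) * z ^ n)) / (z ^ Suc n * z ^ Suc n)) (at z)"
      using nz by (auto intro!: derivative_eq_intros simp del: power_Suc)
    also have "- (C * (of_nat (Suc n) * z ^ n)) / (z ^ Suc n * z ^ Suc n) = - (C * of_nat (Suc n) / z ^ Suc (Suc n))"
      using nz by (simp add: divide_simps)
    finally show ?thesis unfolding n n' .
  qed
  have "(?g has_field_derivative - of_real (binom_half m) * (of_real ?a * kummer_log (Suc m) z + 1 / z) +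
      (\<Sum>j<m. - (of_real (binom_half j * fact (m - Suc j)) * of_nat (m - j) / z ^ (Suc m - j)))) (at z)"
    using Suc by (intro DERIV_add DERIV_cmult kummer_log_has_field_derivative DERIV_sum p) auto
  moreover have "(laplace (fd_weight m) has_field_derivative - laplace (fd_weight (Suc m)) z) (at z)"
    using Suc by (intro laplace_fd_weight_deriv) auto
  then have "(?g has_field_derivative - laplace (fd_weight (Suc m)) z) (at z)"
    by (rule has_field_derivative_transform_within_open[where S="{z. Re z > 0}"])
       (use Suc in \<open>auto simp: open_halfspace_Re_gt\<close>)
  ultimately have E: "- laplace (fd_weight (Suc m)) z = - of_real (binom_half m) * (of_real ?a * kummer_log (Suc m) z + 1 / z) +
      (\<Sum>j<m. - (of_real (binom_half j * fact (m - Suc j)) * of_nat (m - j) / z ^ (Suc m - j)))"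
    using DERIV_unique by blast
  have alg: "- (- b * (a * k + 1 / z) + - s) = b * a * k + b / z + s" for a b k s :: complex
    by (simp add: distrib_left mult.assoc)
  have "laplace (fd_weight (Suc m)) z = of_real (binom_half m * ?a) * kummer_log (Suc m) z + of_real (binom_half m) / z +
      (\<Sum>j<m. of_real (binom_half j * fact (m - Suc j)) * of_nat (m - j) / z ^ (Suc m - j))"
    unfolding minus_equation_iff[THEN iffD1, OF E, symmetric] sum_negf of_real_mult
    by (rule alg)
  also have "(\<Sum>j<m. of_real (binom_half j * fact (m - Suc j)) * of_nat (m - j) / z ^ (Suc m - j)) =
     (\<Sum>j<m. of_real (binom_half j * fact (Suc m - Suc j)) / z ^ (Suc m - j))"
  proof (rule sum.cong[OF refl])
    fix j assume "j \<in> {..<m}"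
    then have "fact (Suc m - Suc j) = fact (m - Suc j) * real (m - j)"
      by (metis Suc_diff_Suc diff_Suc_Suc fact_Suc lessThan_iff mult.commute of_nat_fact of_nat_mult)
    then show "of_real (binom_half j * fact (m - Suc j)) * of_nat (m - j) / z ^ (Suc m - j) =
        of_real (binom_half j * fact (Suc m - Suc j)) / z ^ (Suc m - j)"
      by (simp add: mult.assoc)
  qed
  finally show ?case unfolding binom_half_Suc[symmetric] by simp
qed

section \<open>Behaviour on vertical lines\<close>

text \<open>The quotient (a)_k / (b)_k with b - a = 3/2 is a quotient of Beta values; so the
  coefficients are moments of a positive density on the unit interval, divided by k!.\<close>

lemma kummer_coeff_Beta:
  assumes m: "m \<ge> 1"
  shows "kummer_coeff m k = Beta (real m - 1/2 + real k) (3/2) / Beta (real m - 1/2) (3/2) / fact k"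
proof -
  let ?a = "real m - 1/2"
  have a: "?a > 0" using m by simp
  have G: "Gamma ?a > 0" "Gamma (real m + 1) > 0" "Gamma (?a + real k) > 0" "Gamma (real m + 1 + real k) > 0" "Gamma (3/2 :: real) > 0"
    using a by (auto intro!: Gamma_real_pos)
  have 1: "pochhammer ?a k = Gamma (?a + real k) / Gamma ?a"
    using a by (intro pochhammer_Gamma) (auto elim!: nonpos_Ints_cases)
  have 2: "pochhammer (real m + 1) k = Gamma (real m + 1 + real k) / Gamma (real m + 1)"
    by (intro pochhammer_Gamma) (auto elim!: nonpos_Ints_cases)
  have 3: "?a + real k + 3/2 = real m + 1 + real k" "?a + 3/2 = real m + 1" by simp_all
  have "(y / x) / (f * (w / v)) = (y * g / w) / (x * g / v) / f" if "x > 0" "v > 0" "y > 0" "w > 0" "g > 0"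
    for x y f w v g :: real using that by (simp add: divide_simps)
  from this[OF G(1,2,3,4,5)] show ?thesis unfolding kummer_coeff_def Beta_def 1 2 3 .
qed

text \<open>Summing the moments gives Euler's integral of exp (z u) over the unit interval against a
  probability density, whose modulus is bounded in terms of Re z alone. The series bound exp |z|
  would not do at z = 2 s / \<beta> with small \<beta>, where it outgrows sin (pi s).\<close>

lemma kummer_bounded_on_vline:
  assumes m: "m \<ge> 1"
  shows "\<exists>C. \<forall>z. Re z = x \<longrightarrow> norm (kummer m z) \<le> C"
proof -
  let ?a = "real m - 1/2"
  have a: "?a > 0" using m by simp
  define B where "B = Beta ?a (3/2)"
  have B: "B > 0" unfolding B_def Beta_def using a by (auto intro!: divide_pos_pos mult_pos_pos Gamma_real_pos)
  define h where "h = (\<lambda>u::real. indicator {0..1} u * (u powr (?a - 1) * (1 - u) powr (3/2 - 1)))"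
  have hm [measurable]: "h \<in> borel_measurable borel" unfolding h_def by measurable
  have h0: "h u \<ge> 0" for u unfolding h_def by auto
  \<comment> \<open>\<open>h\<close> vanishes at 0 too because \<open>0 powr p = 0\<close>, so its
    support lies to the right of 0.\<close>
  have hs: "h u \<noteq> 0 \<Longrightarrow> 0 < u \<and> u \<le> 1" for u unfolding h_def by (auto simp: indicator_def split: if_splits)
  have pw: "h u * u ^ k = indicator {0..1} u * (u powr (?a + real k - 1) * (1 - u) powr (3/2 - 1))" for u k
  proof (cases "u > 0")
    case True
    then have "u powr (?a + real k - 1) = u powr (?a - 1) * u ^ k"
      by (simp add: powr_add[symmetric] powr_realpow[symmetric] algebra_simps)
    then show ?thesis by (simp add: h_def)
  qed (auto simp: h_def indicator_def)
  have hk: "integrable lborel (\<lambda>u. h u * u ^ k)" "(LINT u|lborel. h u * u ^ k) = Beta (?a + real k) (3/2)" for k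
  proof -
    have i: "set_integrable lborel {0..1} (\<lambda>u. u powr (?a + real k - 1) * (1 - u) powr (3/2 - 1))"
      using a by (intro integrable_Beta) auto
    then show "integrable lborel (\<lambda>u. h u * u ^ k)" unfolding pw set_integrable_def by simp
    have "(LINT u:{0..1}|lborel. u powr (?a + real k - 1) * (1 - u) powr (3/2 - 1)) = Beta (?a + real k) (3/2)"
      using a by (subst set_borel_integral_eq_integral(2)[OF i], intro integral_unique has_integral_Beta_real) auto
    then show "(LINT u|lborel. h u * u ^ k) = Beta (?a + real k) (3/2)" unfolding pw set_lebesgue_integral_def by simp
  qed
  have hi: "integrable lborel h" using hk(1)[of 0] by simp
  have rep: "kummer m z = (LINT u|lborel. of_real (h u) * exp (z * of_real u)) / of_real B" for z
  proof -
    define f where "f = (\<lambda>k u. complex_of_real (h u * u ^ k) * (z ^ k / of_real (fact k)))"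
    have nf: "norm (f k u) = h u * u ^ k * (norm z ^ k / fact k)" for k u
      using h0[of u] hs[of u] by (cases "h u = 0") (auto simp: f_def norm_mult norm_divide norm_power abs_mult)
    have fi: "integrable lborel (f k)" for k unfolding f_def by (intro integrable_mult_left integrable_of_real hk)
    have sm: "summable (\<lambda>k. B * (norm z ^ k /\<^sub>R fact k))" by (intro summable_mult summable_exp_generic)
    \<comment> \<open>Termwise integration is justified by u^k \<le> 1 on the support of
      \<open>h\<close>: the integrals of the norms are at most B |z|^k / k!.\<close>
    have "(\<lambda>k. LINT u|lborel. f k u) sums (LINT u|lborel. (\<Sum>k. f k u))"
    proof (rule sums_integral[OF fi])
      show "AE u in lborel. summable (\<lambda>k. norm (f k u))"
      proof (intro AE_I2)
        fix u
        have "summable (\<lambda>k. h u * ((u * norm z) ^ k /\<^sub>R fact k))" by (intro summable_mult summable_exp_generic)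
        then show "summable (\<lambda>k. norm (f k u))" unfolding nf
          by (simp add: power_mult_distrib divide_inverse mult_ac)
      qed
      show "summable (\<lambda>k. LINT u|lborel. norm (f k u))"
      proof (rule summable_comparison_test'[OF sm, where N=0])
        fix k
        have "(LINT u|lborel. norm (f k u)) \<le> (LINT u|lborel. h u * u ^ 0 * (norm z ^ k / fact k))"
        proof (rule integral_mono)
          show "integrable lborel (\<lambda>u. norm (f k u))" using fi by (rule integrable_norm)
          show "integrable lborel (\<lambda>u. h u * u ^ 0 * (norm z ^ k / fact k))" using hk(1)[of 0] by (intro integrable_mult_left)
          show "norm (f k u) \<le> h u * u ^ 0 * (norm z ^ k / fact k)" for u
          proof -
            have "h u * u ^ k \<le> h u * u ^ 0"
              using h0[of u] hs[of u] by (cases "h u = 0") (auto intro!: mult_left_le power_le_one)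
            then show ?thesis unfolding nf by (intro mult_right_mono) auto
          qed
        qed
        also have "\<dots> = B * (norm z ^ k /\<^sub>R fact k)"
          unfolding integral_mult_left_zero hk(2) of_nat_0 add_0_right B_def[symmetric]
          by (simp add: divide_inverse mult.commute)
        finally show "norm (LINT u|lborel. norm (f k u)) \<le> B * (norm z ^ k /\<^sub>R fact k)" by simp
      qed
    qed
    moreover have "(LINT u|lborel. f k u) = of_real B * (of_real (kummer_coeff m k) * z ^ k)" for k
    proof -
      have "(LINT u|lborel. f k u) = of_real (LINT u|lborel. h u * u ^ k) * (z ^ k / of_real (fact k))"
        unfolding f_def integral_mult_left_zero integral_complex_of_real ..
      then show ?thesis unfolding hk(2) kummer_coeff_Beta[OF m] B_def[symmetric] using B by simp
    qed
    moreover have "(\<Sum>k. f k u) = of_real (h u) * exp (z * of_real u)" for u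
    proof -
      have "(\<lambda>k. of_real (h u) * ((z * of_real u) ^ k /\<^sub>R fact k)) sums (of_real (h u) * exp (z * of_real u))"
        by (intro sums_mult exp_converges)
      moreover have "(\<lambda>k. of_real (h u) * ((z * of_real u) ^ k /\<^sub>R fact k)) = (\<lambda>k. f k u)"
        by (rule ext) (simp add: f_def power_mult_distrib scaleR_conv_of_real divide_inverse mult_ac)
      ultimately show ?thesis by (simp add: sums_iff)
    qed
    ultimately have "(\<lambda>k. of_real B * (of_real (kummer_coeff m k) * z ^ k)) sums (LINT u|lborel. of_real (h u) * exp (z * of_real u))"
      by simp
    moreover have "(\<lambda>k. of_real B * (of_real (kummer_coeff m k) * z ^ k)) sums (of_real B * kummer m z)"
      unfolding kummer_def by (intro sums_mult pser_sums exp_bounded_kummer m)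
    ultimately have "of_real B * kummer m z = (LINT u|lborel. of_real (h u) * exp (z * of_real u))"
      by (rule sums_unique2[rotated])
    then show ?thesis using B by (simp add: field_simps)
  qed
  have "norm (kummer m z) \<le> (LINT u|lborel. h u * exp \<bar>x\<bar>) / B" if z: "Re z = x" for z
  proof -
    have b: "norm (of_real (h u) * exp (z * of_real u)) \<le> h u * exp \<bar>x\<bar>" for u
    proof (cases "h u = 0")
      case False
      then have u: "0 < u" "u \<le> 1" using hs by auto
      have "x * u \<le> \<bar>x\<bar> * 1" using u by (intro mult_mono) auto
      then show ?thesis using h0[of u] z by (simp add: norm_mult mult_left_mono)
    qed simp
    have i: "integrable lborel (\<lambda>u. h u * exp \<bar>x\<bar>)" by (intro integrable_mult_left hi)
    have "integrable lborel (\<lambda>u. of_real (h u) * exp (z * of_real u))"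
    proof (rule Bochner_Integration.integrable_bound[OF i])
      show "AE u in lborel. norm (of_real (h u) * exp (z * of_real u)) \<le> norm (h u * exp \<bar>x\<bar>)"
        unfolding real_norm_def by (intro AE_I2 order_trans[OF b abs_ge_self])
    qed measurable
    then have "norm (LINT u|lborel. of_real (h u) * exp (z * of_real u)) \<le> (LINT u|lborel. h u * exp \<bar>x\<bar>)"
      by (intro Bochner_Integration.integral_norm_bound_integral i b)
    then show ?thesis unfolding rep norm_divide using B by (simp add: divide_right_mono)
  qed
  then show ?thesis by blast
qed

section \<open>The series of \<open>F_P\<close> and \<open>F_Q\<close> as Kummer series at 2 s /
  \<beta>\<close>

lemma pser_scale: "pser (\<lambda>k. a k * r ^ k) s = pser a (of_real r * s)"
  unfolding pser_def by (simp add: power_mult_distrib mult.assoc)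

lemma exp_bounded_scale:
  assumes "exp_bounded a"
  shows "exp_bounded (\<lambda>k. a k * r ^ k)"
proof -
  obtain C q where b: "\<And>k. \<bar>a k\<bar> \<le> C * q ^ k / fact k" using assms by (auto simp: exp_bounded_def)
  show ?thesis
  proof (rule exp_boundedI)
    fix k
    have "\<bar>a k * r ^ k\<bar> \<le> C * q ^ k / fact k * \<bar>r ^ k\<bar>" unfolding abs_mult by (intro mult_right_mono b) auto
    then show "\<bar>a k * r ^ k\<bar> \<le> C * (q * \<bar>r\<bar>) ^ k / fact k" by (simp add: power_abs power_mult_distrib mult_ac)
  qed
qed

lemma FD_P_kummer: "FD_P m \<beta> = (\<lambda>k. kummer_coeff m k * (2 / \<beta>) ^ k)"
  by (rule ext) (simp add: FD_P_def kummer_coeff_def)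

text \<open>The sum is written as a difference with the factor -1 so that \<open>pser_diff\<close>
  and \<open>exp_bounded_diff\<close> apply.\<close>

lemma FD_Q_kummer: "FD_Q m \<beta> = (\<lambda>k. (ln (2 / \<beta>) * kummer_coeff m k - (- 1) * (psi_coeff m k * kummer_coeff m k)) * (2 / \<beta>) ^ k)"
  by (rule ext) (simp add: FD_Q_def FD_P_kummer psi_coeff_def algebra_simps)

lemma pser_FD_P: "pser (FD_P m \<beta>) s = kummer m (of_real (2 / \<beta>) * s)"
  unfolding FD_P_kummer pser_scale kummer_def ..

lemma pser_FD_Q:
  assumes m: "m \<ge> 1"
  shows "pser (FD_Q m \<beta>) s = of_real (ln (2 / \<beta>)) * kummer m (of_real (2 / \<beta>) * s) + kummer_psi m (of_real (2 / \<beta>) * s)"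
  unfolding FD_Q_kummer pser_scale
  by (subst pser_diff) (use m in \<open>simp_all add: pser_cmult[of _ "-1", simplified] pser_cmult exp_bounded_cmult exp_bounded_kummer
      exp_bounded_kummer_psi exp_bounded_cmult[of _ "-1", simplified] kummer_def kummer_psi_def\<close>)

lemma exp_bounded_FD_P: "m \<ge> 1 \<Longrightarrow> exp_bounded (FD_P m \<beta>)"
  unfolding FD_P_kummer by (intro exp_bounded_scale exp_bounded_kummer)

lemma exp_bounded_FD_Q: "m \<ge> 1 \<Longrightarrow> exp_bounded (FD_Q m \<beta>)"
  unfolding FD_Q_kummer by (intro exp_bounded_scale exp_bounded_diff exp_bounded_cmult exp_bounded_kummer exp_bounded_kummer_psi)

text \<open>Scaling by the positive number 2 / \<beta> does not cross the branch cut, so ln (2 s /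
  \<beta>) = ln (2 / \<beta>) + ln s. This is the split into two parts: ln s goes to P, while ln (2
  / \<beta>) joins the digamma terms in Q.\<close>

lemma kummer_log_FD:
  assumes m: "m \<ge> 1" and \<beta>: "\<beta> > 0" and s: "Re s > 0"
  shows "ln s * pser (FD_P m \<beta>) s + pser (FD_Q m \<beta>) s = kummer_log m (of_real (2 / \<beta>) * s)"
proof -
  have "s \<noteq> 0" using s by auto
  then have "ln (of_real (2 / \<beta>) * s) = of_real (ln (2 / \<beta>)) + ln s"
    using \<beta> Ln_times_of_real[of "2 / \<beta>" s] Ln_of_real[of "2 / \<beta>"] by (simp only:) simp
  then show ?thesis unfolding pser_FD_P pser_FD_Q[OF m] kummer_log_def by (simp only: algebra_simps)
qed

lemma norm_Complex_le: "norm (Complex c t) \<le> \<bar>c\<bar> + \<bar>t\<bar>"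
  using cmod_le[of "Complex c t"] by simp

text \<open>The rate 1/2 is a budget: it leaves 3/2 for powers and tails of series, so that the
  total rate 2 stays below pi.\<close>

lemma norm_ln_vline_le:
  assumes c: "0 < c"
  shows "norm (ln (Complex c t)) \<le> (\<bar>ln c\<bar> + c + pi + 2) * exp (1/2 * \<bar>t\<bar>)"
proof -
  have nz: "Complex c t \<noteq> 0" using c by (auto simp: complex_eq_iff)
  have ge: "c \<le> norm (Complex c t)" using complex_Re_le_cmod[of "Complex c t"] by simp
  have le: "norm (Complex c t) \<le> c + \<bar>t\<bar>" using norm_Complex_le[of c t] c by simp
  have "ln c \<le> ln (norm (Complex c t))" using ge c by (subst ln_le_cancel_iff) linarith+
  moreover have "ln (norm (Complex c t)) \<le> norm (Complex c t)" using ln_le_minus_one[of "norm (Complex c t)"] ge c by linarith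
  ultimately have "\<bar>ln (norm (Complex c t))\<bar> \<le> \<bar>ln c\<bar> + c + \<bar>t\<bar>" using le c by linarith
  moreover have "\<bar>Im (ln (Complex c t))\<bar> \<le> pi" using mpi_less_Im_Ln[OF nz] Im_Ln_le_pi[OF nz] by simp
  ultimately have "norm (ln (Complex c t)) \<le> (\<bar>ln c\<bar> + c + pi) + \<bar>t\<bar>"
    using cmod_le[of "ln (Complex c t)"] Re_Ln[OF nz] by simp
  also have "\<dots> \<le> (\<bar>ln c\<bar> + c + pi) * exp (1/2 * \<bar>t\<bar>) + 2 * exp (1/2 * \<bar>t\<bar>)"
  proof (rule add_mono)
    have "(\<bar>ln c\<bar> + c + pi) * 1 \<le> (\<bar>ln c\<bar> + c + pi) * exp (1/2 * \<bar>t\<bar>)"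
      using c pi_gt_zero by (intro mult_left_mono) auto
    then show "\<bar>ln c\<bar> + c + pi \<le> (\<bar>ln c\<bar> + c + pi) * exp (1/2 * \<bar>t\<bar>)" by simp
    show "\<bar>t\<bar> \<le> 2 * exp (1/2 * \<bar>t\<bar>)" using exp_ge_add_one_self[of "1/2 * \<bar>t\<bar>"] by linarith
  qed
  finally show ?thesis by (simp add: algebra_simps)
qed

lemma measurable_ln_vline [measurable]:
  assumes c: "0 < c"
  shows "(\<lambda>t. ln (Complex c t)) \<in> borel_measurable borel"
proof -
  have "continuous_on UNIV (\<lambda>t. ln (Complex c t))"
    using c by (intro continuous_intros) (auto simp: complex_nonpos_Reals_iff)
  then show ?thesis by (rule borel_measurable_continuous_onI)
qed

lemma measurable_pser_vline:
  assumes "exp_bounded a"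
  shows "(\<lambda>t. pser a (Complex c t)) \<in> borel_measurable borel"
  by (intro borel_measurable_continuous_onI continuous_intros assms)

section \<open>The integral representation\<close>

text \<open>The Fermi factor is dominated by exp \<eta> times exp (- x), a Laplace kernel at
  abscissa 1.\<close>

lemma fermi_integrable:
  assumes f: "laplaceable f"
  shows "set_integrable lborel {0<..} (\<lambda>x. f x / (exp (x - \<eta>) + 1))"
proof -
  have [measurable]: "f \<in> borel_measurable borel" using f by (rule laplaceable_measurable)
  have "set_integrable lborel {0<..} (\<lambda>x. exp \<eta> * (f x * exp (- (1 * x))))"
    by (intro set_integrable_mult_right laplaceableD f) simp
  then show ?thesis
  proof (rule set_integrable_bound)
    show "set_borel_measurable lborel {0<..} (\<lambda>x. f x / (exp (x - \<eta>) + 1))"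
      unfolding set_borel_measurable_def by measurable
    show "AE x in lborel. x \<in> {0<..} \<longrightarrow> norm (f x / (exp (x - \<eta>) + 1)) \<le> norm (exp \<eta> * (f x * exp (- (1 * x))))"
    proof (intro AE_I2 impI)
      fix x :: real
      have "norm (f x / (exp (x - \<eta>) + 1)) = \<bar>f x\<bar> / (exp (x - \<eta>) + 1)"
        by (simp add: abs_of_pos add_pos_pos)
      also have "\<dots> \<le> \<bar>f x\<bar> / exp (x - \<eta>)" by (intro divide_left_mono) (auto intro!: add_pos_pos mult_pos_pos)
      also have "\<dots> = norm (exp \<eta> * (f x * exp (- (1 * x))))"
        by (simp add: abs_mult exp_diff exp_minus divide_inverse mult_ac)
      finally show "norm (f x / (exp (x - \<eta>) + 1)) \<le> norm (exp \<eta> * (f x * exp (- (1 * x))))" .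
    qed
  qed
qed

lemma laplaceable_sum:
  assumes "\<And>j. j \<in> A \<Longrightarrow> laplaceable (f j)"
  shows "laplaceable (\<lambda>u. \<Sum>j\<in>A. f j u)"
  using assms
proof (induction A rule: infinite_finite_induct)
  case (insert x F)
  then show ?case by (simp add: laplaceable_add)
qed (use laplaceable_cmult[OF laplaceable_power, of 0 0] in simp_all)

lemma laplace_sum:
  assumes "\<And>j. j \<in> A \<Longrightarrow> laplaceable (f j)" and "Re z > 0"
  shows "laplace (\<lambda>u. \<Sum>j\<in>A. f j u) z = (\<Sum>j\<in>A. laplace (f j) z)"
  using assms
proof (induction A rule: infinite_finite_induct)
  case (insert x F)
  then show ?case by (simp add: laplace_add laplaceable_sum)
qed (use laplace_cmult[of 0 "\<lambda>_. 0"] in simp_all)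

section \<open>Matching the constants and isolating the logarithmic part\<close>

lemma binom_half_neq_0: "binom_half m \<noteq> 0"
proof -
  have "- (1/2) + real k \<noteq> 0" for k :: nat
  proof
    assume "- (1/2) + real k = 0"
    then have "real (2 * k) = real 1" by simp
    then have "2 * k = 1" by (simp only: of_nat_eq_iff)
    then show False by presburger
  qed
  then have "pochhammer (-1/2 :: real) m \<noteq> 0"
    by (auto simp: pochhammer_eq_0_iff add_eq_0_iff2)
  then show ?thesis by (simp add: binom_half_def)
qed

text \<open>From Gamma (m - 1/2) = (-1/2)_m Gamma (-1/2): the prefactors of the theorem combine to
  the coefficient of \<open>kummer_log\<close> in \<open>laplace_fd_weight\<close>.\<close>

lemma Gamma_FD_A:
  "Gamma (real m - 1/2) * FD_A m = - binom_half m"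
proof -
  have h: "(-1/2 :: real) \<notin> \<int>\<^sub>\<le>\<^sub>0"
  proof
    assume "(-1/2 :: real) \<in> \<int>\<^sub>\<le>\<^sub>0"
    then obtain n :: nat where "-1/2 = - real n" by (auto elim!: nonpos_Ints_cases')
    then have "real (2 * n) = real 1" by simp
    then have "2 * n = 1" by (simp only: of_nat_eq_iff)
    then show False by presburger
  qed
  have "pochhammer (-1/2) m = Gamma (-1/2 + real m) / Gamma (-1/2 :: real)"
    using h by (rule pochhammer_Gamma)
  moreover have "Gamma (-1/2 :: real) \<noteq> 0" using h by (simp add: Gamma_eq_zero_iff)
  ultimately have "Gamma (real m - 1/2) = pochhammer (-1/2) m * Gamma (-1/2)" by (simp add: field_simps)
  then show ?thesis using \<open>Gamma (-1/2 :: real) \<noteq> 0\<close> by (simp add: FD_A_def binom_half_def)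
qed

lemma fd_weight_scale:
  assumes \<beta>: "\<beta> > 0" and x: "x > 0"
  shows "(2 / \<beta>) powr (real m - 3/2) * fd_weight m (\<beta> / 2 * x) = x powr (real m - 3/2) * sqrt (1 + \<beta> * x / 2)"
proof -
  have "(2 / \<beta>) powr (real m - 3/2) * (\<beta> / 2 * x) powr (real m - 3/2) = (2 / \<beta> * (\<beta> / 2 * x)) powr (real m - 3/2)"
    using \<beta> x by (intro powr_mult[symmetric])
  also have "2 / \<beta> * (\<beta> / 2 * x) = x" using \<beta> by simp
  finally show ?thesis unfolding fd_weight_def by simp
qed

text \<open>The part of the weight that grows at infinity, whose Laplace transform yields \<open>F_R\<close>, is subtracted.\<close>

definition fd_remainder :: "nat \<Rightarrow> real \<Rightarrow> real \<Rightarrow> real" where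
  "fd_remainder m \<beta> x = (2 / \<beta>) powr (real m - 3/2) * fd_weight m (\<beta> / 2 * x) -
     (\<Sum>j<m. binom_half j * (2 / \<beta>) powr (real j - 1/2) * x ^ (m - Suc j))"

lemma laplaceable_scale:
  assumes f: "laplaceable f" and a: "a > 0"
  shows "laplaceable (\<lambda>u. f (a * u))"
  unfolding laplaceable_def
proof (intro conjI allI impI)
  have [measurable]: "f \<in> borel_measurable borel" using f by (rule laplaceable_measurable)
  show "(\<lambda>u. f (a * u)) \<in> borel_measurable borel" by measurable
  fix x :: real assume x: "x > 0"
  then have "x / a > 0" using a by simp
  from laplaceableD[OF f this]
  have "integrable lborel (\<lambda>u. indicator {0<..} u *\<^sub>R (f u * exp (- (x / a * u))))"
    by (simp add: set_integrable_def)
  then have "integrable lborel (\<lambda>u. indicator {0<..} (0 + a * u) *\<^sub>R (f (0 + a * u) * exp (- (x / a * (0 + a * u)))))"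
    by (rule lborel_integrable_real_affine) (use a in simp)
  moreover have "0 < a * u \<longleftrightarrow> 0 < u" for u using a by (simp add: zero_less_mult_iff)
  ultimately show "set_integrable lborel {0<..} (\<lambda>u. f (a * u) * exp (- (x * u)))"
    using a by (simp add: set_integrable_def indicator_def)
qed

lemma laplaceable_fd_remainder:
  assumes m: "m \<ge> 1" and \<beta>: "\<beta> > 0"
  shows "laplaceable (fd_remainder m \<beta>)"
  unfolding fd_remainder_def[abs_def]
  using assms by (intro laplaceable_diff laplaceable_cmult laplaceable_scale laplaceable_fd_weight laplaceable_sum laplaceable_power) auto

text \<open>The transforms of the subtracted powers make up the finite sum of
  \<open>laplace_fd_weight\<close> at 2 s / \<beta>, since the exponents combine to (j - 1/2) + (m -
  j) = m - 1/2. Only the logarithmic series is left.\<close>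

lemma laplace_fd_remainder:
  assumes m: "m \<ge> 1" and \<beta>: "\<beta> > 0" and s: "Re s > 0"
  shows "laplace (fd_remainder m \<beta>) s =
     - of_real (binom_half m * (2 / \<beta>) powr (real m - 1/2)) * kummer_log m (of_real (2 / \<beta>) * s)"
proof -
  let ?z = "of_real (2 / \<beta>) * s"
  have s0: "s \<noteq> 0" using s by auto
  have z: "Re ?z > 0" using s \<beta> by (simp del: of_real_divide)
  have r0: "complex_of_real (2 / \<beta>) \<noteq> 0" using \<beta> by simp
  have p1: "(2 / \<beta>) powr (real m - 1/2) = (2 / \<beta>) powr (real m - 3/2) * (2 / \<beta>)"
    using \<beta> powr_mult_base[of "2 / \<beta>" "real m - 3/2"] by (simp add: mult.commute)
  have "laplace (fd_remainder m \<beta>) s = laplace (\<lambda>x. (2 / \<beta>) powr (real m - 3/2) * fd_weight m (\<beta> / 2 * x)) s -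
     laplace (\<lambda>x. \<Sum>j<m. binom_half j * (2 / \<beta>) powr (real j - 1/2) * x ^ (m - Suc j)) s"
    unfolding fd_remainder_def[abs_def] using m \<beta> s
    by (intro laplace_diff laplaceable_cmult laplaceable_scale laplaceable_fd_weight laplaceable_sum laplaceable_power) auto
  also have "laplace (\<lambda>x. (2 / \<beta>) powr (real m - 3/2) * fd_weight m (\<beta> / 2 * x)) s =
     of_real ((2 / \<beta>) powr (real m - 1/2)) * laplace (fd_weight m) ?z"
  proof -
    have "s / of_real (\<beta> / 2) = ?z" using \<beta> by simp
    moreover have "laplace (fd_weight m) w / of_real (\<beta> / 2) = of_real (2 / \<beta>) * laplace (fd_weight m) w" for w
      using \<beta> by simp
    ultimately show ?thesis
      unfolding laplace_cmult laplace_scale[OF half_gt_zero[OF \<beta>]] p1 of_real_mult by (simp only: mult.assoc)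
  qed
  also have "laplace (\<lambda>x. \<Sum>j<m. binom_half j * (2 / \<beta>) powr (real j - 1/2) * x ^ (m - Suc j)) s =
     of_real ((2 / \<beta>) powr (real m - 1/2)) * (\<Sum>j<m. of_real (binom_half j * fact (m - Suc j)) / ?z ^ (m - j))"
    unfolding sum_distrib_left
  proof (subst laplace_sum[OF laplaceable_cmult[OF laplaceable_power] s], rule sum.cong[OF refl])
    fix j assume "j \<in> {..<m}"
    then have j: "j < m" by simp
    have "(2 / \<beta>) powr (real j - 1/2) * (2 / \<beta>) ^ (m - j) = (2 / \<beta>) powr (real m - 1/2)"
      using \<beta> j by (simp add: powr_realpow[symmetric] powr_add[symmetric] of_nat_diff)
    then have e: "complex_of_real ((2 / \<beta>) powr (real m - 1/2)) = of_real ((2 / \<beta>) powr (real j - 1/2)) * of_real (2 / \<beta>) ^ (m - j)"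
      by (metis of_real_mult of_real_power)
    have S: "Suc (m - Suc j) = m - j" using j by simp
    show "laplace (\<lambda>x. binom_half j * (2 / \<beta>) powr (real j - 1/2) * x ^ (m - Suc j)) s =
      of_real ((2 / \<beta>) powr (real m - 1/2)) * (of_real (binom_half j * fact (m - Suc j)) / ?z ^ (m - j))"
      unfolding laplace_cmult laplace_power[OF s] S e power_mult_distrib of_real_mult
      using r0 by (simp add: of_real_fact del: of_real_divide)
  qed
  also have "of_real ((2 / \<beta>) powr (real m - 1/2)) * laplace (fd_weight m) ?z -
     of_real ((2 / \<beta>) powr (real m - 1/2)) * (\<Sum>j<m. of_real (binom_half j * fact (m - Suc j)) / ?z ^ (m - j)) =
     - of_real (binom_half m * (2 / \<beta>) powr (real m - 1/2)) * kummer_log m ?z"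
    unfolding laplace_fd_weight[OF m z] by (simp only: ring_distribs of_real_mult) simp
  finally show ?thesis .
qed

lemma integrable_kernel:
  assumes c: "0 < c" "c < 1" and d: "d < pi"
    and m: "f \<in> borel_measurable borel"
    and bound: "\<And>t. norm (f t) \<le> C * exp (d * \<bar>t\<bar>)"
  shows "integrable lborel (\<lambda>t. exp (of_real \<eta> * Complex c t) * (of_real pi / sin (of_real pi * Complex c t)) * f t)"
    and "norm (LINT t|lborel. exp (of_real \<eta> * Complex c t) * (of_real pi / sin (of_real pi * Complex c t)) * f t) \<le>
       C * (exp (\<eta> * c) * pi * (2 / sin (pi * c) * (LINT t|lborel. exp (- ((pi - d) * \<bar>t\<bar>)))))"
proof -
  have [measurable]: "f \<in> borel_measurable borel" by fact
  let ?g = "\<lambda>t. exp (of_real \<eta> * Complex c t) * of_real pi * f t"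
  have e: "(\<lambda>t. exp (of_real \<eta> * Complex c t) * (of_real pi / sin (of_real pi * Complex c t)) * f t) =
     (\<lambda>t. ?g t / sin (of_real pi * Complex c t))" by (rule ext) simp
  have gm: "?g \<in> borel_measurable borel" by measurable
  have b: "norm (?g t) \<le> (C * (exp (\<eta> * c) * pi)) * exp (d * \<bar>t\<bar>)" for t
  proof -
    have "norm (?g t) = exp (\<eta> * c) * pi * norm (f t)" by (simp add: norm_mult)
    also have "\<dots> \<le> exp (\<eta> * c) * pi * (C * exp (d * \<bar>t\<bar>))" by (intro mult_left_mono bound) auto
    finally show ?thesis by (simp add: mult_ac)
  qed
  show "integrable lborel (\<lambda>t. exp (of_real \<eta> * Complex c t) * (of_real pi / sin (of_real pi * Complex c t)) * f t)"
    unfolding e by (rule integrable_over_sin(1)[OF c d gm b])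
  show "norm (LINT t|lborel. exp (of_real \<eta> * Complex c t) * (of_real pi / sin (of_real pi * Complex c t)) * f t) \<le>
       C * (exp (\<eta> * c) * pi * (2 / sin (pi * c) * (LINT t|lborel. exp (- ((pi - d) * \<bar>t\<bar>)))))"
    unfolding e using integrable_over_sin(2)[OF c d gm b] by (simp only: mult.assoc)
qed

lemma integrable_FD_P:
  assumes c: "0 < c" "c < 1" and m: "m \<ge> 1"
  shows "integrable lborel (\<lambda>t. exp (of_real \<eta> * Complex c t) * (of_real pi / sin (of_real pi * Complex c t)) *
     (ln (Complex c t) * pser (FD_P m \<beta>) (Complex c t)))"
proof -
  obtain C where C: "\<And>z. Re z = 2 / \<beta> * c \<Longrightarrow> norm (kummer m z) \<le> C"
    using kummer_bounded_on_vline[OF m] by metis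
  have k: "norm (pser (FD_P m \<beta>) (Complex c t)) \<le> C" for t
    unfolding pser_FD_P by (rule C) (simp del: of_real_divide)
  have C0: "C \<ge> 0" using k[of 0] norm_ge_zero order_trans by blast
  show ?thesis
  proof (rule integrable_kernel(1)[OF c, where d="1/2" and C="(\<bar>ln c\<bar> + c + pi + 2) * C"])
    show "norm (ln (Complex c t) * pser (FD_P m \<beta>) (Complex c t)) \<le> (\<bar>ln c\<bar> + c + pi + 2) * C * exp (1/2 * \<bar>t\<bar>)" for t
    proof -
      have "norm (ln (Complex c t) * pser (FD_P m \<beta>) (Complex c t)) \<le> ((\<bar>ln c\<bar> + c + pi + 2) * exp (1/2 * \<bar>t\<bar>)) * C"
        unfolding norm_mult using c by (intro mult_mono norm_ln_vline_le k order_trans[OF norm_ge_zero norm_ln_vline_le] norm_ge_zero)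
      then show ?thesis by (simp add: mult_ac)
    qed
    show "(\<lambda>t. ln (Complex c t) * pser (FD_P m \<beta>) (Complex c t)) \<in> borel_measurable borel"
      by (intro borel_measurable_times measurable_ln_vline measurable_pser_vline exp_bounded_FD_P c m)
    show "1 / 2 < pi" using pi_gt3 by simp
  qed
qed

text \<open>The sum of both series is, up to the constant \<open>D\<close>, the transform of
  \<open>fd_remainder\<close>, which is bounded on the line by the absolute integral
  \<open>K\<close>. Dividing by \<open>D\<close> is possible because the binomial coefficients of
  1/2 never vanish.\<close>

lemma integrable_FD_PQ:
  assumes c: "0 < c" "c < 1" and m: "m \<ge> 1" and \<beta>: "\<beta> > 0"
  shows "integrable lborel (\<lambda>t. exp (of_real \<eta> * Complex c t) * (of_real pi / sin (of_real pi * Complex c t)) *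
     (ln (Complex c t) * pser (FD_P m \<beta>) (Complex c t) + pser (FD_Q m \<beta>) (Complex c t)))" (is "integrable _ (\<lambda>t. _ * ?f t)")
proof -
  define K where "K = (LINT u:{0<..}|lborel. \<bar>fd_remainder m \<beta> u\<bar> * exp (- (c * u)))"
  define D where "D = binom_half m * (2 / \<beta>) powr (real m - 1/2)"
  have D: "D \<noteq> 0" using \<beta> binom_half_neq_0 by (simp add: D_def)
  have b: "norm (?f t) \<le> K / \<bar>D\<bar> * exp (0 * \<bar>t\<bar>)" for t
  proof -
    have s: "Re (Complex c t) > 0" using c by simp
    have "norm (laplace (fd_remainder m \<beta>) (Complex c t)) \<le> K"
      using norm_laplace_le[OF laplaceable_fd_remainder[OF m \<beta>] s] by (simp add: K_def)
    then have "\<bar>D\<bar> * norm (?f t) \<le> K"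
      unfolding laplace_fd_remainder[OF m \<beta> s] kummer_log_FD[OF m \<beta> s] D_def[symmetric] by (simp add: norm_mult)
    then show ?thesis using D by (simp add: pos_le_divide_eq mult.commute)
  qed
  show ?thesis
    by (rule integrable_kernel(1)[OF c pi_gt_zero _ b])
       (intro borel_measurable_times borel_measurable_add measurable_ln_vline measurable_pser_vline exp_bounded_FD_P exp_bounded_FD_Q c m)
qed

theorem fermi_dirac_representation:
  assumes c: "0 < c" "c < 1" and m: "m \<ge> 1" and \<beta>: "\<beta> > 0"
  shows "complex_of_real (rel_fermi_dirac (real m - 3/2) \<eta> \<beta>) =
            of_real (Gamma (real m - 1/2) * (2 / \<beta>) powr (real m - 1/2)) *
              (F_P m c \<eta> \<beta> + F_Q m c \<eta> \<beta>) + of_real (F_R m \<eta> \<beta>)"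
proof -
  let ?K = "\<lambda>t. exp (of_real \<eta> * Complex c t) * (of_real pi / sin (of_real pi * Complex c t))"
  let ?P = "\<lambda>t. ln (Complex c t) * pser (FD_P m \<beta>) (Complex c t)"
  let ?Q = "\<lambda>t. pser (FD_Q m \<beta>) (Complex c t)"
  define D where "D = (2 / \<beta>) powr (real m - 1/2)"
  have iP: "integrable lborel (\<lambda>t. ?K t * ?P t)" by (rule integrable_FD_P[OF c m])
  have iPQ: "integrable lborel (\<lambda>t. ?K t * (?P t + ?Q t))" by (rule integrable_FD_PQ[OF c m \<beta>])
  \<comment> \<open>The Q part inherits integrability from the sum and the P part, so no estimate of
    the digamma series on the line enters for fixed \<beta>.\<close>
  have eQ: "(\<lambda>t. ?K t * ?Q t) = (\<lambda>t. ?K t * (?P t + ?Q t) - ?K t * ?P t)" by (rule ext) (simp only: ring_distribs, simp)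
  have iQ: "integrable lborel (\<lambda>t. ?K t * ?Q t)" unfolding eQ by (intro Bochner_Integration.integrable_diff iP iPQ)
  have PQ: "(LINT t|lborel. ?K t * ?P t) + (LINT t|lborel. ?K t * ?Q t) = (LINT t|lborel. ?K t * (?P t + ?Q t))"
    by (subst Bochner_Integration.integral_add[OF iP iQ, symmetric]) (simp only: ring_distribs)
  \<comment> \<open>The factor \<open>\<i>\<close> in \<open>vline_integral\<close> cancels the one
    in 1 / (2 pi i).\<close>
  have FP: "F_P m c \<eta> \<beta> = of_real (FD_A m) / of_real (2 * pi) * (LINT t|lborel. ?K t * ?P t)"
    unfolding F_P_def vline_integral_def pser_def[symmetric] by (simp add: mult.assoc)
  have FQ: "F_Q m c \<eta> \<beta> = of_real (FD_A m) / of_real (2 * pi) * (LINT t|lborel. ?K t * ?Q t)"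
    unfolding F_Q_def vline_integral_def pser_def[symmetric] by (simp add: mult.assoc)
  have "of_real (Gamma (real m - 1/2) * D) * (F_P m c \<eta> \<beta> + F_Q m c \<eta> \<beta>) =
      of_real (Gamma (real m - 1/2) * FD_A m * D) / of_real (2 * pi) * (LINT t|lborel. ?K t * (?P t + ?Q t))"
    unfolding FP FQ PQ[symmetric] by (simp add: ring_distribs mult_ac)
  also have "Gamma (real m - 1/2) * FD_A m * D = - (binom_half m * D)" unfolding Gamma_FD_A by simp
  also have "of_real (- (binom_half m * D)) / of_real (2 * pi) * (LINT t|lborel. ?K t * (?P t + ?Q t)) =
      (LINT t|lborel. of_real (- (binom_half m * D)) * (?K t * (?P t + ?Q t))) / of_real (2 * pi)"
    unfolding integral_mult_right_zero by (simp only: times_divide_eq_left)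
  also have "(\<lambda>t. of_real (- (binom_half m * D)) * (?K t * (?P t + ?Q t))) =
     (\<lambda>t. exp (of_real \<eta> * Complex c t) * of_real pi * laplace (fd_remainder m \<beta>) (Complex c t) / sin (of_real pi * Complex c t))"
  proof
    fix t
    have s: "Re (Complex c t) > 0" using c by simp
    show "of_real (- (binom_half m * D)) * (?K t * (?P t + ?Q t)) =
      exp (of_real \<eta> * Complex c t) * of_real pi * laplace (fd_remainder m \<beta>) (Complex c t) / sin (of_real pi * Complex c t)"
      unfolding laplace_fd_remainder[OF m \<beta> s] kummer_log_FD[OF m \<beta> s] D_def by (simp del: of_real_mult)
  qed
  also have "(LINT t|lborel. exp (of_real \<eta> * Complex c t) * of_real pi * laplace (fd_remainder m \<beta>) (Complex c t) / sin (of_real pi * Complex c t)) / of_real (2 * pi)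
     = of_real (LINT x:{0<..}|lborel. fd_remainder m \<beta> x / (exp (x - \<eta>) + 1))"
    unfolding laplace_fermi[OF laplaceable_fd_remainder[OF m \<beta>] c] by simp
  also have "(LINT x:{0<..}|lborel. fd_remainder m \<beta> x / (exp (x - \<eta>) + 1)) =
      rel_fermi_dirac (real m - 3/2) \<eta> \<beta> - F_R m \<eta> \<beta>"
  proof -
    let ?w = "\<lambda>x. (2 / \<beta>) powr (real m - 3/2) * fd_weight m (\<beta> / 2 * x)"
    let ?p = "\<lambda>j x. binom_half j * (2 / \<beta>) powr (real j - 1/2) * x ^ (m - Suc j)"
    have i1: "set_integrable lborel {0<..} (\<lambda>x. ?w x / (exp (x - \<eta>) + 1))"
      using m \<beta> by (intro fermi_integrable laplaceable_cmult laplaceable_scale laplaceable_fd_weight) auto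
    have i2: "set_integrable lborel {0<..} (\<lambda>x. ?p j x / (exp (x - \<eta>) + 1))" for j
      by (intro fermi_integrable laplaceable_cmult laplaceable_power)
    have i3: "set_integrable lborel {0<..} (\<lambda>x. (\<Sum>j<m. ?p j x) / (exp (x - \<eta>) + 1))"
      by (intro fermi_integrable laplaceable_sum laplaceable_cmult laplaceable_power)
    have "(LINT x:{0<..}|lborel. fd_remainder m \<beta> x / (exp (x - \<eta>) + 1)) =
       (LINT x:{0<..}|lborel. ?w x / (exp (x - \<eta>) + 1)) - (LINT x:{0<..}|lborel. (\<Sum>j<m. ?p j x) / (exp (x - \<eta>) + 1))"
      unfolding fd_remainder_def diff_divide_distrib by (rule set_integral_diff(2)[OF i1 i3])
    also have "(LINT x:{0<..}|lborel. ?w x / (exp (x - \<eta>) + 1)) = rel_fermi_dirac (real m - 3/2) \<eta> \<beta>"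
      unfolding rel_fermi_dirac_def
    proof (rule set_lebesgue_integral_cong)
      show "\<forall>x. x \<in> {0<..} \<longrightarrow> ?w x / (exp (x - \<eta>) + 1) = x powr (real m - 3/2) * sqrt (1 + \<beta> * x / 2) / (exp (x - \<eta>) + 1)"
        by (intro allI impI arg_cong2[where f="(/)"] refl fd_weight_scale[OF \<beta>]) (simp only: greaterThan_iff)
    qed simp
    also have "(LINT x:{0<..}|lborel. (\<Sum>j<m. ?p j x) / (exp (x - \<eta>) + 1)) = (\<Sum>j<m. LINT x:{0<..}|lborel. ?p j x / (exp (x - \<eta>) + 1))"
      unfolding sum_divide_distrib set_lebesgue_integral_def scaleR_sum_right
      using i2 by (intro Bochner_Integration.integral_sum) (simp add: set_integrable_def)
    also have "\<dots> = F_R m \<eta> \<beta>"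
      unfolding F_R_def
    proof (rule sum.cong[OF refl])
      fix j assume "j \<in> {..<m}"
      then have j: "real (m - Suc j) = real m - real j - 1" by (simp add: of_nat_diff)
      \<comment> \<open>Natural powers and \<open>powr\<close> agree on the open half-line, also for
        exponent 0, which occurs at j = m - 1.\<close>
      have "(LINT x:{0<..}|lborel. ?p j x / (exp (x - \<eta>) + 1)) =
        (LINT x:{0<..}|lborel. binom_half j * (2 / \<beta>) powr (real j - 1/2) * (x powr (real m - real j - 1) / (exp (x - \<eta>) + 1)))"
        by (intro set_lebesgue_integral_cong) (auto simp: powr_realpow[symmetric] j)
      then show "(LINT x:{0<..}|lborel. ?p j x / (exp (x - \<eta>) + 1)) = (-1) ^ j * (pochhammer (-1/2) j / fact j) *
         (2 / \<beta>) powr (real j - 1/2) * fermi_dirac (real m - real j - 1) \<eta>"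
        unfolding fermi_dirac_def binom_half_def set_integral_mult_right .
    qed
    finally show ?thesis .
  qed
  finally show ?thesis unfolding D_def by simp
qed

section \<open>The asymptotic expansions\<close>

lemma power_le_fact_exp:
  assumes x: "(x::real) \<ge> 0"
  shows "x ^ k \<le> fact k * exp x"
proof -
  have "(\<lambda>n. x ^ n /\<^sub>R fact n) sums exp x" by (rule exp_converges)
  then have "sum (\<lambda>n. x ^ n /\<^sub>R fact n) {k} \<le> exp x"
    using x sum_le_suminf[of "\<lambda>n. x ^ n /\<^sub>R fact n" "{k}"] by (simp add: sums_iff)
  then have "x ^ k / fact k \<le> exp x" by (simp add: divide_inverse mult.commute)
  then show ?thesis by (simp add: divide_le_eq mult.commute)
qed

text \<open>Common core of both expansions: \<open>L\<close> is the logarithm or the constant 1, and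
  \<open>g\<close> collects the dependence of the coefficients on \<beta> beyond the power
  \<beta>^(-k). Inside the integral the series is cut after \<open>N\<close> terms, and
  \<open>pser_tail\<close> bounds the rest by g(\<beta>) \<beta>^(-N) times a function whose
  integral against the kernel converges and does not depend on \<beta>.\<close>

lemma vline_pser_asymp:
  fixes \<eta> c r B C :: real and L :: "complex \<Rightarrow> complex" and a :: "real \<Rightarrow> nat \<Rightarrow> real" and g :: "real \<Rightarrow> real"
  assumes c: "0 < c" "c < 1" and r: "r > 0"
    and Lm: "(\<lambda>t. L (Complex c t)) \<in> borel_measurable borel"
    and Lb: "\<And>t. norm (L (Complex c t)) \<le> C * exp (1/2 * \<bar>t\<bar>)"
    and a: "\<And>\<beta> k. \<beta> \<ge> B \<Longrightarrow> \<bar>a \<beta> k\<bar> \<le> g \<beta> * (r / \<beta>) ^ k / fact k"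
    and g0: "\<And>\<beta>. \<beta> \<ge> B \<Longrightarrow> g \<beta> \<ge> 0"
  defines "J \<equiv> \<lambda>h. vline_integral c (\<lambda>s. exp (of_real \<eta> * s) * (of_real pi / sin (of_real pi * s)) * (L s * h s))"
  shows "(\<lambda>\<beta>. J (pser (a \<beta>)) - (\<Sum>k<N. of_real (a \<beta> k) * J (\<lambda>s. s ^ k))) \<in> O[at_top](\<lambda>\<beta>. of_real (g \<beta> / \<beta> ^ N))"
proof -
  let ?K = "\<lambda>t. exp (of_real \<eta> * Complex c t) * (of_real pi / sin (of_real pi * Complex c t))"
  have d2: "(2::real) < pi" using pi_gt3 by simp
  have C0: "C \<ge> 0" using order_trans[OF norm_ge_zero Lb[of 0]] by simp
  have s: "norm (Complex c t) \<le> c + \<bar>t\<bar>" for t using norm_Complex_le[of c t] c by simp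
  have ip: "integrable lborel (\<lambda>t. ?K t * (L (Complex c t) * Complex c t ^ k))" for k
  proof (rule integrable_kernel(1)[OF c d2, where C="C * (fact k * exp c)"])
    show "(\<lambda>t. L (Complex c t) * Complex c t ^ k) \<in> borel_measurable borel" using Lm by measurable
    fix t
    have "norm (Complex c t) ^ k \<le> fact k * exp (norm (Complex c t))" by (rule power_le_fact_exp) simp
    also have "\<dots> \<le> fact k * exp (c + \<bar>t\<bar>)" using s[of t] by (intro mult_left_mono) auto
    finally have "norm (L (Complex c t) * Complex c t ^ k) \<le> (C * exp (1/2 * \<bar>t\<bar>)) * (fact k * exp (c + \<bar>t\<bar>))"
      unfolding norm_mult norm_power using C0 by (intro mult_mono Lb) auto
    also have "\<dots> = C * (fact k * exp c) * exp (3/2 * \<bar>t\<bar>)"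
      by (simp add: exp_add[symmetric] mult_ac)
    also have "\<dots> \<le> C * (fact k * exp c) * exp (2 * \<bar>t\<bar>)" using C0 by (intro mult_left_mono) auto
    finally show "norm (L (Complex c t) * Complex c t ^ k) \<le> C * (fact k * exp c) * exp (2 * \<bar>t\<bar>)" .
  qed
  define R where "R = C * r ^ N * (fact N * exp (3/2 * c)) * (exp (\<eta> * c) * pi * (2 / sin (pi * c) * (LINT t|lborel. exp (- ((pi - 2) * \<bar>t\<bar>)))))"
  show ?thesis
  proof (rule bigoI)
    show "eventually (\<lambda>\<beta>. norm (J (pser (a \<beta>)) - (\<Sum>k<N. of_real (a \<beta> k) * J (\<lambda>s. s ^ k))) \<le> R * norm (complex_of_real (g \<beta> / \<beta> ^ N))) at_top"
      using eventually_ge_at_top[of B] eventually_ge_at_top[of "2 * r"]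
    proof eventually_elim
      case (elim \<beta>)
      then have \<beta>: "\<beta> > 0" using r by linarith
      have gb: "g \<beta> \<ge> 0" using g0 elim by simp
      have ea: "exp_bounded (a \<beta>)" using a[OF elim(1)] by (rule exp_boundedI)
      let ?T = "\<lambda>s. pser (a \<beta>) s - (\<Sum>k<N. of_real (a \<beta> k) * s ^ k)"
      have tb: "norm (L (Complex c t) * ?T (Complex c t)) \<le> (C * r ^ N * (fact N * exp (3/2 * c)) * (g \<beta> / \<beta> ^ N)) * exp (2 * \<bar>t\<bar>)" for t
      proof -
        let ?n = "norm (Complex c t)"
        have "norm (?T (Complex c t)) \<le> g \<beta> * (r / \<beta> * ?n) ^ N * exp (r / \<beta> * ?n)"
          using \<beta> r by (intro pser_tail a elim) auto
        also have "\<dots> = g \<beta> / \<beta> ^ N * r ^ N * (?n ^ N * exp (r / \<beta> * ?n))"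
          by (simp add: power_mult_distrib power_divide)
        also have "\<dots> \<le> g \<beta> / \<beta> ^ N * r ^ N * (fact N * exp ?n * exp (1/2 * ?n))"
        proof (intro mult_left_mono mult_mono)
          show "?n ^ N \<le> fact N * exp ?n" by (rule power_le_fact_exp) simp
          \<comment> \<open>Here \<beta> \<ge> 2 r enters. The tail costs rate 1/2, the N-th power
            rate 1 and \<open>L\<close> rate 1/2; the sum 2 is still below pi.\<close>
          have "r / \<beta> \<le> 1/2" using elim(2) \<beta> by (simp add: divide_le_eq)
          then have "r / \<beta> * ?n \<le> 1/2 * ?n" by (intro mult_right_mono) auto
          then show "exp (r / \<beta> * ?n) \<le> exp (1/2 * ?n)" by simp
        qed (use gb r \<beta> in auto)
        also have "\<dots> = g \<beta> / \<beta> ^ N * r ^ N * (fact N * exp (3/2 * ?n))"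
          by (simp add: exp_add[symmetric])
        also have "\<dots> \<le> g \<beta> / \<beta> ^ N * r ^ N * (fact N * exp (3/2 * (c + \<bar>t\<bar>)))"
          using gb r \<beta> s[of t] by (intro mult_left_mono) auto
        finally have "norm (L (Complex c t) * ?T (Complex c t)) \<le>
           (C * exp (1/2 * \<bar>t\<bar>)) * (g \<beta> / \<beta> ^ N * r ^ N * (fact N * exp (3/2 * (c + \<bar>t\<bar>))))"
          unfolding norm_mult using C0 by (intro mult_mono Lb) auto
        also have "\<dots> = C * r ^ N * (fact N * exp (3/2 * c)) * (g \<beta> / \<beta> ^ N) * (exp (1/2 * \<bar>t\<bar>) * exp (3/2 * \<bar>t\<bar>))"
          unfolding distrib_left[of "3/2" c] exp_add by (simp only: mult_ac)
        also have "exp (1/2 * \<bar>t\<bar>) * exp (3/2 * \<bar>t\<bar>) = exp (2 * \<bar>t\<bar>)" by (simp add: exp_add[symmetric])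
        finally show ?thesis .
      qed
      have mT: "(\<lambda>t. L (Complex c t) * ?T (Complex c t)) \<in> borel_measurable borel"
        by (intro borel_measurable_times borel_measurable_diff Lm measurable_pser_vline ea) measurable
      have iT: "integrable lborel (\<lambda>t. ?K t * (L (Complex c t) * ?T (Complex c t)))"
        by (rule integrable_kernel(1)[OF c d2 mT tb])
      have iS: "integrable lborel (\<lambda>t. (\<Sum>k<N. of_real (a \<beta> k) * (?K t * (L (Complex c t) * Complex c t ^ k))))"
        by (intro Bochner_Integration.integrable_sum integrable_mult_right ip)
      have "(\<lambda>t. ?K t * (L (Complex c t) * pser (a \<beta>) (Complex c t))) =
        (\<lambda>t. ?K t * (L (Complex c t) * ?T (Complex c t)) + (\<Sum>k<N. of_real (a \<beta> k) * (?K t * (L (Complex c t) * Complex c t ^ k))))"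
      proof
        fix t
        have "(\<Sum>k<N. of_real (a \<beta> k) * (?K t * (L (Complex c t) * Complex c t ^ k))) =
          ?K t * (L (Complex c t) * (\<Sum>k<N. of_real (a \<beta> k) * Complex c t ^ k))"
          unfolding sum_distrib_left by (intro sum.cong refl) (simp only: mult_ac)
        then show "?K t * (L (Complex c t) * pser (a \<beta>) (Complex c t)) =
          ?K t * (L (Complex c t) * ?T (Complex c t)) + (\<Sum>k<N. of_real (a \<beta> k) * (?K t * (L (Complex c t) * Complex c t ^ k)))"
          by (simp only: right_diff_distrib) simp
      qed
      then have "J (pser (a \<beta>)) = \<i> * ((LINT t|lborel. ?K t * (L (Complex c t) * ?T (Complex c t))) +
          (LINT t|lborel. (\<Sum>k<N. of_real (a \<beta> k) * (?K t * (L (Complex c t) * Complex c t ^ k)))))"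
        unfolding J_def vline_integral_def by (simp only: Bochner_Integration.integral_add[OF iT iS])
      also have "(LINT t|lborel. (\<Sum>k<N. of_real (a \<beta> k) * (?K t * (L (Complex c t) * Complex c t ^ k)))) =
          (\<Sum>k<N. of_real (a \<beta> k) * (LINT t|lborel. ?K t * (L (Complex c t) * Complex c t ^ k)))"
        by (subst Bochner_Integration.integral_sum) (intro integrable_mult_right ip, simp only: integral_mult_right_zero)
      finally have "J (pser (a \<beta>)) - (\<Sum>k<N. of_real (a \<beta> k) * J (\<lambda>s. s ^ k)) =
          \<i> * (LINT t|lborel. ?K t * (L (Complex c t) * ?T (Complex c t)))"
        unfolding J_def vline_integral_def distrib_left sum_distrib_left by (simp add: mult.left_commute)
      then have "norm (J (pser (a \<beta>)) - (\<Sum>k<N. of_real (a \<beta> k) * J (\<lambda>s. s ^ k))) =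
          norm (LINT t|lborel. ?K t * (L (Complex c t) * ?T (Complex c t)))"
        by (simp only: norm_mult norm_ii mult_1_left)
      also have "\<dots> \<le> (C * r ^ N * (fact N * exp (3/2 * c)) * (g \<beta> / \<beta> ^ N)) *
          (exp (\<eta> * c) * pi * (2 / sin (pi * c) * (LINT t|lborel. exp (- ((pi - 2) * \<bar>t\<bar>)))))"
        by (rule integrable_kernel(2)[OF c d2 mT tb])
      also have "\<dots> = R * norm (complex_of_real (g \<beta> / \<beta> ^ N))"
        unfolding norm_of_real R_def using gb \<beta> by (simp add: abs_of_nonneg mult_ac)
      finally show ?case .
    qed
  qed
qed

section \<open>Coefficient bounds and the two expansions\<close>

lemma FD_P_le:
  assumes m: "m \<ge> 1" and \<beta>: "\<beta> > 0"
  shows "\<bar>FD_P m \<beta> k\<bar> \<le> (2 / \<beta>) ^ k / fact k"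
proof -
  have "\<bar>FD_P m \<beta> k\<bar> = kummer_coeff m k * (2 / \<beta>) ^ k"
    unfolding FD_P_kummer using \<beta> kummer_coeff_nonneg[OF m, of k] by (simp add: abs_mult)
  also have "\<dots> \<le> (1 / fact k) * (2 / \<beta>) ^ k"
    using \<beta> by (intro mult_right_mono kummer_coeff_le m) auto
  finally show ?thesis by simp
qed

text \<open>For \<beta> \<ge> 3 > e one has ln \<beta> \<ge> 1, so the logarithm and the digamma
  part are both at most a multiple of ln \<beta> (k + 1). The inequality k + 1 \<le> 2^k then turns
  2 / \<beta> into 4 / \<beta>.\<close>

lemma FD_Q_le:
  assumes m: "m \<ge> 1"
  shows "\<exists>K\<ge>0. \<forall>\<beta>\<ge>3. \<forall>k. \<bar>FD_Q m \<beta> k\<bar> \<le> (K * ln \<beta>) * (4 / \<beta>) ^ k / fact k"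
proof -
  obtain K where K: "\<And>k. \<bar>psi_coeff m k\<bar> \<le> K * real (Suc k)" using psi_coeff_bound[OF m] by blast
  have K0: "K \<ge> 0" using order_trans[OF abs_ge_zero K[of 0]] by simp
  have "\<bar>FD_Q m \<beta> k\<bar> \<le> ((1 + K) * ln \<beta>) * (4 / \<beta>) ^ k / fact k" if \<beta>: "\<beta> \<ge> 3" for \<beta> k
  proof -
    have l1: "ln \<beta> \<ge> 1" using exp_le \<beta> ln_ge_iff[of \<beta> 1] by simp
    have "\<bar>ln (2 / \<beta>)\<bar> \<le> ln \<beta>"
    proof -
      have "ln (2 / \<beta>) = ln 2 - ln \<beta>" using \<beta> by (simp add: ln_div)
      moreover have "ln 2 \<ge> (0::real)" "ln 2 \<le> ln \<beta>" using \<beta> by simp_all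
      ultimately show ?thesis by linarith
    qed
    then have "\<bar>ln (2 / \<beta>) + psi_coeff m k\<bar> \<le> ln \<beta> + K * real (Suc k)" using K[of k] by linarith
    also have "\<dots> \<le> ln \<beta> * real (Suc k) + K * (ln \<beta> * real (Suc k))"
    proof (rule add_mono)
      show "ln \<beta> \<le> ln \<beta> * real (Suc k)" using l1 mult_left_mono[of 1 "real (Suc k)" "ln \<beta>"] by simp
      have "1 * real (Suc k) \<le> ln \<beta> * real (Suc k)" using l1 by (intro mult_right_mono) auto
      then show "K * real (Suc k) \<le> K * (ln \<beta> * real (Suc k))" using K0 by (intro mult_left_mono) auto
    qed
    also have "\<dots> = ((1 + K) * ln \<beta>) * real (Suc k)" by (simp add: algebra_simps)
    also have "\<dots> \<le> ((1 + K) * ln \<beta>) * 2 ^ k" using K0 l1 by (intro mult_left_mono Suc_le_two_power) auto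
    finally have b: "\<bar>ln (2 / \<beta>) + psi_coeff m k\<bar> \<le> ((1 + K) * ln \<beta>) * 2 ^ k" .
    have "FD_Q m \<beta> k = FD_P m \<beta> k * (ln (2 / \<beta>) + psi_coeff m k)"
      by (simp add: FD_Q_def psi_coeff_def algebra_simps)
    then have "\<bar>FD_Q m \<beta> k\<bar> = \<bar>FD_P m \<beta> k\<bar> * \<bar>ln (2 / \<beta>) + psi_coeff m k\<bar>" by (simp only: abs_mult)
    also have "\<dots> \<le> ((2 / \<beta>) ^ k / fact k) * (((1 + K) * ln \<beta>) * 2 ^ k)"
      using \<beta> by (intro mult_mono FD_P_le m b) auto
    also have "\<dots> = ((1 + K) * ln \<beta>) * (2 / \<beta> * 2) ^ k / fact k"
      unfolding power_mult_distrib[of "2 / \<beta>"] by (simp only: times_divide_eq_left times_divide_eq_right mult_ac)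
    finally show ?thesis by simp
  qed
  then show ?thesis using K0 by (intro exI[of _ "1 + K"]) auto
qed

text \<open>The factor pi is moved into the kernel, so that \<open>FD_Psi\<close> gets the
  normalisation 1 / (2 pi i) of \<open>F_P\<close> and the integrand the shape of
  \<open>vline_pser_asymp\<close>.\<close>

lemma FD_Psi_vline:
  "FD_Psi c \<eta> k = 1 / (2 * of_real pi * \<i>) *
     vline_integral c (\<lambda>s. exp (of_real \<eta> * s) * (of_real pi / sin (of_real pi * s)) * (ln s * s ^ k))"
proof -
  have "(\<lambda>t. exp (of_real \<eta> * Complex c t) * (of_real pi / sin (of_real pi * Complex c t)) * (ln (Complex c t) * Complex c t ^ k)) =
    (\<lambda>t. of_real pi * (ln (Complex c t) * exp (of_real \<eta> * Complex c t) * Complex c t ^ k / sin (of_real pi * Complex c t)))"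
    by (rule ext) (simp add: mult_ac)
  then show ?thesis unfolding FD_Psi_def vline_integral_def by (simp only: integral_mult_right_zero) simp
qed

text \<open>The factor 1 takes the place of \<open>L\<close> in
  \<open>vline_pser_asymp\<close>.\<close>

lemma FD_Phi1_vline:
  "FD_Phi1 c \<eta> k = 1 / (2 * of_real pi * \<i>) *
     vline_integral c (\<lambda>s. exp (of_real \<eta> * s) * (of_real pi / sin (of_real pi * s)) * (1 * s ^ k))"
proof -
  have "(\<lambda>t. exp (of_real \<eta> * Complex c t) * (of_real pi / sin (of_real pi * Complex c t)) * (1 * Complex c t ^ k)) =
    (\<lambda>t. of_real pi * (exp (of_real \<eta> * Complex c t) * Complex c t ^ k / sin (of_real pi * Complex c t)))"
    by (rule ext) (simp add: mult_ac)
  then show ?thesis unfolding FD_Phi1_def vline_integral_def by (simp only: integral_mult_right_zero) simp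
qed

lemma F_P_asymp:
  assumes m: "m \<ge> 1" and c: "0 < c" "c < 1"
  shows "(\<lambda>\<beta>. F_P m c \<eta> \<beta> - of_real (FD_A m) * (\<Sum>k<N. of_real (FD_Pt m k / \<beta> ^ k) * FD_Psi c \<eta> k))
            \<in> O[at_top](\<lambda>\<beta>. of_real (1 / \<beta> ^ N))"
proof -
  let ?J = "\<lambda>h. vline_integral c (\<lambda>s. exp (of_real \<eta> * s) * (of_real pi / sin (of_real pi * s)) * (ln s * h s))"
  have "(\<lambda>\<beta>. ?J (pser (FD_P m \<beta>)) - (\<Sum>k<N. of_real (FD_P m \<beta> k) * ?J (\<lambda>s. s ^ k))) \<in> O[at_top](\<lambda>\<beta>. of_real (1 / \<beta> ^ N))"
    by (rule vline_pser_asymp[OF c, where r=2 and B=1 and g="\<lambda>_. 1", OF _ measurable_ln_vline[OF c(1)] norm_ln_vline_le[OF c(1)]])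
       (use FD_P_le[OF m] in simp_all)
  then have "(\<lambda>\<beta>. of_real (FD_A m) / (2 * of_real pi * \<i>) * (?J (pser (FD_P m \<beta>)) - (\<Sum>k<N. of_real (FD_P m \<beta> k) * ?J (\<lambda>s. s ^ k))))
      \<in> O[at_top](\<lambda>\<beta>. of_real (1 / \<beta> ^ N))"
    using landau_o.big.mult[OF bigo_const] by fastforce
  moreover have "of_real (FD_A m) / (2 * of_real pi * \<i>) * (?J (pser (FD_P m \<beta>)) - (\<Sum>k<N. of_real (FD_P m \<beta> k) * ?J (\<lambda>s. s ^ k))) =
     F_P m c \<eta> \<beta> - of_real (FD_A m) * (\<Sum>k<N. of_real (FD_Pt m k / \<beta> ^ k) * FD_Psi c \<eta> k)" for \<beta>
  proof -
    have "FD_P m \<beta> k = FD_Pt m k / \<beta> ^ k" for k by (simp add: FD_P_def FD_Pt_def power_divide)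
    then have p: "of_real (FD_Pt m k / \<beta> ^ k) = complex_of_real (FD_P m \<beta> k)" for k by simp
    have F: "F_P m c \<eta> \<beta> = of_real (FD_A m) / (2 * of_real pi * \<i>) * ?J (pser (FD_P m \<beta>))"
      unfolding F_P_def pser_def by (simp only: mult.assoc mult_1_left)
    \<comment> \<open>The rearrangement is proved for abstract coefficients and integrals, which
      then match the actual ones without any rewriting under the integral sign.\<close>
    have "A / D * (j0 - (\<Sum>k<N. p k * j k)) = A / D * j0 - A * (\<Sum>k<N. p k * (1 / D * j k))"
      for A D j0 :: complex and p j :: "nat \<Rightarrow> complex"
      by (simp add: right_diff_distrib sum_distrib_left mult_ac)
    then show ?thesis unfolding F FD_Psi_vline p .
  qed
  ultimately show ?thesis by (simp only:)
qed

lemma F_Q_asymp: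
  assumes m: "m \<ge> 1" and c: "0 < c" "c < 1"
  shows "(\<lambda>\<beta>. F_Q m c \<eta> \<beta> - of_real (FD_A m) * (\<Sum>k<N. of_real (FD_Qt m \<beta> k / \<beta> ^ k) * FD_Phi1 c \<eta> k))
            \<in> O[at_top](\<lambda>\<beta>. of_real (ln \<beta> / \<beta> ^ N))"
proof -
  let ?J = "\<lambda>h. vline_integral c (\<lambda>s. exp (of_real \<eta> * s) * (of_real pi / sin (of_real pi * s)) * (1 * h s))"
  obtain K where K: "K \<ge> 0" "\<And>\<beta> k. \<beta> \<ge> 3 \<Longrightarrow> \<bar>FD_Q m \<beta> k\<bar> \<le> (K * ln \<beta>) * (4 / \<beta>) ^ k / fact k"
    using FD_Q_le[OF m] by blast
  have "(\<lambda>\<beta>. ?J (pser (FD_Q m \<beta>)) - (\<Sum>k<N. of_real (FD_Q m \<beta> k) * ?J (\<lambda>s. s ^ k))) \<in> O[at_top](\<lambda>\<beta>. of_real (K * ln \<beta> / \<beta> ^ N))"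
    \<comment> \<open>Here g(\<beta>) = K ln \<beta> with the rate 4 and the threshold 3 of
      \<open>FD_Q_le\<close>; the constant \<open>K\<close> is absorbed afterwards.\<close>
    by (rule vline_pser_asymp[OF c, where r=4 and B=3 and C=1]) (use K c in simp_all)
  also have "(\<lambda>\<beta>. complex_of_real (K * ln \<beta> / \<beta> ^ N)) \<in> O[at_top](\<lambda>\<beta>. of_real (ln \<beta> / \<beta> ^ N))"
    by (rule bigoI[where c=K]) (use K(1) in \<open>simp add: norm_mult norm_divide abs_mult\<close>)
  finally have "(\<lambda>\<beta>. of_real (FD_A m) / (2 * of_real pi * \<i>) * (?J (pser (FD_Q m \<beta>)) - (\<Sum>k<N. of_real (FD_Q m \<beta> k) * ?J (\<lambda>s. s ^ k))))
      \<in> O[at_top](\<lambda>\<beta>. of_real (ln \<beta> / \<beta> ^ N))"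
    using landau_o.big.mult[OF bigo_const] by fastforce
  moreover have "of_real (FD_A m) / (2 * of_real pi * \<i>) * (?J (pser (FD_Q m \<beta>)) - (\<Sum>k<N. of_real (FD_Q m \<beta> k) * ?J (\<lambda>s. s ^ k))) =
     F_Q m c \<eta> \<beta> - of_real (FD_A m) * (\<Sum>k<N. of_real (FD_Qt m \<beta> k / \<beta> ^ k) * FD_Phi1 c \<eta> k)" for \<beta>
  proof -
    have "FD_Q m \<beta> k = FD_Qt m \<beta> k / \<beta> ^ k" for k by (simp add: FD_Q_def FD_Qt_def FD_P_def FD_Pt_def power_divide)
    then have p: "of_real (FD_Qt m \<beta> k / \<beta> ^ k) = complex_of_real (FD_Q m \<beta> k)" for k by simp
    have F: "F_Q m c \<eta> \<beta> = of_real (FD_A m) / (2 * of_real pi * \<i>) * ?J (pser (FD_Q m \<beta>))"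
      unfolding F_Q_def pser_def by (simp only: mult.assoc mult_1_left)
    have "A / D * (j0 - (\<Sum>k<N. p k * j k)) = A / D * j0 - A * (\<Sum>k<N. p k * (1 / D * j k))"
      for A D j0 :: complex and p j :: "nat \<Rightarrow> complex"
      by (simp add: right_diff_distrib sum_distrib_left mult_ac)
    then show ?thesis unfolding F FD_Phi1_vline p .
  qed
  ultimately show ?thesis by (simp only:)
qed

theorem lemma5p3:
  fixes \<eta> q c :: real and m :: nat
  assumes "m \<ge> 2" and "q = real m - 3/2" and "0 < c" and "c < 1"
  shows "(\<forall>\<beta>>0. complex_of_real (rel_fermi_dirac q \<eta> \<beta>) =
            of_real (Gamma (real m - 1/2) * (2 / \<beta>) powr (real m - 1/2)) *
              (F_P m c \<eta> \<beta> + F_Q m c \<eta> \<beta>) + of_real (F_R m \<eta> \<beta>))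
    \<and> (\<forall>N. (\<lambda>\<beta>. F_P m c \<eta> \<beta> -
              of_real (FD_A m) * (\<Sum>k<N. of_real (FD_Pt m k / \<beta> ^ k) * FD_Psi c \<eta> k))
            \<in> O[at_top](\<lambda>\<beta>. of_real (1 / \<beta> ^ N)))
    \<and> (\<forall>N. (\<lambda>\<beta>. F_Q m c \<eta> \<beta> -
              of_real (FD_A m) * (\<Sum>k<N. of_real (FD_Qt m \<beta> k / \<beta> ^ k) * FD_Phi1 c \<eta> k))
            \<in> O[at_top](\<lambda>\<beta>. of_real (ln \<beta> / \<beta> ^ N)))"
proof -
  have m: "m \<ge> 1" using assms(1) by simp
  show ?thesis
    unfolding assms(2) using fermi_dirac_representation[OF assms(3,4) m] F_P_asymp[OF m assms(3,4)] F_Q_asymp[OF m assms(3,4)]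
    by blast
qed

end
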